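(* For any Borel measurable subset $A\subset M$, $$\lim_{r\to0^+}\mu_{W_r}(A\times A)=C_{0,k}\,\mathrm{vol}(A).$$
   Context: $M$ is a smooth, compact, closed Riemannian manifold of dimension $k\ge1$ with geodesic distance $\mathrm{dist}$ and Riemannian volume $\mathrm{vol}$ (written $dx$). $K:[0,\infty)\to[0,\infty)$ satisfies $K(0)>0$, $K$ is non-increasing, and $\int_0^\infty K(t)t^n\,dt<\infty$ for all $n=1,2,\dots$. For $r>0$, $K_r(t)=r^{-k}K(t/r)$ and $W_r:M\times M\to[0,\infty)$, $W_r(x,y)=K_r(\mathrm{dist}(x,y))$. The measure $\mu_{W_r}$ on $M\times M$ is given by $\mu_{W_r}(A\times B)=\int_{A\times B}W_r(x,y)\,dx\,dy$ for measurable $A,B\subset M$. The constant is $C_{0,k}=\int_{\mathbb R^k}K(|x|)\,dx$, with $|x|$ the Euclidean norm. *)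

theory Defs
  imports "HOL-Analysis.Analysis"
begin

text \<open>\<open>smooth_on f S\<close> is meant for open \<open>S\<close>: all iterated directional derivatives of \<open>f\<close> exist
  as Frechet derivatives and are continuous on \<open>S\<close>.\<close>

fun Ck_on :: "nat \<Rightarrow> ('a::real_normed_vector \<Rightarrow> 'b::real_normed_vector) \<Rightarrow> 'a set \<Rightarrow> bool" where
  "Ck_on 0 f S \<longleftrightarrow> continuous_on S f"
| "Ck_on (Suc n) f S \<longleftrightarrow>
     (\<forall>x\<in>S. f differentiable (at x)) \<and> (\<forall>v. Ck_on n (\<lambda>x. frechet_derivative f (at x) v) S)"

definition smooth_on :: "('a::real_normed_vector \<Rightarrow> 'b::real_normed_vector) \<Rightarrow> 'a set \<Rightarrow> bool" where
  "smooth_on f S \<longleftrightarrow> (\<forall>n. Ck_on n f S)"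

text \<open>A manifold of dimension \<open>CARD('k)\<close> modelled on \<open>real ^ 'k\<close>: the underlying topological space
  \<open>mtop\<close>, an atlas of charts \<open>(chart_dom i, coord i)\<close> indexed by \<open>i \<in> index\<close>, and in each chart the matrix
  \<open>metric i x\<close> of the metric tensor at the point with coordinates \<open>x\<close>. Only the values of \<open>coord i\<close>
  on \<open>chart_dom i\<close>, and of \<open>metric i\<close> on \<open>coord i ` chart_dom i\<close>, are relevant.\<close>

record ('a, 'i, 'k) riemannian =
  mtop :: "'a topology"
  index :: "'i set"
  chart_dom :: "'i \<Rightarrow> 'a set"
  coord :: "'i \<Rightarrow> 'a \<Rightarrow> real ^ 'k"
  metric :: "'i \<Rightarrow> real ^ 'k \<Rightarrow> real ^ 'k ^ 'k"

definition transition ::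
  "('a, 'i, 'k::finite) riemannian \<Rightarrow> 'i \<Rightarrow> 'i \<Rightarrow> real ^ 'k \<Rightarrow> real ^ 'k" where
  "transition M i j = coord M j \<circ> inv_into (chart_dom M i) (coord M i)"

definition smooth_manifold :: "('a, 'i, 'k::finite) riemannian \<Rightarrow> bool" where
  "smooth_manifold M \<longleftrightarrow>
     Hausdorff_space (mtop M) \<and> second_countable (mtop M) \<and>
     topspace (mtop M) = (\<Union>i\<in>index M. chart_dom M i) \<and>
     (\<forall>i\<in>index M. openin (mtop M) (chart_dom M i) \<and> open (coord M i ` chart_dom M i) \<and>
        homeomorphic_map (subtopology (mtop M) (chart_dom M i))
          (top_of_set (coord M i ` chart_dom M i)) (coord M i)) \<and>
     (\<forall>i\<in>index M. \<forall>j\<in>index M.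
        smooth_on (transition M i j) (coord M i ` (chart_dom M i \<inter> chart_dom M j)))"

text \<open>The last condition is the transformation law of a covariant 2-tensor, which makes the local
  matrices the coordinate expressions of a single tensor field.\<close>

definition riemannian_manifold :: "('a, 'i, 'k::finite) riemannian \<Rightarrow> bool" where
  "riemannian_manifold M \<longleftrightarrow>
     smooth_manifold M \<and>
     (\<forall>i\<in>index M. smooth_on (metric M i) (coord M i ` chart_dom M i) \<and>
        (\<forall>x\<in>coord M i ` chart_dom M i.
           transpose (metric M i x) = metric M i x \<and>
           (\<forall>v. v \<noteq> 0 \<longrightarrow> v \<bullet> (metric M i x *v v) > 0))) \<and>
     (\<forall>i\<in>index M. \<forall>j\<in>index M. \<forall>x\<in>coord M i ` (chart_dom M i \<inter> chart_dom M j).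
        let J = matrix (frechet_derivative (transition M i j) (at x))
        in metric M i x = transpose J ** metric M j (transition M i j x) ** J)"

text \<open>There is no boundary, because charts have open images in \<open>real ^ 'k\<close>; hence compactness makes
  the manifold closed. Connectedness is not assumed.\<close>

definition closed_riemannian_manifold :: "('a, 'i, 'k::finite) riemannian \<Rightarrow> bool" where
  "closed_riemannian_manifold M \<longleftrightarrow> riemannian_manifold M \<and> compact_space (mtop M)"

definition C1_arc ::
  "('a, 'i, 'k::finite) riemannian \<Rightarrow> (real \<Rightarrow> 'a) \<Rightarrow> real \<Rightarrow> real \<Rightarrow> bool" where
  "C1_arc M \<gamma> a b \<longleftrightarrow>
     (\<forall>i\<in>index M. \<exists>D.
        (\<forall>t\<in>{a..b}. \<gamma> t \<in> chart_dom M i \<longrightarrow>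
           ((coord M i \<circ> \<gamma>) has_vector_derivative D t) (at t within {a..b})) \<and>
        continuous_on {t\<in>{a..b}. \<gamma> t \<in> chart_dom M i} D)"

definition piecewise_C1_curve :: "('a, 'i, 'k::finite) riemannian \<Rightarrow> (real \<Rightarrow> 'a) \<Rightarrow> bool" where
  "piecewise_C1_curve M \<gamma> \<longleftrightarrow>
     pathin (mtop M) \<gamma> \<and>
     (\<exists>n p. p 0 = 0 \<and> p n = 1 \<and>
        (\<forall>k<n. p k < p (Suc k) \<and> C1_arc M \<gamma> (p k) (p (Suc k))))"

definition chart_at :: "('a, 'i, 'k::finite) riemannian \<Rightarrow> 'a \<Rightarrow> 'i" where
  "chart_at M q = (SOME i. i \<in> index M \<and> q \<in> chart_dom M i)"

text \<open>The norm of the velocity, computed in an arbitrary chart around \<open>\<gamma> t\<close>; by the transformation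
  law of the metric the choice of chart is irrelevant.\<close>

definition speed :: "('a, 'i, 'k::finite) riemannian \<Rightarrow> (real \<Rightarrow> 'a) \<Rightarrow> real \<Rightarrow> real" where
  "speed M \<gamma> t =
     (let i = chart_at M (\<gamma> t); v = vector_derivative (coord M i \<circ> \<gamma>) (at t)
      in sqrt (v \<bullet> (metric M i (coord M i (\<gamma> t)) *v v)))"

definition curve_length :: "('a, 'i, 'k::finite) riemannian \<Rightarrow> (real \<Rightarrow> 'a) \<Rightarrow> ennreal" where
  "curve_length M \<gamma> = (\<integral>\<^sup>+t\<in>{0..1}. ennreal (speed M \<gamma> t) \<partial>lborel)"

text \<open>The value is \<open>\<infinity>\<close> exactly when the two points lie in different components.\<close>

definition geodesic_dist :: "('a, 'i, 'k::finite) riemannian \<Rightarrow> 'a \<Rightarrow> 'a \<Rightarrow> ennreal" where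
  "geodesic_dist M x y =
     (INF \<gamma>\<in>{\<gamma>. piecewise_C1_curve M \<gamma> \<and> \<gamma> 0 = x \<and> \<gamma> 1 = y}. curve_length M \<gamma>)"

definition borel_manifold :: "('a, 'i, 'k::finite) riemannian \<Rightarrow> 'a measure" where
  "borel_manifold M = sigma (topspace (mtop M)) {U. openin (mtop M) U}"

text \<open>The unique Borel measure that in each chart has density \<open>sqrt (det g)\<close> with respect to
  Lebesgue measure.\<close>

definition riemannian_volume :: "('a, 'i, 'k::finite) riemannian \<Rightarrow> 'a measure" where
  "riemannian_volume M =
     (THE \<nu>. sets \<nu> = sets (borel_manifold M) \<and>
        (\<forall>i\<in>index M. \<forall>A\<in>sets (borel_manifold M). A \<subseteq> chart_dom M i \<longrightarrow>
           emeasure \<nu> A =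
             (\<integral>\<^sup>+x\<in>coord M i ` A. ennreal (sqrt (det (metric M i x))) \<partial>lborel)))"

definition scaled_kernel :: "nat \<Rightarrow> (real \<Rightarrow> real) \<Rightarrow> real \<Rightarrow> real \<Rightarrow> real" where
  "scaled_kernel k K r t = K (t / r) / r ^ k"

text \<open>Points at infinite distance get weight \<open>0\<close>, the limit of \<open>K\<close> at infinity.\<close>

definition kernel_weight ::
  "('a, 'i, 'k::finite) riemannian \<Rightarrow> (real \<Rightarrow> real) \<Rightarrow> real \<Rightarrow> 'a \<Rightarrow> 'a \<Rightarrow> real" where
  "kernel_weight M K r x y =
     (if geodesic_dist M x y = \<infinity> then 0
      else scaled_kernel CARD('k) K r (enn2real (geodesic_dist M x y)))"

definition kernel_measure ::
  "('a, 'i, 'k::finite) riemannian \<Rightarrow> (real \<Rightarrow> real) \<Rightarrow> real \<Rightarrow> ('a \<times> 'a) measure" where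
  "kernel_measure M K r =
     density (riemannian_volume M \<Otimes>\<^sub>M riemannian_volume M)
       (\<lambda>(x, y). ennreal (kernel_weight M K r x y))"

text \<open>The dimension is passed as the type argument of \<open>itself\<close>.\<close>

definition kernel_constant :: "'k::finite itself \<Rightarrow> (real \<Rightarrow> real) \<Rightarrow> ennreal" where
  "kernel_constant _ K = (\<integral>\<^sup>+x. ennreal (K (norm (x :: real ^ 'k))) \<partial>lborel)"

end

theory Submission
  imports Defs
begin

text \<open>In coordinates around \<open>p\<close> that are orthonormal for the metric at \<open>p\<close>, the geodesic distance and the
  volume agree with their Euclidean counterparts up to factors \<open>1 \<plusminus> \<epsilon>\<close>, while everything outside the
  chart has distance bounded below from \<open>p\<close>. Scaling and the decay of \<open>K\<close> then show that
  \<open>\<integral> W\<^sub>r(x, y) dy\<close> is bounded uniformly in \<open>x\<close> and \<open>r\<close>, and tends to \<open>C\<^sub>0\<^sub>,\<^sub>k\<close> for every \<open>x\<close>; hence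
  \<open>\<mu>(A \<times> M) \<rightarrow> C\<^sub>0\<^sub>,\<^sub>k vol A\<close>. The sets \<open>A\<close> with \<open>\<mu>(A \<times> (M - A)) \<rightarrow> 0\<close> form a \<open>\<sigma>\<close>-algebra (this uses the
  symmetry of the distance) that contains the open sets, so this holds for all Borel sets.\<close>

text \<open>At a boundary point of \<open>A\<close> the integral of the kernel over \<open>A\<close>
  need not approach the constant, and the boundary of a Borel set may have positive volume. Hence
  the mass of \<open>A\<close> times \<open>A\<close> is found by subtraction: the whole row has a
  limit at every point, and the mass crossing from \<open>A\<close> to its complement is shown to
  vanish. For an open set every point has positive distance from the complement, so dominated
  convergence applies. For countable unions the bound uniform in \<open>x\<close> and
  \<open>r\<close> turns small volume into small mass for all \<open>r\<close> at once; the tail of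
  the union can therefore be cut off before \<open>r\<close> tends to 0. Distances are estimated
  through lengths of curves, from above by coordinate segments and from below by integrating the
  velocity, with a first-exit argument for curves that leave the chart. The limit in
  \<open>r\<close> is taken at fixed \<epsilon>: it confines the row integral between the constant
  times \<open>(1 - \<epsilon>) / (1 + \<epsilon>) ^ k\<close> and the constant times
  \<open>(1 + \<epsilon>) / (1 - \<epsilon>) ^ k\<close>, and \<epsilon> is arbitrary.\<close>

section \<open>Change of variables\<close>

text \<open>HOL-Analysis has the change of variables theorem only for well-ordered index types; it is
  transferred to an arbitrary finite index type along a bijection with \<open>'k idx\<close>.\<close>

typedef ('k::finite) idx = "{..<CARD('k)}"
  by (rule exI[of _ 0]) simp

instantiation idx :: (finite) linorder
begin
definition less_eq_idx :: "'a idx \<Rightarrow> 'a idx \<Rightarrow> bool" where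
  "less_eq_idx x y \<longleftrightarrow> Rep_idx x \<le> Rep_idx y"
definition less_idx :: "'a idx \<Rightarrow> 'a idx \<Rightarrow> bool" where
  "less_idx x y \<longleftrightarrow> Rep_idx x < Rep_idx y"
instance
  by standard (auto simp: less_eq_idx_def less_idx_def Rep_idx_inject)

end

lemma idx_UNIV: "(UNIV :: ('k::finite) idx set) = Abs_idx ` {..<CARD('k)}"
  by (metis type_definition.Abs_image type_definition_idx)

instance idx :: (finite) finite
  by standard (simp add: idx_UNIV)

instance idx :: (finite) wellorder
proof
  fix P :: "'a idx \<Rightarrow> bool" and a
  assume step: "\<And>x. (\<And>y. y < x \<Longrightarrow> P y) \<Longrightarrow> P x"
  show "P a"
    by (induction a rule: measure_induct_rule[where f = Rep_idx])
      (use step in \<open>auto simp: less_idx_def\<close>)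
qed

lemma card_idx: "CARD(('k::finite) idx) = CARD('k)"
  by (simp add: idx_UNIV card_image inj_on_def Abs_idx_inject)

text \<open>Conjugation with \<open>f\<close> matches the permutations of the two index types and
  preserves signs, so the two Leibniz sums agree term by term.\<close>

lemma det_reindex:
  fixes A :: "real^'k^'k" and f :: "'j::finite \<Rightarrow> 'k::finite"
  assumes f: "bij f"
  shows "det (\<chi> i j. A $ f i $ f j) = det A"
proof -
  let ?U = "UNIV :: 'j set" and ?V = "UNIV :: 'k set"
  have bb: "bij_betw f ?U ?V" using f by simp
  have "det A = (\<Sum>p\<in>{p. p permutes ?U}.
      of_int (sign (map_permutation ?U f p)) * (\<Prod>i\<in>?V. A $ i $ map_permutation ?U f p i))"
    unfolding det_def
  proof (rule sum.reindex_bij_betw[symmetric])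
    let ?g = "inv f"
    have gb: "bij_betw ?g ?V ?U" using bij_imp_bij_inv[OF f] by simp
    show "bij_betw (map_permutation ?U f) {p. p permutes ?U} {p. p permutes ?V}"
    proof (rule bij_betwI[where g = "map_permutation ?V ?g"])
      show "map_permutation ?U f \<in> {p. p permutes ?U} \<rightarrow> {p. p permutes ?V}"
        using map_permutation_permutes[OF bb] by blast
      show "map_permutation ?V ?g \<in> {p. p permutes ?V} \<rightarrow> {p. p permutes ?U}"
        using map_permutation_permutes[OF gb] by blast
      show "map_permutation ?V ?g (map_permutation ?U f x) = x" if "x \<in> {p. p permutes ?U}" for x
        by (rule map_permutation_compose_inv[OF bb]) (use that f in \<open>auto simp: bij_is_inj\<close>)
      show "map_permutation ?U f (map_permutation ?V ?g x) = x" if "x \<in> {p. p permutes ?V}" for x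
        by (rule map_permutation_compose_inv[OF gb])
          (use that f in \<open>auto simp: bij_is_surj surj_f_inv_f\<close>)
    qed
  qed
  also have "\<dots> = (\<Sum>p\<in>{p. p permutes ?U}. of_int (sign p) * (\<Prod>i\<in>?U. A $ f i $ f (p i)))"
  proof (rule sum.cong[OF refl])
    fix p assume p: "p \<in> {p. p permutes ?U}"
    have "(\<Prod>i\<in>?V. A $ i $ map_permutation ?U f p i) = (\<Prod>i\<in>?U. A $ f i $ map_permutation ?U f p (f i))"
      by (rule prod.reindex_bij_betw[OF bb, symmetric])
    moreover have "sign (map_permutation ?U f p) = sign p"
      using p f by (intro sign_map_permutation) (auto simp: bij_is_inj)
    ultimately show "of_int (sign (map_permutation ?U f p)) * (\<Prod>i\<in>?V. A $ i $ map_permutation ?U f p i)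
       = of_int (sign p) * (\<Prod>i\<in>?U. A $ f i $ f (p i))"
      using f by (simp add: map_permutation_apply bij_is_inj)
  qed
  finally show ?thesis by (simp add: det_def)
qed

section \<open>Relabelling of coordinates\<close>

definition reindex_vec :: "('j \<Rightarrow> 'k) \<Rightarrow> real^('k::finite) \<Rightarrow> real^('j::finite)" where
  "reindex_vec f x = (\<chi> j. x $ f j)"

lemma linear_reindex_vec: "linear (reindex_vec f)"
  by (rule linearI) (auto simp: reindex_vec_def vec_eq_iff)

lemma reindex_vec_inverse: "bij f \<Longrightarrow> reindex_vec (inv f) (reindex_vec f x) = x"
  by (simp add: reindex_vec_def vec_eq_iff bij_is_surj surj_f_inv_f)

lemma reindex_vec_inverse': "bij f \<Longrightarrow> reindex_vec f (reindex_vec (inv f) x) = x"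
  by (simp add: reindex_vec_def vec_eq_iff bij_is_inj inv_f_f)

lemma borel_measurable_linear:
  fixes f :: "'m::euclidean_space \<Rightarrow> 'n::real_normed_vector"
  shows "linear f \<Longrightarrow> f \<in> borel_measurable borel"
  by (simp add: borel_measurable_continuous_onI linear_continuous_on linear_conv_bounded_linear)

text \<open>The preimage of a box is a box with the same side lengths in another order, and
  \<open>lborel\<close> is determined by its values on boxes.\<close>

lemma lborel_reindex_vec:
  fixes f :: "'j::finite \<Rightarrow> 'k::finite"
  assumes f: "bij f"
  shows "distr lborel borel (reindex_vec f) = lborel"
proof (rule lborel_eqI[symmetric])
  fix l u :: "real^'j"
  assume le: "\<And>b. b \<in> Basis \<Longrightarrow> l \<bullet> b \<le> u \<bullet> b"
  let ?l = "reindex_vec (inv f) l" and ?u = "reindex_vec (inv f) u"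
  have vimage: "reindex_vec f -` box l u = box ?l ?u"
  proof -
    have "(\<forall>j. l $ j < x $ f j \<and> x $ f j < u $ j) \<longleftrightarrow>
          (\<forall>i. l $ inv f i < x $ i \<and> x $ i < u $ inv f i)" for x
      by (metis assms bij_inv_eq_iff)
    thus ?thesis by (auto simp: mem_box_cart reindex_vec_def)
  qed
  have le': "l $ j \<le> u $ j" for j
    using le[of "axis j 1"] by (simp add: inner_axis axis_in_Basis_iff)
  have ne: "\<forall>b\<in>Basis. ?l \<bullet> b \<le> ?u \<bullet> b"
    using le' by (auto simp: Basis_vec_def inner_axis reindex_vec_def)
  \<comment> \<open>The product over \<open>Basis\<close> becomes a product over the index type,
    where the bijection can act, and is then turned back.\<close>
  have "emeasure lborel (box ?l ?u) = ennreal (measure lborel (cbox ?l ?u))"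
    by (simp add: emeasure_eq_ennreal_measure emeasure_lborel_box_eq emeasure_lborel_cbox_eq measure_def)
  also have "measure lborel (cbox ?l ?u) = (\<Prod>i\<in>UNIV. ?u $ i - ?l $ i)"
    using ne by (subst content_cbox_cart) (auto simp: box_ne_empty)
  also have "\<dots> = (\<Prod>j\<in>UNIV. u $ j - l $ j)"
    using prod.reindex_bij_betw[OF bij_imp_bij_inv[OF f], of "\<lambda>j. u $ j - l $ j"]
    by (simp add: reindex_vec_def)
  also have "\<dots> = measure lborel (cbox l u)"
    using le by (subst content_cbox_cart) (auto simp: box_ne_empty)
  also have "\<dots> = (\<Prod>b\<in>Basis. (u - l) \<bullet> b)"
    using le by (subst content_cbox) (auto simp: inner_diff_left)
  finally show "emeasure (distr lborel borel (reindex_vec f)) (box l u) = ennreal (\<Prod>b\<in>Basis. (u - l) \<bullet> b)"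
    using vimage by (subst emeasure_distr) (auto intro: borel_measurable_linear linear_reindex_vec)
qed simp

lemma emeasure_reindex_vec:
  fixes f :: "'j::finite \<Rightarrow> 'k::finite"
  assumes f: "bij f" and S: "S \<in> sets borel"
  shows "reindex_vec f ` S \<in> sets borel" "emeasure lborel (reindex_vec f ` S) = emeasure lborel S"
proof -
  have eq: "reindex_vec f ` S = reindex_vec (inv f) -` S"
    using reindex_vec_inverse[OF f] reindex_vec_inverse'[OF f] by (auto simp: image_iff) (metis)
  have m: "reindex_vec g \<in> borel_measurable borel" for g :: "'c::finite \<Rightarrow> 'd::finite"
    by (intro borel_measurable_linear linear_reindex_vec)
  show *: "reindex_vec f ` S \<in> sets borel"
    unfolding eq using measurable_sets[OF m S] by simp
  have "emeasure lborel (reindex_vec f ` S) = emeasure (distr lborel borel (reindex_vec f)) (reindex_vec f ` S)"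
    by (simp add: lborel_reindex_vec f)
  also have "\<dots> = emeasure lborel (reindex_vec f -` (reindex_vec f ` S))"
    using * m by (subst emeasure_distr) auto
  also have "reindex_vec f -` (reindex_vec f ` S) = S"
    using reindex_vec_inverse[OF f] by (auto) (metis)
  finally show "emeasure lborel (reindex_vec f ` S) = emeasure lborel S" .
qed

lemma nn_integral_reindex_vec:
  fixes f :: "'j::finite \<Rightarrow> 'k::finite"
  assumes f: "bij f" and h: "h \<in> borel_measurable borel"
  shows "(\<integral>\<^sup>+x. h (reindex_vec f x) \<partial>lborel) = (\<integral>\<^sup>+x. h x \<partial>lborel)"
proof -
  have "(\<integral>\<^sup>+x. h x \<partial>lborel) = (\<integral>\<^sup>+x. h x \<partial>distr lborel borel (reindex_vec f))"
    by (simp add: lborel_reindex_vec f)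
  also have "\<dots> = (\<integral>\<^sup>+x. h (reindex_vec f x) \<partial>lborel)"
    using h by (intro nn_integral_distr) (auto intro: borel_measurable_linear linear_reindex_vec)
  finally show ?thesis by simp
qed

text \<open>\<open>has_measure_differentiable_image\<close> is an equivalence between finite measure
  of the image and existence of a gauge integral. One direction covers a finite integral, the other
  one, by contraposition, an infinite integral.\<close>

lemma emeasure_image_eq_nn_integral_det_wellorder:
  fixes g :: "real^'n::{finite,wellorder} \<Rightarrow> real^'n::_"
  assumes S: "S \<in> sets borel" and gS: "g ` S \<in> sets borel"
    and der: "\<And>x. x \<in> S \<Longrightarrow> (g has_derivative g' x) (at x within S)" and inj: "inj_on g S"
    and m: "(\<lambda>x. indicator S x * \<bar>det (matrix (g' x))\<bar>) \<in> borel_measurable borel"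
  shows "emeasure lborel (g ` S) = (\<integral>\<^sup>+x\<in>S. ennreal \<bar>det (matrix (g' x))\<bar> \<partial>lborel)"
proof -
  note * = has_measure_differentiable_image[OF _ der inj]
  have Sl: "S \<in> sets lebesgue" using S by auto
  let ?w = "\<lambda>x. indicator S x * \<bar>det (matrix (g' x))\<bar>"
  have I: "(\<integral>\<^sup>+x\<in>S. ennreal \<bar>det (matrix (g' x))\<bar> \<partial>lborel) = (\<integral>\<^sup>+x. ennreal (?w x) \<partial>lborel)"
    by (intro nn_integral_cong) (auto simp: indicator_def)
  have eq: "?w = (\<lambda>x. if x \<in> S then \<bar>det (matrix (g' x))\<bar> else 0)"
    by (auto simp: indicator_def)
  show ?thesis
  proof (cases "(\<integral>\<^sup>+x. ennreal (?w x) \<partial>lborel) < \<infinity>")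
    case True
    then have "(?w has_integral enn2real (\<integral>\<^sup>+x. ennreal (?w x) \<partial>lborel)) UNIV"
      by (intro nn_integral_has_integral) (use m in \<open>auto simp: less_top\<close>)
    then have "((\<lambda>x. \<bar>det (matrix (g' x))\<bar>) has_integral enn2real (\<integral>\<^sup>+x. ennreal (?w x) \<partial>lborel)) S"
      unfolding eq has_integral_restrict_UNIV by simp
    then have "g ` S \<in> lmeasurable" "measure lebesgue (g ` S) = enn2real (\<integral>\<^sup>+x. ennreal (?w x) \<partial>lborel)"
      using *[OF Sl] by blast+
    then have "emeasure lebesgue (g ` S) = (\<integral>\<^sup>+x. ennreal (?w x) \<partial>lborel)"
      using True by (simp add: emeasure_eq_measure2)
    then show ?thesis using gS I by simp
  next
    case False
    have "emeasure lborel (g ` S) = \<infinity>"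
    proof (rule ccontr)
      assume "emeasure lborel (g ` S) \<noteq> \<infinity>"
      then have "g ` S \<in> lmeasurable" using gS by (simp add: fmeasurable_def less_top)
      then have "((\<lambda>x. \<bar>det (matrix (g' x))\<bar>) has_integral measure lebesgue (g ` S)) S"
        using *[OF Sl] by blast
      then have "(?w has_integral measure lebesgue (g ` S)) UNIV"
        unfolding eq has_integral_restrict_UNIV by simp
      then have "(\<integral>\<^sup>+x. ennreal (?w x) \<partial>lborel) = ennreal (measure lebesgue (g ` S))"
        by (intro nn_integral_has_integral_lborel) (use m in auto)
      with False show False by simp
    qed
    with False show ?thesis using I by (simp add: not_less top_unique)
  qed
qed

lemma matrix_reindex_vec:
  fixes f :: "'j::finite \<Rightarrow> 'k::finite" and L :: "real^'k \<Rightarrow> real^'k"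
  assumes f: "bij f"
  shows "matrix (reindex_vec f \<circ> L \<circ> reindex_vec (inv f)) = (\<chi> i j. matrix L $ f i $ f j)"
proof -
  have "reindex_vec (inv f) (axis j 1) = axis (f j) (1::real)" for j
    by (auto simp: reindex_vec_def vec_eq_iff axis_def bij_is_inj inv_f_f)
      (metis assms bij_inv_eq_iff)+
  then show ?thesis
    by (simp add: matrix_def vec_eq_iff reindex_vec_def)
qed

text \<open>The map is conjugated with the relabelling \<open>h\<close>, which preserves
  \<open>lborel\<close>; by \<open>det_reindex\<close> the Jacobian determinant does not
  change.\<close>

lemma emeasure_image_eq_nn_integral_det:
  fixes g :: "real^'k::finite \<Rightarrow> real^'k"
  assumes S: "S \<in> sets borel" and gS: "g ` S \<in> sets borel"
    and der: "\<And>x. x \<in> S \<Longrightarrow> (g has_derivative g' x) (at x within S)" and inj: "inj_on g S"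
    and m: "(\<lambda>x. indicator S x * \<bar>det (matrix (g' x))\<bar>) \<in> borel_measurable borel"
  shows "emeasure lborel (g ` S) = (\<integral>\<^sup>+x\<in>S. ennreal \<bar>det (matrix (g' x))\<bar> \<partial>lborel)"
proof -
  obtain f :: "'k idx \<Rightarrow> 'k" where f: "bij f"
    using finite_same_card_bij[of "UNIV :: 'k idx set" "UNIV :: 'k set"] card_idx by auto
  define h where "h = (reindex_vec f :: real^'k \<Rightarrow> real^'k idx)"
  define h' where "h' = (reindex_vec (inv f) :: real^'k idx \<Rightarrow> real^'k)"
  have hh: "h' (h x) = x" "h (h' y) = y" for x y
    using reindex_vec_inverse[OF f] reindex_vec_inverse'[OF f] by (auto simp: h_def h'_def)
  have lin: "linear h" "linear h'" by (auto simp: h_def h'_def linear_reindex_vec)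
  have mh: "h \<in> borel_measurable borel" "h' \<in> borel_measurable borel"
    using lin borel_measurable_linear by auto
  let ?G = "h \<circ> g \<circ> h'" and ?G' = "\<lambda>y. h \<circ> g' (h' y) \<circ> h'"
  have bf: "bij (inv f)" using f by (rule bij_imp_bij_inv)
  have img: "?G ` (h ` S) = h ` (g ` S)" by (auto simp: image_comp hh o_def)
  have detG: "det (matrix (?G' y)) = det (matrix (g' (h' y)))" for y
    unfolding h_def h'_def matrix_reindex_vec[OF f] det_reindex[OF f] ..
  have ind: "indicator (h ` S) y = (indicator S (h' y) :: real)" for y
    by (auto simp: indicator_def hh image_iff) (metis hh)+
  have "emeasure lborel (g ` S) = emeasure lborel (?G ` (h ` S))"
    unfolding img unfolding h_def using emeasure_reindex_vec(2)[OF f gS] by simp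
  also have "\<dots> = (\<integral>\<^sup>+y\<in>h ` S. ennreal \<bar>det (matrix (?G' y))\<bar> \<partial>lborel)"
  proof (rule emeasure_image_eq_nn_integral_det_wellorder)
    show "h ` S \<in> sets borel" "?G ` (h ` S) \<in> sets borel"
      unfolding img unfolding h_def using emeasure_reindex_vec(1)[OF f] S gS by auto
    show "inj_on ?G (h ` S)"
      using inj by (auto simp: inj_on_def hh) (metis hh)
    show "(?G has_derivative ?G' y) (at y within h ` S)" if "y \<in> h ` S" for y
    proof -
      have "h' y \<in> S" "h' ` h ` S = S" using that by (auto simp: hh image_comp)
      with der[of "h' y"] have "(g has_derivative g' (h' y)) (at (h' y) within h' ` h ` S)" by simp
      moreover have "(h' has_derivative h') (at y within h ` S)"
        using lin by (simp add: bounded_linear_imp_has_derivative linear_conv_bounded_linear)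
      ultimately have 1: "((g \<circ> h') has_derivative (g' (h' y) \<circ> h')) (at y within h ` S)"
        by (rule diff_chain_within[rotated])
      have "(h has_derivative h) (at ((g \<circ> h') y) within (g \<circ> h') ` h ` S)"
        using lin by (simp add: bounded_linear_imp_has_derivative linear_conv_bounded_linear)
      from diff_chain_within[OF 1 this] show ?thesis by (simp only: comp_assoc)
    qed
    show "(\<lambda>x. indicator (h ` S) x * \<bar>det (matrix (?G' x))\<bar>) \<in> borel_measurable borel"
      unfolding detG ind using measurable_compose[OF mh(2) m] by simp
  qed
  also have "\<dots> = (\<integral>\<^sup>+y. ennreal (indicator S (h' y) * \<bar>det (matrix (g' (h' y)))\<bar>) \<partial>lborel)"
    unfolding detG by (intro nn_integral_cong) (auto simp: indicator_def hh image_iff)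
  also have "\<dots> = (\<integral>\<^sup>+x. ennreal (indicator S x * \<bar>det (matrix (g' x))\<bar>) \<partial>lborel)"
    unfolding h'_def by (intro nn_integral_reindex_vec[OF bf] measurable_compose[OF m measurable_ennreal])
  also have "\<dots> = (\<integral>\<^sup>+x\<in>S. ennreal \<bar>det (matrix (g' x))\<bar> \<partial>lborel)"
    by (intro nn_integral_cong) (auto simp: indicator_def)
  finally show ?thesis .
qed

text \<open>The version for sets, applied to all Borel subsets of \<open>S\<close>, says that
  Lebesgue measure on the image is the push-forward of the measure with the Jacobian as density.
  Integrating \<open>f\<close> against both measures gives the formula.\<close>

lemma nn_integral_image_change_of_variables:
  fixes g h :: "real^'k::finite \<Rightarrow> real^'k"
  assumes S: "open S" and gS: "open (g ` S)"
    and der: "\<And>x. x \<in> S \<Longrightarrow> (g has_derivative g' x) (at x)"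
    and inv: "\<And>x. x \<in> S \<Longrightarrow> h (g x) = x" and h: "continuous_on (g ` S) h"
    and cont: "continuous_on S (\<lambda>x. det (matrix (g' x)))"
    and f: "f \<in> borel_measurable borel"
  shows "(\<integral>\<^sup>+y\<in>g ` S. f y \<partial>lborel) = (\<integral>\<^sup>+x\<in>S. f (g x) * ennreal \<bar>det (matrix (g' x))\<bar> \<partial>lborel)"
proof -
  let ?w = "\<lambda>x. ennreal (indicator S x * \<bar>det (matrix (g' x))\<bar>)"
  \<comment> \<open>The map is cut off to be Borel on the whole space; the value 0 outside
    \<open>S\<close> does no harm because the density \<open>?w\<close> vanishes there.\<close>
  let ?g = "\<lambda>x. indicator S x *\<^sub>R g x"
  have Sb: "S \<in> sets borel" "g ` S \<in> sets borel" using S gS by auto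
  have inj: "inj_on g S" using inv by (metis inj_onI)
  have gc: "continuous_on S g"
    using der by (meson continuous_at_imp_continuous_on has_derivative_continuous)
  have gm: "?g \<in> borel_measurable borel"
    using borel_measurable_continuous_on_indicator[OF Sb(1) gc] by simp
  have hm: "(\<lambda>y. indicator (g ` S) y *\<^sub>R h y) \<in> borel_measurable borel"
    using borel_measurable_continuous_on_indicator[OF Sb(2) h] by simp
  have wm0: "(\<lambda>x. indicator S x * \<bar>det (matrix (g' x))\<bar>) \<in> borel_measurable borel"
    using borel_measurable_continuous_on_indicator[OF Sb(1) continuous_on_rabs[OF cont]] by simp
  then have wm: "?w \<in> borel_measurable borel" by (intro measurable_compose[OF _ measurable_ennreal])
  \<comment> \<open>Images of Borel sets are Borel because they are preimages under the continuous
    inverse \<open>h\<close>.\<close>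
  have img: "g ` T \<in> sets borel" if T: "T \<in> sets borel" "T \<subseteq> S" for T
  proof -
    have "g ` T = ((\<lambda>y. indicator (g ` S) y *\<^sub>R h y) -` T \<inter> space borel) \<inter> g ` S"
      using T inv by (force simp: indicator_def subset_iff)
    with measurable_sets[OF hm T(1)] Sb show ?thesis by simp
  qed
  have em: "emeasure lborel (g ` T) = (\<integral>\<^sup>+x\<in>T. ?w x \<partial>lborel)" if T: "T \<in> sets borel" "T \<subseteq> S" for T
  proof -
    have eq: "(\<lambda>x. indicator T x * \<bar>det (matrix (g' x))\<bar>) = (\<lambda>x. indicator T x * (indicator S x * \<bar>det (matrix (g' x))\<bar>))"
      using T by (auto simp: indicator_def fun_eq_iff)
    have "(\<lambda>x. indicator T x * \<bar>det (matrix (g' x))\<bar>) \<in> borel_measurable borel"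
      unfolding eq using T by (intro borel_measurable_times[OF _ wm0]) simp
    then have "emeasure lborel (g ` T) = (\<integral>\<^sup>+x\<in>T. ennreal \<bar>det (matrix (g' x))\<bar> \<partial>lborel)"
      using T inj img by (intro emeasure_image_eq_nn_integral_det)
        (auto intro: has_derivative_at_withinI der inj_on_subset)
    also have "\<dots> = (\<integral>\<^sup>+x\<in>T. ?w x \<partial>lborel)"
      using T by (intro nn_integral_cong) (auto simp: indicator_def)
    finally show ?thesis .
  qed
  have eq: "density lborel (indicator (g ` S)) = distr (density lborel ?w) borel ?g"
  proof (rule measure_eqI)
    fix B assume "B \<in> sets (density lborel (indicator (g ` S) :: _ \<Rightarrow> ennreal))"
    then have B: "B \<in> sets borel" by simp
    have pre: "?g -` B \<in> sets borel" using measurable_sets[OF gm B] by simp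
    have "emeasure (density lborel (indicator (g ` S))) B = emeasure lborel (B \<inter> g ` S)"
      using B Sb by (subst emeasure_density) (auto simp: indicator_inter_arith[symmetric] mult.commute Int_commute)
    also have "B \<inter> g ` S = g ` (?g -` B \<inter> S)" by (auto simp: indicator_def)
    also have "emeasure lborel \<dots> = (\<integral>\<^sup>+x\<in>?g -` B \<inter> S. ?w x \<partial>lborel)"
      using pre Sb by (intro em) auto
    also have "\<dots> = (\<integral>\<^sup>+x\<in>?g -` B. ?w x \<partial>lborel)"
      by (intro nn_integral_cong) (auto simp: indicator_def)
    also have "\<dots> = emeasure (distr (density lborel ?w) borel ?g) B"
      using B pre wm gm by (subst emeasure_distr) (auto simp: emeasure_density)
    finally show "emeasure (density lborel (indicator (g ` S))) B = emeasure (distr (density lborel ?w) borel ?g) B" .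
  qed simp
  have "(\<integral>\<^sup>+y\<in>g ` S. f y \<partial>lborel) = (\<integral>\<^sup>+y. f y \<partial>density lborel (indicator (g ` S)))"
    using f Sb by (subst nn_integral_density) (auto simp: mult.commute)
  also have "\<dots> = (\<integral>\<^sup>+x. f (?g x) \<partial>density lborel ?w)"
    unfolding eq using f gm by (intro nn_integral_distr) auto
  also have "\<dots> = (\<integral>\<^sup>+x. ?w x * f (?g x) \<partial>lborel)"
    using f gm wm by (intro nn_integral_density) auto
  also have "\<dots> = (\<integral>\<^sup>+x\<in>S. f (g x) * ennreal \<bar>det (matrix (g' x))\<bar> \<partial>lborel)"
    by (intro nn_integral_cong) (auto simp: indicator_def mult.commute)
  finally show ?thesis .
qed

lemma nn_integral_affine:
  fixes P :: "real^'k::finite^'k"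
  assumes P: "invertible P" and f: "f \<in> borel_measurable borel"
  shows "(\<integral>\<^sup>+y. f y \<partial>lborel) = (\<integral>\<^sup>+x. f (a + P *v x) * ennreal \<bar>det P\<bar> \<partial>lborel)"
proof -
  obtain Q where Q: "P ** Q = mat 1" "Q ** P = mat 1" using P by (auto simp: invertible_def)
  have "P *v (Q *v z) = z" "Q *v (P *v z) = z" for z
    by (simp_all only: matrix_vector_mul_assoc Q matrix_vector_mul_lid)
  note PQ = this
  have "y = a + P *v (Q *v (y - a))" for y
    by (simp only: PQ) simp
  then have surj: "range (\<lambda>x. a + P *v x) = UNIV" by (intro surjI[of _ "\<lambda>y. Q *v (y - a)"]) simp
  have "(\<integral>\<^sup>+y\<in>range (\<lambda>x. a + P *v x). f y \<partial>lborel) =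
    (\<integral>\<^sup>+x\<in>UNIV. f (a + P *v x) * ennreal \<bar>det (matrix (\<lambda>v. P *v v))\<bar> \<partial>lborel)"
  proof (rule nn_integral_image_change_of_variables[where h = "\<lambda>y. Q *v (y - a)"])
    show "((\<lambda>x. a + P *v x) has_derivative (\<lambda>v. P *v v)) (at x)" for x
      using has_derivative_add[OF has_derivative_const bounded_linear_imp_has_derivative[OF matrix_vector_mul_bounded_linear]]
      by simp
    show "Q *v (a + P *v x - a) = x" for x by (simp add: PQ)
    show "continuous_on (range (\<lambda>x. a + P *v x)) (\<lambda>y. Q *v (y - a))"
      by (intro continuous_intros bounded_linear.continuous_on[OF matrix_vector_mul_bounded_linear])
  qed (use surj f in auto)
  then show ?thesis unfolding surj matrix_of_matrix_vector_mul by simp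
qed

section \<open>Positive definite matrices\<close>

lemma inner_mat_mult: "v \<bullet> ((A :: real^'n::finite^'n) *v w) = (\<Sum>i\<in>UNIV. \<Sum>j\<in>UNIV. v $ i * A $ i $ j * w $ j)"
  by (simp add: inner_vec_def matrix_vector_mult_def sum_distrib_left mult.assoc)

lemma inner_mat_symmetric:
  fixes A :: "real^'n::finite^'n"
  assumes "transpose A = A"
  shows "v \<bullet> (A *v w) = w \<bullet> (A *v v)"
  using dot_lmul_matrix[of v A w] assms
  by (metis dot_lmul_matrix inner_commute transpose_matrix_vector)

text \<open>The columns of \<open>P\<close> form an orthonormal basis for the inner product given by
  \<open>A\<close>. It is found as an orthonormal set of largest size: below full dimension, one
  Gram-Schmidt step would enlarge it.\<close>

lemma posdef_orthonormal_columns: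
  fixes A :: "real^'n::finite^'n"
  assumes sym: "transpose A = A" and pos: "\<And>v. v \<noteq> 0 \<Longrightarrow> v \<bullet> (A *v v) > 0"
  obtains P :: "real^'n^'n" where "invertible P" "transpose P ** A ** P = mat 1"
proof -
  define N where "N B \<longleftrightarrow> finite B \<and> (\<forall>b\<in>B. b \<bullet> (A *v b) = 1) \<and> (\<forall>b\<in>B. \<forall>c\<in>B. b \<noteq> c \<longrightarrow> b \<bullet> (A *v c) = 0)"
    for B :: "(real^'n) set"
  have comb: "(\<Sum>c\<in>B. f c *\<^sub>R c) \<bullet> (A *v b) = f b" if "N B" "b \<in> B" for B b f
  proof -
    have "(\<Sum>c\<in>B. f c *\<^sub>R c) \<bullet> (A *v b) = (\<Sum>c\<in>B. if c = b then f b else 0)"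
      unfolding inner_sum_left using that by (intro sum.cong) (auto simp: N_def)
    also have "\<dots> = f b" using that by (auto simp: N_def)
    finally show ?thesis .
  qed
  have ind: "independent B" if B: "N B" for B
  proof (rule independent_if_scalars_zero)
    show "finite B" using B by (simp add: N_def)
    fix f x assume "(\<Sum>x\<in>B. f x *\<^sub>R x) = 0" "x \<in> B"
    then show "f x = 0" using comb[OF B, of x f] by simp
  qed
  have le: "card B \<le> CARD('n)" if "N B" for B
    using independent_bound[OF ind[OF that]] by simp
  \<comment> \<open>Orthonormal sets are independent, so their size is bounded and a largest one
    exists.\<close>
  have "N {}" by (simp add: N_def)
  moreover have "\<forall>B. N B \<longrightarrow> card B < Suc CARD('n)" using le by (simp add: less_Suc_eq_le)
  ultimately obtain B where B: "N B" and max: "\<And>B'. N B' \<Longrightarrow> card B' \<le> card B"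
    using ex_has_greatest_nat[of N "{}" card "Suc CARD('n)"] by metis
  have "card B = CARD('n)"
  proof (rule ccontr)
    assume "card B \<noteq> CARD('n)"
    with le[OF B] have "card B < CARD('n)" by simp
    moreover have "card B \<ge> CARD('n)" if "span B = UNIV"
    proof -
      have "card B = dim (span B)" using dim_eq_card_independent[OF ind[OF B]] by simp
      then show ?thesis unfolding that by simp
    qed
    ultimately obtain v where v: "v \<notin> span B" by auto
    \<comment> \<open>The part of \<open>v\<close> orthogonal to \<open>B\<close>; it is nonzero
      since \<open>v\<close> lies outside the span.\<close>
    define w where "w = v - (\<Sum>c\<in>B. (v \<bullet> (A *v c)) *\<^sub>R c)"
    have "(\<Sum>c\<in>B. (v \<bullet> (A *v c)) *\<^sub>R c) \<in> span B"
      by (intro span_sum span_scale span_base)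
    with v have w0: "w \<noteq> 0" by (auto simp: w_def)
    have orth: "w \<bullet> (A *v b) = 0" if "b \<in> B" for b
      unfolding w_def using comb[OF B that, of "\<lambda>c. v \<bullet> (A *v c)"] by (simp add: inner_diff_left)
    define s where "s = sqrt (w \<bullet> (A *v w))"
    have s: "s > 0" "s * s = w \<bullet> (A *v w)" using pos[OF w0] by (auto simp: s_def)
    define e where "e = (1 / s) *\<^sub>R w"
    have e1: "e \<bullet> (A *v e) = 1"
      using s w0 pos[OF w0] by (simp add: e_def matrix_vector_mult_scaleR flip: s(2))
    have eo: "e \<bullet> (A *v b) = 0" "b \<bullet> (A *v e) = 0" if "b \<in> B" for b
      using orth[OF that] inner_mat_symmetric[OF sym, of b e] by (auto simp: e_def)
    have "e \<notin> B" using eo e1 by force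
    moreover have "N (insert e B)"
      using B e1 eo by (auto simp: N_def)
    ultimately show False using max[of "insert e B"] B by (auto simp: N_def)
  qed
  moreover have "finite B" using B by (simp add: N_def)
  ultimately obtain e where e: "bij_betw e (UNIV :: 'n set) B"
    using finite_same_card_bij[of "UNIV :: 'n set" B] by auto
  define P where "P = (\<chi> i j. e j $ i)"
  have "(transpose P ** A ** P) $ i $ j = e i \<bullet> (A *v e j)" for i j
    by (simp add: P_def inner_mat_mult matrix_matrix_mult_def transpose_def sum_distrib_right sum_distrib_left mult.assoc)
      (subst sum.swap, simp add: mult_ac)
  moreover have "e i \<bullet> (A *v e j) = (if i = j then 1 else 0)" for i j
    using B e by (fastforce simp: N_def bij_betw_def inj_on_def)
  ultimately have *: "transpose P ** A ** P = mat 1"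
    by (simp add: vec_eq_iff mat_def)
  then have "invertible P" unfolding invertible_left_inverse by blast
  with * that show ?thesis by blast
qed

text \<open>Taking determinants gives \<open>det P * det P * det A = 1\<close>. For the metric at a
  point this says that the volume density in the orthonormal coordinates is 1 there.\<close>

lemma det_orthonormal_columns:
  fixes A P :: "real^'n::finite^'n"
  assumes "transpose P ** A ** P = mat 1"
  shows "det A > 0" "\<bar>det P\<bar> * sqrt (det A) = 1"
proof -
  have *: "det P * det P * det A = 1"
    using arg_cong[OF assms, of det] by (simp add: det_mul mult_ac)
  then show "det A > 0" by (metis mult_nonneg_nonpos not_less not_one_le_zero zero_le_square)
  have "\<bar>det P\<bar> * sqrt (det A) = sqrt (det P * det P * det A)"
    by (simp add: real_sqrt_mult)
  then show "\<bar>det P\<bar> * sqrt (det A) = 1" using * by simp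
qed

text \<open>Lets continuity of the matrix entries control the quadratic form uniformly in the
  vector.\<close>

lemma quadratic_form_bound:
  fixes A :: "real^'n::finite^'n"
  shows "\<bar>v \<bullet> (A *v v)\<bar> \<le> (\<Sum>i\<in>UNIV. \<Sum>j\<in>UNIV. \<bar>A $ i $ j\<bar>) * (norm v)\<^sup>2"
proof -
  have "\<bar>v \<bullet> (A *v v)\<bar> \<le> norm v * norm (A *v v)" by (rule Cauchy_Schwarz_ineq2)
  also have "\<dots> \<le> norm v * (onorm ((*v) A) * norm v)"
    by (intro mult_left_mono onorm) auto
  also have "\<dots> \<le> norm v * ((\<Sum>i\<in>UNIV. \<Sum>j\<in>UNIV. \<bar>A $ i $ j\<bar>) * norm v)"
    by (intro mult_left_mono mult_right_mono onorm_le_matrix_component_sum) auto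
  finally show ?thesis by (simp add: power2_eq_square mult_ac)
qed

section \<open>The kernel in Euclidean space\<close>

lemma nn_integral_scaleR:
  fixes f :: "'n::euclidean_space \<Rightarrow> ennreal"
  assumes f: "f \<in> borel_measurable borel" and c: "c > 0"
  shows "(\<integral>\<^sup>+x. f (c *\<^sub>R x) \<partial>lborel) = ennreal (1 / c ^ DIM('n)) * (\<integral>\<^sup>+x. f x \<partial>lborel)"
proof -
  have "(\<integral>\<^sup>+x. f x \<partial>lborel) = (\<integral>\<^sup>+x. f x \<partial>density (distr lborel borel (\<lambda>x. 0 + c *\<^sub>R x)) (\<lambda>_. ennreal (\<bar>c\<bar> ^ DIM('n))))"
    using c by (subst lborel_affine[of c 0]) auto
  also have "\<dots> = ennreal (c ^ DIM('n)) * (\<integral>\<^sup>+x. f (c *\<^sub>R x) \<partial>lborel)"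
    using f c by (simp add: nn_integral_density nn_integral_distr nn_integral_cmult)
  finally have "ennreal (1 / c ^ DIM('n)) * (\<integral>\<^sup>+x. f x \<partial>lborel)
    = ennreal (1 / c ^ DIM('n) * c ^ DIM('n)) * (\<integral>\<^sup>+x. f (c *\<^sub>R x) \<partial>lborel)"
    using c by (subst ennreal_mult) (auto simp: mult.assoc)
  then show ?thesis using c by simp
qed

locale kernel =
  fixes K :: "real \<Rightarrow> real"
  assumes nonneg: "\<And>t. t \<ge> 0 \<Longrightarrow> K t \<ge> 0"
    and antimono: "antimono_on {0..} K"
    and moments: "\<And>n::nat. n \<ge> 1 \<Longrightarrow> set_integrable lborel {0..} (\<lambda>t. K t * t ^ n)"
begin

lemma decreasing: "0 \<le> s \<Longrightarrow> s \<le> t \<Longrightarrow> K t \<le> K s"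
  using antimono by (auto simp: monotone_on_def)

text \<open>The argument is clamped because \<open>K\<close> is constrained only on the nonnegative
  half line; the clamped function is monotone on the whole line.\<close>

lemma borel_measurable_pos_part: "(\<lambda>t. K (max 0 t)) \<in> borel_measurable borel"
proof -
  have "mono (\<lambda>t. - K (max 0 t))"
    by (intro monoI) (auto intro!: decreasing)
  from borel_measurable_mono[OF this] show ?thesis by simp
qed

lemma borel_measurable_compose_nonneg:
  assumes "f \<in> borel_measurable N" "\<And>x. x \<in> space N \<Longrightarrow> f x \<ge> 0"
  shows "(\<lambda>x. K (f x)) \<in> borel_measurable N"
proof -
  have "(\<lambda>x. K (max 0 (f x))) \<in> borel_measurable N"
    using measurable_compose[OF assms(1) borel_measurable_pos_part] .
  then show ?thesis using assms(2) by (subst measurable_cong) (auto simp: max_def)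
qed

text \<open>On the interval from \<open>t / 2\<close> to \<open>t\<close> the integrand of a moment
  is at least \<open>K t\<close> times a power of \<open>t / 2\<close>, because \<open>K\<close>
  decreases. A finite moment therefore bounds \<open>K t\<close> times a power of
  \<open>t\<close>.\<close>

lemma polynomial_decay: "\<exists>c\<ge>0. \<forall>t\<ge>0. K t * t ^ n \<le> c"
proof -
  define I where "I = (LBINT s:{0..}. K s * s ^ (Suc n))"
  \<comment> \<open>The moment of order \<open>n + 1\<close> is taken because the orders start at 1
    while \<open>n\<close> may be 0.\<close>
  have I: "set_integrable lborel {0..} (\<lambda>t. K t * t ^ Suc n)" using moments[of "Suc n"] by simp
  have I0: "I \<ge> 0" unfolding I_def set_lebesgue_integral_def
    by (intro integral_nonneg_AE) (auto simp: indicator_def nonneg)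
  have bound: "K t * t ^ n \<le> 2 ^ Suc (Suc n) * I" if t: "t \<ge> 1" for t
  proof -
    have "K t * (t / 2) ^ Suc n * (t / 2) = (LBINT s:{t/2..t}. K t * (t / 2) ^ Suc n)"
      using t by (simp add: set_integral_const)
    also have "\<dots> \<le> (LBINT s:{t/2..t}. K s * s ^ Suc n)"
    proof (rule set_integral_mono)
      show "set_integrable lborel {t/2..t} (\<lambda>s. K s * s ^ Suc n)"
        using t by (intro set_integrable_subset[OF I]) auto
      show "K t * (t / 2) ^ Suc n \<le> K s * s ^ Suc n" if "s \<in> {t/2..t}" for s
        using that t by (intro mult_mono power_mono decreasing nonneg) auto
    qed (use t in \<open>auto simp: set_integrable_def\<close>)
    also have "\<dots> \<le> I"
      unfolding I_def set_lebesgue_integral_def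
    proof (rule integral_mono)
      show "integrable lborel (\<lambda>s. indicat_real {t/2..t} s *\<^sub>R (K s * s ^ Suc n))"
        using set_integrable_subset[OF I, of "{t/2..t}"] t by (simp add: set_integrable_def)
      show "integrable lborel (\<lambda>s. indicat_real {0..} s *\<^sub>R (K s * s ^ Suc n))"
        using I by (simp add: set_integrable_def)
      show "indicat_real {t/2..t} s *\<^sub>R (K s * s ^ Suc n) \<le> indicat_real {0..} s *\<^sub>R (K s * s ^ Suc n)" for s
        using t nonneg[of s] by (auto simp: indicator_def)
    qed
    \<comment> \<open>The interval contributes its length \<open>t / 2\<close> as well, so there are
      two powers of \<open>t\<close> to spare; they are at least 1 for the present
      \<open>t\<close>.\<close>
    finally have "K t * t ^ n * (t * t) \<le> 2 ^ Suc (Suc n) * I"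
      by (simp add: field_simps power_divide)
    moreover have "K t * t ^ n * 1 \<le> K t * t ^ n * (t * t)"
      using t nonneg[of t] mult_mono[of 1 t 1 t] by (intro mult_left_mono) auto
    ultimately show ?thesis by simp
  qed
  show ?thesis
  proof (intro exI[of _ "K 0 + 2 ^ Suc (Suc n) * I"] conjI allI impI)
    show "0 \<le> K 0 + 2 ^ Suc (Suc n) * I" using I0 nonneg[of 0] by simp
    fix t :: real assume t: "t \<ge> 0"
    show "K t * t ^ n \<le> K 0 + 2 ^ Suc (Suc n) * I"
    proof (cases "t \<ge> 1")
      case True then show ?thesis using bound[of t] nonneg[of 0] by simp
    next
      case False
      then have "K t * t ^ n \<le> K 0 * 1"
        using t by (intro mult_mono decreasing power_le_one nonneg) auto
      then show ?thesis using I0 by (smt (verit) mult_nonneg_nonneg zero_le_power)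
    qed
  qed
qed

text \<open>With \<open>t = a / r\<close> the scaled kernel is \<open>K t * t ^ n / a ^ n\<close>,
  which the decay bounds.\<close>

lemma scaled_bounded:
  assumes a: "a > 0"
  shows "\<exists>c\<ge>0. \<forall>r>0. scaled_kernel n K r a \<le> c"
proof -
  obtain c where c: "c \<ge> 0" "\<And>t. t \<ge> 0 \<Longrightarrow> K t * t ^ n \<le> c" using polynomial_decay by blast
  have "scaled_kernel n K r a \<le> c / a ^ n" if "r > 0" for r
    using c(2)[of "a / r"] that a by (simp add: scaled_kernel_def field_simps power_divide)
  then show ?thesis using c a by (intro exI[of _ "c / a ^ n"]) auto
qed

text \<open>The same substitution with one more power of \<open>t\<close> leaves a factor
  \<open>r\<close> in the bound.\<close>

lemma scaled_tendsto_0: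
  assumes a: "a > 0"
  shows "((\<lambda>r. scaled_kernel n K r a) \<longlongrightarrow> 0) (at_right 0)"
proof -
  obtain c where c: "c \<ge> 0" "\<And>t. t \<ge> 0 \<Longrightarrow> K t * t ^ Suc n \<le> c" using polynomial_decay by blast
  have le: "scaled_kernel n K r a \<le> c / a ^ Suc n * r" if "r > 0" for r
    using c(2)[of "a / r"] that a by (simp add: scaled_kernel_def field_simps power_divide)
  have ge: "scaled_kernel n K r a \<ge> 0" if "r > 0" for r
    using that a by (simp add: scaled_kernel_def nonneg)
  have "((\<lambda>r. c / a ^ Suc n * r) \<longlongrightarrow> c / a ^ Suc n * 0) (at_right 0)"
    by (intro tendsto_intros)
  then have lim: "((\<lambda>r. c / a ^ Suc n * r) \<longlongrightarrow> 0) (at_right 0)" by simp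
  have ev: "\<forall>\<^sub>F r in at_right 0. (0::real) < r" by (rule eventually_at_right_less)
  show ?thesis
    by (rule tendsto_sandwich[OF eventually_mono[OF ev ge] eventually_mono[OF ev le] tendsto_const lim])
qed

lemma scaled_decreasing: "0 < r \<Longrightarrow> 0 \<le> s \<Longrightarrow> s \<le> t \<Longrightarrow> scaled_kernel n K r t \<le> scaled_kernel n K r s"
  by (simp add: scaled_kernel_def divide_right_mono decreasing)

lemma scaled_nonneg: "0 < r \<Longrightarrow> 0 \<le> s \<Longrightarrow> 0 \<le> scaled_kernel n K r s"
  by (simp add: scaled_kernel_def nonneg)

lemma borel_measurable_norm [measurable]:
  "(\<lambda>x::'n::euclidean_space. ennreal (K (norm x))) \<in> borel_measurable borel"
  by (intro measurable_compose[OF _ measurable_ennreal] borel_measurable_compose_nonneg) auto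

text \<open>The radial function is dominated by a series of step functions on balls of integer
  radius, whose integrals are summable by the decay of \<open>K\<close>.\<close>

lemma kernel_constant_finite: "kernel_constant TYPE('k::finite) K < \<infinity>"
proof -
  let ?k = "CARD('k)"
  let ?B = "\<lambda>n. ball (0::real^'k) (real (Suc n))"
  \<comment> \<open>Of these powers, \<open>CARD('k)\<close> pay for the volume of the balls and the
    last two leave the summable sequence \<open>1 / n ^ 2\<close>.\<close>
  obtain c where c: "c \<ge> 0" "\<And>t. t \<ge> 0 \<Longrightarrow> K t * t ^ (?k + 2) \<le> c" using polynomial_decay by blast
  have "kernel_constant TYPE('k) K \<le> (\<integral>\<^sup>+x. (\<Sum>n. ennreal (K (real n)) * indicator (?B n) x) \<partial>lborel)"
    unfolding kernel_constant_def
  proof (intro nn_integral_mono)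
    fix x :: "real^'k"
    \<comment> \<open>This single term of the series already dominates the value at
      \<open>x\<close>.\<close>
    define n where "n = nat \<lfloor>norm x\<rfloor>"
    have n: "real n \<le> norm x" "norm x < real (Suc n)"
      using floor_correct[of "norm x"] unfolding n_def by (simp_all add: add.commute)
    have "ennreal (K (norm x)) \<le> ennreal (K (real n)) * indicator (?B n) x"
      using n by (auto intro!: ennreal_leI decreasing)
    also have "\<dots> \<le> (\<Sum>n. ennreal (K (real n)) * indicator (?B n) x)"
      using sum_le_suminf[OF summableI, of "{n}" "\<lambda>n. ennreal (K (real n)) * indicator (?B n) x"]
      by (simp del: of_nat_Suc sum_mult_indicator)
    finally show "ennreal (K (norm x)) \<le> (\<Sum>n. ennreal (K (real n)) * indicator (?B n) x)" .
  qed
  also have "\<dots> = (\<Sum>n. ennreal (K (real n)) * emeasure lborel (?B n))"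
    by (subst nn_integral_suminf)
      (auto simp: nn_integral_cmult_indicator simp del: of_nat_Suc intro!: borel_measurable_times_ennreal borel_measurable_indicator)
  also have "\<dots> = (\<Sum>n. ennreal (K (real n) * (unit_ball_vol (real ?k) * real (Suc n) ^ ?k)))"
    by (intro suminf_cong) (auto simp: emeasure_ball ennreal_mult nonneg simp del: of_nat_Suc)
  also have "\<dots> < \<infinity>"
  proof -
    have "summable (\<lambda>n. K (real n) * (unit_ball_vol (real ?k) * real (Suc n) ^ ?k))"
    proof (rule summable_comparison_test_ev)
      show "summable (\<lambda>n. c * 2 ^ ?k * unit_ball_vol (real ?k) * (1 / real n ^ 2))"
        by (intro summable_mult) (use inverse_power_summable[of 2, where 'a = real] in \<open>simp add: inverse_eq_divide\<close>)
      show "\<forall>\<^sub>F n in sequentially. norm (K (real n) * (unit_ball_vol (real ?k) * real (Suc n) ^ ?k))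
          \<le> c * 2 ^ ?k * unit_ball_vol (real ?k) * (1 / real n ^ 2)"
        using eventually_ge_at_top[of 1]
      proof eventually_elim
        case (elim n)
        have "K (real n) * real (Suc n) ^ ?k \<le> K (real n) * (2 * real n) ^ ?k"
          using elim by (intro mult_left_mono power_mono nonneg) auto
        also have "\<dots> = 2 ^ ?k * (K (real n) * real n ^ (?k + 2)) * (1 / real n ^ 2)"
          using elim by (simp add: power_add power_mult_distrib power2_eq_square)
        also have "\<dots> \<le> 2 ^ ?k * c * (1 / real n ^ 2)"
          using elim by (intro mult_right_mono mult_left_mono c(2)) auto
        finally have "unit_ball_vol (real ?k) * (K (real n) * real (Suc n) ^ ?k) \<le> unit_ball_vol (real ?k) * (2 ^ ?k * c * (1 / real n ^ 2))"
          by (intro mult_left_mono) auto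
        then show ?case using nonneg[of "real n"] by (simp add: mult_ac abs_mult)
      qed
    qed
    then show ?thesis
      using nonneg by (subst suminf_ennreal2) auto
  qed
  finally show ?thesis .
qed

text \<open>The substitution absorbs \<open>1 / r ^ CARD('k)\<close>, so the value does not depend
  on \<open>r\<close>; the factor \<open>c\<close> will be the metric distortion of a chart.\<close>

lemma nn_integral_scaled:
  assumes "r > 0" "c > 0"
  shows "(\<integral>\<^sup>+x. ennreal (scaled_kernel CARD('k) K r (c * norm (x :: real^'k::finite))) \<partial>lborel)
    = ennreal (1 / c ^ CARD('k)) * kernel_constant TYPE('k) K"
proof -
  have "(\<integral>\<^sup>+x. ennreal (scaled_kernel CARD('k) K r (c * norm (x :: real^'k))) \<partial>lborel)
     = (\<integral>\<^sup>+x. ennreal (1 / r ^ CARD('k)) * ennreal (K (norm ((c / r) *\<^sub>R (x :: real^'k)))) \<partial>lborel)"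
    using assms by (intro nn_integral_cong) (simp add: scaled_kernel_def ennreal_mult'[symmetric])
  also have "\<dots> = ennreal (1 / r ^ CARD('k)) * (\<integral>\<^sup>+x. ennreal (K (norm ((c / r) *\<^sub>R (x :: real^'k)))) \<partial>lborel)"
    by (intro nn_integral_cmult) measurable
  also have "(\<integral>\<^sup>+x. ennreal (K (norm ((c / r) *\<^sub>R (x :: real^'k)))) \<partial>lborel) = ennreal (1 / (c / r) ^ CARD('k)) * kernel_constant TYPE('k) K"
    unfolding kernel_constant_def
    using nn_integral_scaleR[of "\<lambda>x :: real^'k. ennreal (K (norm x))" "c / r"] assms by simp
  also have "ennreal (1 / r ^ CARD('k)) * (ennreal (1 / (c / r) ^ CARD('k)) * kernel_constant TYPE('k) K)
      = ennreal (1 / r ^ CARD('k) * (1 / (c / r) ^ CARD('k))) * kernel_constant TYPE('k) K"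
    using assms by (subst ennreal_mult) (auto simp: mult.assoc)
  finally show ?thesis using assms by (simp add: power_divide)
qed

text \<open>Rescaling fixes the integrand and turns the ball into one of radius
  \<open>R / r n\<close>. These balls exhaust the space, and the full integrand is an integrable
  majorant.\<close>

lemma nn_integral_scaled_ball_tendsto:
  assumes c: "c > 0" and R: "R > 0" and r: "\<And>n. r n > 0" "r \<longlonglongrightarrow> 0"
  shows "(\<lambda>n. \<integral>\<^sup>+x\<in>ball 0 R. ennreal (scaled_kernel CARD('k) K (r n) (c * norm (x :: real^'k::finite))) \<partial>lborel)
    \<longlonglongrightarrow> ennreal (1 / c ^ CARD('k)) * kernel_constant TYPE('k) K"
proof -
  let ?f = "\<lambda>n x. ennreal (K (c * norm (x::real^'k))) * indicator (ball 0 (R / r n)) x"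
  have scale: "(\<integral>\<^sup>+x\<in>ball 0 R. ennreal (scaled_kernel CARD('k) K (r n) (c * norm (x :: real^'k::finite))) \<partial>lborel)
      = (\<integral>\<^sup>+x. ?f n x \<partial>lborel)" for n
  proof -
    have "(\<integral>\<^sup>+x\<in>ball 0 R. ennreal (scaled_kernel CARD('k) K (r n) (c * norm (x :: real^'k))) \<partial>lborel)
        = (\<integral>\<^sup>+x. ennreal (1 / r n ^ CARD('k)) * ?f n ((1 / r n) *\<^sub>R x) \<partial>lborel)"
      using r(1)[of n] R c
      by (intro nn_integral_cong) (auto simp: scaled_kernel_def indicator_def field_simps ennreal_mult'[symmetric])
    also have "\<dots> = ennreal (1 / r n ^ CARD('k)) * (ennreal (1 / (1 / r n) ^ CARD('k)) * (\<integral>\<^sup>+x. ?f n x \<partial>lborel))"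
    proof (subst nn_integral_cmult)
      have m: "?f n \<in> borel_measurable borel"
        using c by (auto intro!: borel_measurable_times_ennreal borel_measurable_indicator measurable_compose[OF _ measurable_ennreal] borel_measurable_compose_nonneg)
      have s: "(\<lambda>x::real^'k. (1 / r n) *\<^sub>R x) \<in> borel_measurable borel" by simp
      show "(\<lambda>x. ?f n ((1 / r n) *\<^sub>R x)) \<in> borel_measurable lborel"
        using measurable_compose[OF s m] by simp
      show "ennreal (1 / r n ^ CARD('k)) * (\<integral>\<^sup>+x. ?f n ((1 / r n) *\<^sub>R x) \<partial>lborel) =
        ennreal (1 / r n ^ CARD('k)) * (ennreal (1 / (1 / r n) ^ CARD('k)) * (\<integral>\<^sup>+x. ?f n x \<partial>lborel))"
        using nn_integral_scaleR[OF m, of "1 / r n"] r(1)[of n] by simp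
    qed
    also have "\<dots> = ennreal (1 / r n ^ CARD('k) * (1 / (1 / r n) ^ CARD('k))) * (\<integral>\<^sup>+x. ?f n x \<partial>lborel)"
      using r(1)[of n] by (subst ennreal_mult) (auto simp: mult.assoc)
    also have "\<dots> = (\<integral>\<^sup>+x. ?f n x \<partial>lborel)" using r(1)[of n] by (simp add: power_divide)
    finally show ?thesis .
  qed
  have m: "(\<lambda>x. ennreal (K (c * norm (x::real^'k)))) \<in> borel_measurable lborel"
    using c by (intro measurable_compose[OF _ measurable_ennreal] borel_measurable_compose_nonneg) auto
  have lim: "(\<integral>\<^sup>+x. ennreal (K (c * norm (x::real^'k))) \<partial>lborel) = ennreal (1 / c ^ CARD('k)) * kernel_constant TYPE('k) K"
    using nn_integral_scaled[of 1 c, where 'k = 'k] c by (simp add: scaled_kernel_def)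
  have "(\<lambda>n. \<integral>\<^sup>+x. ?f n x \<partial>lborel) \<longlonglongrightarrow> (\<integral>\<^sup>+x. ennreal (K (c * norm (x::real^'k))) \<partial>lborel)"
  proof (rule nn_integral_dominated_convergence[where w = "\<lambda>x. ennreal (K (c * norm (x::real^'k)))"])
    show "(\<integral>\<^sup>+x. ennreal (K (c * norm (x::real^'k))) \<partial>lborel) < \<infinity>"
      unfolding lim using kernel_constant_finite[where 'k = 'k] by (simp add: ennreal_mult_less_top)
    show "AE x in lborel. (\<lambda>n. ?f n x) \<longlonglongrightarrow> ennreal (K (c * norm (x::real^'k)))"
    proof (intro AE_I2 tendsto_eventually)
      fix x :: "real^'k"
      have "filterlim r (at_right 0) sequentially"
        using r by (auto intro!: tendsto_imp_filterlim_at_right)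
      then have "filterlim (\<lambda>n. R / r n) at_top sequentially"
        using filterlim_compose[OF filterlim_inverse_at_top_right] R
        by (auto simp: divide_inverse intro!: filterlim_tendsto_pos_mult_at_top[OF tendsto_const])
      then have "\<forall>\<^sub>F n in sequentially. R / r n > norm x" by (simp add: filterlim_at_top_dense)
      then show "\<forall>\<^sub>F n in sequentially. ?f n x = ennreal (K (c * norm x))"
        by eventually_elim simp
    qed
  qed (use m in \<open>auto simp: indicator_def\<close>)
  then show ?thesis unfolding scale lim .
qed

end

section \<open>Charts and the Riemannian volume\<close>

locale closed_riemannian =
  fixes M :: "('a, 'i, 'k::finite) riemannian"
  assumes closed: "closed_riemannian_manifold M"
begin

abbreviation "T \<equiv> mtop M"
abbreviation "I \<equiv> index M"
abbreviation "cdom i \<equiv> chart_dom M i"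
abbreviation "\<phi> i \<equiv> coord M i"
abbreviation "\<psi> i \<equiv> inv_into (chart_dom M i) (coord M i)"
abbreviation "cod i \<equiv> coord M i ` chart_dom M i"
abbreviation "jac i j x \<equiv> frechet_derivative (transition M i j) (at x)"

section \<open>Topology of the charts and their inverses\<close>

lemma manifold: "smooth_manifold M" and compact: "compact_space T" and Hausdorff: "Hausdorff_space T"
  and second_countable: "second_countable T" and topspace_eq: "topspace T = (\<Union>i\<in>I. cdom i)"
  using closed by (auto simp: closed_riemannian_manifold_def riemannian_manifold_def smooth_manifold_def)

lemma chart_homeomorphic:
  "i \<in> I \<Longrightarrow> homeomorphic_map (subtopology T (cdom i)) (top_of_set (cod i)) (\<phi> i)"
  using manifold by (auto simp: smooth_manifold_def)

lemma openin_dom: "i \<in> I \<Longrightarrow> openin T (cdom i)" and open_cod: "i \<in> I \<Longrightarrow> open (cod i)"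
  using manifold by (auto simp: smooth_manifold_def)

lemma dom_subset: "i \<in> I \<Longrightarrow> cdom i \<subseteq> topspace T"
  using openin_dom openin_subset by blast

lemma inj_coord: "i \<in> I \<Longrightarrow> inj_on (\<phi> i) (cdom i)"
  using chart_homeomorphic[of i] dom_subset[of i] by (auto simp: homeomorphic_map_def Int_absorb1)

lemma \<psi>_\<phi> [simp]: "i \<in> I \<Longrightarrow> x \<in> cdom i \<Longrightarrow> \<psi> i (\<phi> i x) = x"
  using inj_coord by (simp add: inv_into_f_f)

lemma \<phi>_\<psi>: "u \<in> cod i \<Longrightarrow> \<phi> i (\<psi> i u) = u" and \<psi>_in: "u \<in> cod i \<Longrightarrow> \<psi> i u \<in> cdom i"
  by (auto simp: f_inv_into_f inv_into_into)

lemma continuous_coord: "i \<in> I \<Longrightarrow> continuous_map (subtopology T (cdom i)) (top_of_set (cod i)) (\<phi> i)"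
  using chart_homeomorphic homeomorphic_imp_continuous_map by blast

text \<open>The homeomorphism comes with some continuous inverse, which by injectivity agrees with
  \<open>\<psi> i\<close> on \<open>cod i\<close>.\<close>

lemma continuous_inverse: "i \<in> I \<Longrightarrow> continuous_map (top_of_set (cod i)) (subtopology T (cdom i)) (\<psi> i)"
proof -
  assume i: "i \<in> I"
  then obtain g where g: "homeomorphic_maps (subtopology T (cdom i)) (top_of_set (cod i)) (\<phi> i) g"
    using chart_homeomorphic homeomorphic_map_maps by blast
  have gi: "g u = \<psi> i u" if "u \<in> cod i" for u
  proof -
    have "g u \<in> cdom i" "\<phi> i (g u) = u"
      using g that by (auto simp: homeomorphic_maps_def continuous_map_def Pi_iff)
    then show ?thesis using i by (metis \<psi>_\<phi>)
  qed
  have "continuous_map (top_of_set (cod i)) (subtopology T (cdom i)) g"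
    using g by (simp add: homeomorphic_maps_def)
  then show ?thesis by (rule continuous_map_eq) (simp add: gi)
qed

lemma openin_coord_preimage: "i \<in> I \<Longrightarrow> open Q \<Longrightarrow> openin T {x \<in> cdom i. \<phi> i x \<in> Q}"
proof -
  assume i: "i \<in> I" and Q: "open Q"
  have "openin (subtopology T (cdom i)) {x \<in> topspace (subtopology T (cdom i)). \<phi> i x \<in> Q \<inter> cod i}"
    using Q openin_open_Int[OF Q, of "cod i"]
    by (intro openin_continuous_map_preimage[OF continuous_coord[OF i]]) (simp add: Int_commute)
  moreover have "{x \<in> topspace (subtopology T (cdom i)). \<phi> i x \<in> Q \<inter> cod i} = {x \<in> cdom i. \<phi> i x \<in> Q}"
    using dom_subset[OF i] by auto
  ultimately show ?thesis using openin_dom[OF i] openin_open_subtopology by metis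
qed

lemma coord_image_eq: "i \<in> I \<Longrightarrow> W \<subseteq> cdom i \<Longrightarrow> \<phi> i ` W = {u \<in> cod i. \<psi> i u \<in> W}"
  by (force simp: \<phi>_\<psi>)

lemma inverse_image_eq: "i \<in> I \<Longrightarrow> Q \<subseteq> cod i \<Longrightarrow> \<psi> i ` Q = {x \<in> cdom i. \<phi> i x \<in> Q}"
  by (auto simp: \<phi>_\<psi> \<psi>_in subset_iff intro!: image_eqI[where x = "\<phi> i _"])

lemma openin_inverse_image: "i \<in> I \<Longrightarrow> open Q \<Longrightarrow> Q \<subseteq> cod i \<Longrightarrow> openin T (\<psi> i ` Q)"
  using inverse_image_eq openin_coord_preimage by simp

lemma open_coord_image: "i \<in> I \<Longrightarrow> openin T W \<Longrightarrow> open (\<phi> i ` (W \<inter> cdom i))"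
proof -
  assume i: "i \<in> I" and W: "openin T W"
  have "openin (subtopology T (cdom i)) (W \<inter> cdom i)"
    using W by (simp add: openin_subtopology_Int)
  then have "openin (top_of_set (cod i)) {u \<in> topspace (top_of_set (cod i)). \<psi> i u \<in> W \<inter> cdom i}"
    by (rule openin_continuous_map_preimage[OF continuous_inverse[OF i]])
  then show ?thesis
    using coord_image_eq[OF i, of "W \<inter> cdom i"] open_cod[OF i] by (simp add: openin_open_eq)
qed

text \<open>A compact part of a chart is compact in the Hausdorff manifold and thus closed there,
  not only relative to the chart. A curve can therefore not leave the chart as a limit of points of
  that part.\<close>

lemma closedin_inverse_image:
  assumes i: "i \<in> I" and C: "compact C" "C \<subseteq> cod i"
  shows "closedin T (\<psi> i ` C)"
proof -
  have "compactin (top_of_set (cod i)) C" using C by (simp add: compactin_subtopology)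
  then have "compactin (subtopology T (cdom i)) (\<psi> i ` C)"
    using continuous_inverse[OF i] image_compactin by blast
  then have "compactin T (\<psi> i ` C)" by (simp add: compactin_subtopology)
  then show ?thesis using Hausdorff compactin_imp_closedin by blast
qed

section \<open>Transition maps and the metric tensor\<close>

lemma transition_eq: "transition M i j u = \<phi> j (\<psi> i u)"
  by (simp add: transition_def)

lemma transition_coord: "i \<in> I \<Longrightarrow> x \<in> cdom i \<Longrightarrow> transition M i j (\<phi> i x) = \<phi> j x"
  by (simp add: transition_eq)

lemma open_overlap: "i \<in> I \<Longrightarrow> j \<in> I \<Longrightarrow> open (\<phi> i ` (cdom i \<inter> cdom j))"
  using open_coord_image[of i "cdom j"] openin_dom by (simp add: Int_commute)

lemma transition_smooth: "i \<in> I \<Longrightarrow> j \<in> I \<Longrightarrow> Ck_on n (transition M i j) (\<phi> i ` (cdom i \<inter> cdom j))"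
  using manifold by (auto simp: smooth_manifold_def smooth_on_def)

lemma transition_has_derivative:
  "i \<in> I \<Longrightarrow> j \<in> I \<Longrightarrow> u \<in> \<phi> i ` (cdom i \<inter> cdom j) \<Longrightarrow> (transition M i j has_derivative jac i j u) (at u)"
  using transition_smooth[of i j 1] frechet_derivative_works by auto

lemma continuous_on_jac: "i \<in> I \<Longrightarrow> j \<in> I \<Longrightarrow> continuous_on (\<phi> i ` (cdom i \<inter> cdom j)) (\<lambda>u. jac i j u v)"
  using transition_smooth[of i j 1] by auto

lemma transition_inverse:
  "i \<in> I \<Longrightarrow> j \<in> I \<Longrightarrow> u \<in> \<phi> i ` (cdom i \<inter> cdom j) \<Longrightarrow> transition M j i (transition M i j u) = u"
  by (auto simp: transition_eq)

lemma transition_image: "i \<in> I \<Longrightarrow> j \<in> I \<Longrightarrow> W \<subseteq> cdom i \<inter> cdom j \<Longrightarrow> transition M i j ` \<phi> i ` W = \<phi> j ` W"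
  by (simp add: image_image transition_eq) (intro image_cong, auto)

lemma metric_continuous: "i \<in> I \<Longrightarrow> continuous_on (cod i) (metric M i)"
proof -
  assume "i \<in> I"
  then have "Ck_on 0 (metric M i) (cod i)"
    using closed unfolding closed_riemannian_manifold_def riemannian_manifold_def smooth_on_def by blast
  then show ?thesis by simp
qed

lemma metric_sym: "i \<in> I \<Longrightarrow> x \<in> cod i \<Longrightarrow> transpose (metric M i x) = metric M i x"
  and metric_pos: "i \<in> I \<Longrightarrow> x \<in> cod i \<Longrightarrow> v \<noteq> 0 \<Longrightarrow> v \<bullet> (metric M i x *v v) > 0"
  using closed unfolding closed_riemannian_manifold_def riemannian_manifold_def by blast+

lemma metric_transition:
  "i \<in> I \<Longrightarrow> j \<in> I \<Longrightarrow> x \<in> \<phi> i ` (cdom i \<inter> cdom j) \<Longrightarrow>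
    metric M i x = transpose (matrix (jac i j x)) ** metric M j (transition M i j x) ** matrix (jac i j x)"
  using closed unfolding closed_riemannian_manifold_def riemannian_manifold_def Let_def by blast

lemma continuous_on_det_metric: "i \<in> I \<Longrightarrow> continuous_on (cod i) (\<lambda>x. sqrt (det (metric M i x)))"
  unfolding det_def by (intro continuous_intros metric_continuous continuous_on_component)

lemma finite_chart_cover: obtains F where "finite F" "F \<subseteq> I" "topspace T = (\<Union>i\<in>F. cdom i)"
proof -
  have "\<forall>U\<in>cdom ` I. openin T U" "topspace T \<subseteq> \<Union>(cdom ` I)"
    using openin_dom topspace_eq by auto
  then obtain \<F> where \<F>: "finite \<F>" "\<F> \<subseteq> cdom ` I" "topspace T \<subseteq> \<Union>\<F>"
    using compact[unfolded compact_space_alt, rule_format, of "cdom ` I"] by auto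
  then obtain F where "F \<subseteq> I" "finite F" "\<F> = cdom ` F" by (meson finite_subset_image)
  moreover have "(\<Union>i\<in>F. cdom i) \<subseteq> topspace T" using \<open>F \<subseteq> I\<close> dom_subset by (meson UN_least subsetD)
  ultimately have "topspace T = (\<Union>i\<in>F. cdom i)" using \<F>(3) by (intro equalityI) auto
  with \<open>finite F\<close> \<open>F \<subseteq> I\<close> that show ?thesis by blast
qed

section \<open>Borel sets and the volume within one chart\<close>

abbreviation "B \<equiv> borel_manifold M"

lemma space_B [simp]: "space B = topspace T"
  unfolding borel_manifold_def by (rule space_measure_of) (auto dest: openin_subset)

lemma sets_B: "sets B = sigma_sets (topspace T) {U. openin T U}"
  unfolding borel_manifold_def by (rule sets_measure_of) (auto dest: openin_subset)

lemma openin_sets_B: "openin T W \<Longrightarrow> W \<in> sets B"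
  unfolding sets_B by (rule sigma_sets.Basic) simp

lemma dom_sets_B: "i \<in> I \<Longrightarrow> cdom i \<in> sets B"
  using openin_sets_B openin_dom by blast

lemma measurable_inverse: "i \<in> I \<Longrightarrow> \<psi> i \<in> restrict_space borel (cod i) \<rightarrow>\<^sub>M B"
  unfolding borel_manifold_def
proof (rule measurable_measure_of)
  assume i: "i \<in> I"
  show "\<psi> i \<in> space (restrict_space borel (cod i)) \<rightarrow> topspace T"
    using \<psi>_in dom_subset[OF i] by (auto simp: space_restrict_space)
  fix W assume "W \<in> {U. openin T U}"
  then have "open (\<phi> i ` (W \<inter> cdom i))" using open_coord_image[OF i] by simp
  moreover have "\<psi> i -` W \<inter> space (restrict_space borel (cod i)) = \<phi> i ` (W \<inter> cdom i)"
    using coord_image_eq[OF i, of "W \<inter> cdom i"] \<psi>_in by (auto simp: space_restrict_space)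
  ultimately show "\<psi> i -` W \<inter> space (restrict_space borel (cod i)) \<in> sets (restrict_space borel (cod i))"
    using open_cod[OF i] by (auto simp: sets_restrict_space_iff)
qed (auto dest: openin_subset)

lemma coord_image_borel: "i \<in> I \<Longrightarrow> A \<in> sets B \<Longrightarrow> A \<subseteq> cdom i \<Longrightarrow> \<phi> i ` A \<in> sets borel"
proof -
  assume i: "i \<in> I" and A: "A \<in> sets B" "A \<subseteq> cdom i"
  have "\<psi> i -` A \<inter> space (restrict_space borel (cod i)) \<in> sets (restrict_space borel (cod i))"
    using measurable_sets[OF measurable_inverse[OF i] A(1)] .
  moreover have "\<psi> i -` A \<inter> space (restrict_space borel (cod i)) = \<phi> i ` A"
    using coord_image_eq[OF i A(2)] by (auto simp: space_restrict_space)
  ultimately show ?thesis using open_cod[OF i] by (auto simp: sets_restrict_space_iff)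
qed

definition "dens i x = ennreal (sqrt (det (metric M i x)))"

definition "local_vol i A = (\<integral>\<^sup>+x\<in>\<phi> i ` A. dens i x \<partial>lborel)"

lemma dens_measurable: "i \<in> I \<Longrightarrow> (\<lambda>x. dens i x * indicator (cod i) x) \<in> borel_measurable borel"
proof -
  assume i: "i \<in> I"
  have "(\<lambda>x. indicator (cod i) x *\<^sub>R sqrt (det (metric M i x))) \<in> borel_measurable borel"
    using open_cod[OF i] continuous_on_det_metric[OF i] by (intro borel_measurable_continuous_on_indicator) auto
  then have "(\<lambda>x. ennreal (indicator (cod i) x *\<^sub>R sqrt (det (metric M i x)))) \<in> borel_measurable borel"
    by simp
  moreover have "(\<lambda>x. ennreal (indicator (cod i) x *\<^sub>R sqrt (det (metric M i x)))) = (\<lambda>x. dens i x * indicator (cod i) x)"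
    by (auto simp: indicator_def dens_def)
  ultimately show ?thesis by simp
qed

lemma dens_transition:
  assumes "i \<in> I" "j \<in> I" "x \<in> \<phi> i ` (cdom i \<inter> cdom j)"
  shows "dens i x = dens j (transition M i j x) * ennreal \<bar>det (matrix (jac i j x))\<bar>"
proof -
  have "det (metric M i x) = (det (matrix (jac i j x)))\<^sup>2 * det (metric M j (transition M i j x))"
    by (subst metric_transition[OF assms]) (simp add: det_mul power2_eq_square)
  then show ?thesis
    by (simp add: dens_def real_sqrt_mult ennreal_mult'' mult.commute)
qed

text \<open>By \<open>dens_transition\<close> the two densities differ exactly by the Jacobian of
  the transition map, which is the factor that the change of variables produces.\<close>

lemma local_vol_eq:
  assumes ij: "i \<in> I" "j \<in> I" and A: "A \<in> sets B" "A \<subseteq> cdom i \<inter> cdom j"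
  shows "local_vol i A = local_vol j A"
proof -
  let ?S = "\<phi> i ` (cdom i \<inter> cdom j)" and ?g = "transition M i j"
  \<comment> \<open>The indicator of \<open>cod j\<close> makes the integrand Borel on the whole
    space, since the metric is controlled only on the chart image.\<close>
  let ?f = "\<lambda>y. dens j y * indicator (cod j) y * indicator (\<phi> j ` A) y"
  have img: "?g ` ?S = \<phi> j ` (cdom i \<inter> cdom j)" using transition_image[OF ij] by blast
  have cj: "\<phi> j ` A \<in> sets borel" using coord_image_borel[OF ij(2) A(1)] A(2) by blast
  have "local_vol j A = (\<integral>\<^sup>+y\<in>?g ` ?S. ?f y \<partial>lborel)"
    unfolding local_vol_def img using A(2) by (intro nn_integral_cong) (auto simp: indicator_def)
  also have "\<dots> = (\<integral>\<^sup>+x\<in>?S. ?f (?g x) * ennreal \<bar>det (matrix (jac i j x))\<bar> \<partial>lborel)"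
  proof (rule nn_integral_image_change_of_variables[where h = "transition M j i"])
    show "open ?S" "open (?g ` ?S)"
      unfolding img using open_overlap[OF ij] open_overlap[OF ij(2,1)] by (auto simp: Int_commute)
    show "continuous_on (?g ` ?S) (transition M j i)"
      unfolding img using transition_smooth[OF ij(2,1), of 0] by (simp add: Int_commute)
    show "continuous_on ?S (\<lambda>x. det (matrix (jac i j x)))"
      unfolding det_def matrix_def
      by (simp, intro continuous_intros continuous_on_component continuous_on_jac ij)
    show "?f \<in> borel_measurable borel"
      using cj by (intro borel_measurable_times_ennreal[OF dens_measurable[OF ij(2)]]) simp
  qed (use ij transition_has_derivative transition_inverse in auto)
  also have "\<dots> = local_vol i A"
    unfolding local_vol_def
  proof (intro nn_integral_cong)
    fix x :: "real^'k"
    show "?f (?g x) * ennreal \<bar>det (matrix (jac i j x))\<bar> * indicator ?S x = dens i x * indicator (\<phi> i ` A) x"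
    proof (cases "x \<in> ?S")
      case True
      then obtain p where p: "p \<in> cdom i" "p \<in> cdom j" "x = \<phi> i p" by auto
      have "?g x \<in> cod j" using p ij by (auto simp: transition_coord)
      moreover have "?g x \<in> \<phi> j ` A \<longleftrightarrow> x \<in> \<phi> i ` A"
        using p ij A inj_on_image_mem_iff[OF inj_coord[OF ij(1)] p(1), of A]
          inj_on_image_mem_iff[OF inj_coord[OF ij(2)] p(2), of A]
        by (simp add: transition_coord)
      ultimately show ?thesis
        using dens_transition[OF ij True] True by (simp add: indicator_def)
    next
      case False
      then show ?thesis using A by (auto simp: indicator_def)
    qed
  qed
  finally show ?thesis by simp
qed

text \<open>The volume of chart \<open>i\<close>, carried to the manifold. The restriction to
  \<open>cod i\<close> comes first because \<open>dens i\<close> and \<open>\<psi> i\<close> have a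
  meaning only there.\<close>

definition "chart_measure i = distr (density (restrict_space lborel (cod i)) (dens i)) B (\<psi> i)"

lemma dens_measurable_restrict: "i \<in> I \<Longrightarrow> dens i \<in> borel_measurable (restrict_space lborel (cod i))"
  using dens_measurable open_cod by (subst borel_measurable_restrict_space_iff_ennreal) auto

lemma nn_integral_chart_measure:
  assumes i: "i \<in> I" and f: "f \<in> borel_measurable B"
  shows "(\<integral>\<^sup>+x. f x \<partial>chart_measure i) = (\<integral>\<^sup>+u\<in>cod i. f (\<psi> i u) * dens i u \<partial>lborel)"
proof -
  have psi: "\<psi> i \<in> restrict_space lborel (cod i) \<rightarrow>\<^sub>M B"
    using measurable_inverse[OF i] by (simp cong: measurable_cong_sets add: sets_restrict_space)
  have "(\<integral>\<^sup>+x. f x \<partial>chart_measure i) = (\<integral>\<^sup>+u. f (\<psi> i u) \<partial>density (restrict_space lborel (cod i)) (dens i))"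
    unfolding chart_measure_def using psi f by (intro nn_integral_distr) (simp_all)
  also have "\<dots> = (\<integral>\<^sup>+u. dens i u * f (\<psi> i u) \<partial>restrict_space lborel (cod i))"
    using psi f dens_measurable_restrict[OF i] by (intro nn_integral_density) (auto intro: measurable_compose)
  also have "\<dots> = (\<integral>\<^sup>+u\<in>cod i. dens i u * f (\<psi> i u) \<partial>lborel)"
    using open_cod[OF i] by (intro nn_integral_restrict_space) simp
  finally show ?thesis by (simp add: mult.commute)
qed

lemma emeasure_chart_measure:
  assumes i: "i \<in> I" and A: "A \<in> sets B"
  shows "emeasure (chart_measure i) A = local_vol i (A \<inter> cdom i)"
proof -
  have "emeasure (chart_measure i) A = (\<integral>\<^sup>+x. indicator A x \<partial>chart_measure i)"
    using A by (simp add: chart_measure_def)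
  also have "\<dots> = (\<integral>\<^sup>+u\<in>cod i. indicator A (\<psi> i u) * dens i u \<partial>lborel)"
    using A by (intro nn_integral_chart_measure i) simp
  also have "\<dots> = local_vol i (A \<inter> cdom i)"
    unfolding local_vol_def using coord_image_eq[OF i, of "A \<inter> cdom i"] \<psi>_in
    by (intro nn_integral_cong) (auto simp: indicator_def)
  finally show ?thesis .
qed

section \<open>Gluing the local volumes\<close>

definition "vol_spec \<nu> \<longleftrightarrow> sets \<nu> = sets B \<and>
  (\<forall>i\<in>I. \<forall>A\<in>sets B. A \<subseteq> cdom i \<longrightarrow> emeasure \<nu> A = local_vol i A)"

lemma riemannian_volume_eq: "riemannian_volume M = (THE \<nu>. vol_spec \<nu>)"
  unfolding riemannian_volume_def vol_spec_def local_vol_def dens_def ..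

text \<open>A finite chart cover is made disjoint by numbering it and removing from each chart those
  with smaller number; a point then lies in the piece of the first chart that contains it.\<close>

lemma chart_partition:
  obtains F P where "finite F" "F \<subseteq> I" "\<And>i. i \<in> F \<Longrightarrow> P i \<in> sets B" "\<And>i. i \<in> F \<Longrightarrow> P i \<subseteq> cdom i"
    "disjoint_family_on P F" "(\<Union>i\<in>F. P i) = topspace T"
proof -
  obtain F where F: "finite F" "F \<subseteq> I" "topspace T = (\<Union>i\<in>F. cdom i)" by (rule finite_chart_cover)
  obtain e :: "'i \<Rightarrow> nat" where e: "inj_on e F" using F(1) finite_imp_inj_to_nat_seg by metis
  define P where "P i = cdom i - (\<Union>j\<in>{j\<in>F. e j < e i}. cdom j)" for i
  have "\<exists>i\<in>F. x \<in> P i" if x: "x \<in> topspace T" for x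
  proof -
    define Q where "Q n \<longleftrightarrow> (\<exists>j\<in>F. e j = n \<and> x \<in> cdom j)" for n
    have "\<exists>n. Q n" using x F(3) by (auto simp: Q_def)
    then have "Q (LEAST n. Q n)" by (rule LeastI_ex)
    then obtain j where j: "j \<in> F" "e j = (LEAST n. Q n)" "x \<in> cdom j" by (auto simp: Q_def)
    have "x \<notin> cdom l" if "l \<in> F" "e l < e j" for l
    proof -
      have "\<not> Q (e l)" using that(2) unfolding j(2) by (rule not_less_Least)
      then show ?thesis using that(1) unfolding Q_def by blast
    qed
    with j show ?thesis unfolding P_def by auto
  qed
  moreover have "P i \<inter> P j = {}" if "i \<in> F" "j \<in> F" "i \<noteq> j" for i j
    using that inj_onD[OF e, of i j] by (cases "e i" "e j" rule: linorder_cases) (auto simp: P_def)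
  moreover have "P i \<in> sets B" if "i \<in> F" for i
    unfolding P_def using F that by (intro sets.Diff sets.finite_UN dom_sets_B) auto
  ultimately show ?thesis
    using F that[of F P] by (fastforce simp: P_def disjoint_family_on_def)
qed

lemma emeasure_partition:
  assumes "sets \<nu> = sets B" "finite F" "\<And>i. i \<in> F \<Longrightarrow> P i \<in> sets B"
    "disjoint_family_on P F" "(\<Union>i\<in>F. P i) = topspace T" "A \<in> sets B"
  shows "emeasure \<nu> A = (\<Sum>i\<in>F. emeasure \<nu> (A \<inter> P i))"
proof -
  have "(\<Sum>i\<in>F. emeasure \<nu> (A \<inter> P i)) = emeasure \<nu> (\<Union>i\<in>F. A \<inter> P i)"
    using assms by (intro sum_emeasure) (fastforce simp: disjoint_family_on_def)+
  also have "(\<Union>i\<in>F. A \<inter> P i) = A"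
    using assms(5) sets.sets_into_space[OF assms(6)] by auto
  finally show ?thesis by simp
qed

text \<open>Every Borel set splits into finitely many pieces inside charts, and there the
  specification fixes the value.\<close>

lemma vol_spec_unique:
  assumes "vol_spec \<nu>" "vol_spec \<nu>'"
  shows "\<nu> = \<nu>'"
proof (rule measure_eqI)
  show "sets \<nu> = sets \<nu>'" using assms by (simp add: vol_spec_def)
  obtain F P where F: "finite F" "F \<subseteq> I" and P: "\<And>i. i \<in> F \<Longrightarrow> P i \<in> sets B" "\<And>i. i \<in> F \<Longrightarrow> P i \<subseteq> cdom i"
    "disjoint_family_on P F" "(\<Union>i\<in>F. P i) = topspace T" by (rule chart_partition) blast
  fix A assume "A \<in> sets \<nu>"
  then have A: "A \<in> sets B" using assms by (simp add: vol_spec_def)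
  have eq: "emeasure \<nu>'' (A \<inter> P i) = local_vol i (A \<inter> P i)" if "vol_spec \<nu>''" "i \<in> F" for i \<nu>''
  proof -
    have "i \<in> I" "A \<inter> P i \<in> sets B" "A \<inter> P i \<subseteq> cdom i"
      using that A P(1,2)[OF that(2)] F(2) by auto
    then show ?thesis using that(1) unfolding vol_spec_def by simp
  qed
  have "emeasure \<nu>'' A = (\<Sum>i\<in>F. local_vol i (A \<inter> P i))" if "vol_spec \<nu>''" for \<nu>''
    using emeasure_partition[OF _ F(1) P(1,3,4) A, of \<nu>''] that eq[OF that] by (simp add: vol_spec_def)
  then show "emeasure \<nu> A = emeasure \<nu>' A" using assms by simp
qed

text \<open>Each piece of a chart partition is measured in its own chart. The result fits any other
  chart \<open>j\<close> because \<open>local_vol_eq\<close> allows every piece inside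
  \<open>cdom j\<close> to be measured in chart \<open>j\<close> instead.\<close>

lemma vol_spec_exists: "\<exists>\<nu>. vol_spec \<nu>"
proof -
  obtain F P where F: "finite F" "F \<subseteq> I" and P: "\<And>i. i \<in> F \<Longrightarrow> P i \<in> sets B" "\<And>i. i \<in> F \<Longrightarrow> P i \<subseteq> cdom i"
    "disjoint_family_on P F" "(\<Union>i\<in>F. P i) = topspace T" by (rule chart_partition) blast
  define m where "m A = (\<Sum>i\<in>F. emeasure (chart_measure i) (A \<inter> P i))" for A
  define \<nu> where "\<nu> = measure_of (topspace T) (sets B) m"
  have sa: "sigma_algebra (topspace T) (sets B)" using sets.sigma_algebra_axioms[of B] by simp
  have em: "emeasure \<nu> A = m A" if "A \<in> sets B" for A
    unfolding \<nu>_def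
  proof (rule emeasure_measure_of_sigma[OF sa _ _ that])
    show "positive (sets B) m" by (simp add: positive_def m_def)
    show "countably_additive (sets B) m"
    proof (rule countably_additiveI)
      fix C :: "nat \<Rightarrow> 'a set"
      assume C: "range C \<subseteq> sets B" "disjoint_family C"
      have "(\<lambda>n. emeasure (chart_measure i) (C n \<inter> P i)) sums emeasure (chart_measure i) ((\<Union>n. C n) \<inter> P i)"
        if i: "i \<in> F" for i
      proof -
        have "(\<Sum>n. emeasure (chart_measure i) (C n \<inter> P i)) = emeasure (chart_measure i) (\<Union>n. C n \<inter> P i)"
          using C P(1)[OF i] by (intro suminf_emeasure) (auto simp: chart_measure_def disjoint_family_on_def)
        moreover have "(\<Union>n. C n \<inter> P i) = (\<Union>n. C n) \<inter> P i" by auto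
        ultimately show ?thesis
          using summable_sums[OF summableI, of "\<lambda>n. emeasure (chart_measure i) (C n \<inter> P i)"] by simp
      qed
      then have "(\<lambda>n. m (C n)) sums m (\<Union>n. C n)"
        unfolding m_def by (rule sums_sum)
      then show "(\<Sum>n. m (C n)) = m (\<Union>n. C n)" by (simp add: sums_iff)
    qed
  qed
  have sets\<nu>: "sets \<nu> = sets B"
    unfolding \<nu>_def using sigma_algebra.sets_measure_of_eq[OF sa] by simp
  have "emeasure \<nu> A = local_vol j A" if j: "j \<in> I" and A: "A \<in> sets B" "A \<subseteq> cdom j" for j A
  proof -
    have "emeasure (chart_measure i) (A \<inter> P i) = emeasure (chart_measure j) (A \<inter> P i)" if i: "i \<in> F" for i
    proof -
      have iI: "i \<in> I" and m: "A \<inter> P i \<in> sets B" using i F A P by auto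
      have "A \<inter> P i \<inter> cdom i = A \<inter> P i" "A \<inter> P i \<inter> cdom j = A \<inter> P i" using A P(2)[OF i] by auto
      then show ?thesis
        using local_vol_eq[OF iI j m] emeasure_chart_measure[OF iI m] emeasure_chart_measure[OF j m] by auto
    qed
    then have "emeasure \<nu> A = (\<Sum>i\<in>F. emeasure (chart_measure j) (A \<inter> P i))"
      using em[OF A(1)] by (simp add: m_def)
    also have "\<dots> = emeasure (chart_measure j) A"
      by (rule emeasure_partition[symmetric, OF _ F(1) P(1,3,4) A(1)]) (simp add: chart_measure_def)
    also have "\<dots> = local_vol j A"
      using emeasure_chart_measure[OF j A(1)] A(2) by (simp add: Int_absorb2)
    finally show ?thesis .
  qed
  then show ?thesis using sets\<nu> by (auto simp: vol_spec_def)
qed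

abbreviation "vol \<equiv> riemannian_volume M"

lemma vol_spec_vol: "vol_spec vol"
  unfolding riemannian_volume_eq using vol_spec_exists vol_spec_unique by (metis theI)

lemma sets_vol [simp, measurable_cong]: "sets vol = sets B"
  using vol_spec_vol by (simp add: vol_spec_def)

lemma space_vol [simp]: "space vol = topspace T"
  using sets_eq_imp_space_eq[OF sets_vol] by simp

lemma emeasure_vol: "i \<in> I \<Longrightarrow> A \<in> sets B \<Longrightarrow> A \<subseteq> cdom i \<Longrightarrow> emeasure vol A = local_vol i A"
  using vol_spec_vol by (simp add: vol_spec_def)

text \<open>\<open>vol\<close> cut down to the chart is the measure \<open>chart_measure i\<close>,
  whose integrals are known in coordinates.\<close>

lemma nn_integral_vol_chart:
  assumes i: "i \<in> I" and f: "f \<in> borel_measurable B"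
  shows "(\<integral>\<^sup>+x\<in>cdom i. f x \<partial>vol) = (\<integral>\<^sup>+u\<in>cod i. f (\<psi> i u) * dens i u \<partial>lborel)"
proof -
  have "density vol (indicator (cdom i)) = chart_measure i"
  proof (rule measure_eqI)
    show "sets (density vol (indicator (cdom i) :: 'a \<Rightarrow> ennreal)) = sets (chart_measure i)"
      by (simp add: chart_measure_def)
    fix A assume "A \<in> sets (density vol (indicator (cdom i) :: 'a \<Rightarrow> ennreal))"
    then have A: "A \<in> sets B" by simp
    have m: "A \<inter> cdom i \<in> sets B" using A dom_sets_B[OF i] by auto
    have "emeasure (density vol (indicator (cdom i))) A = emeasure vol (A \<inter> cdom i)"
      using A m dom_sets_B[OF i]
      by (subst emeasure_density) (auto simp: indicator_inter_arith[symmetric] mult.commute Int_commute)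
    also have "\<dots> = emeasure (chart_measure i) A"
      using emeasure_vol[OF i m] emeasure_chart_measure[OF i A] by simp
    finally show "emeasure (density vol (indicator (cdom i))) A = emeasure (chart_measure i) A" .
  qed
  moreover have "(\<integral>\<^sup>+x. f x \<partial>density vol (indicator (cdom i))) = (\<integral>\<^sup>+x\<in>cdom i. f x \<partial>vol)"
    using f dom_sets_B[OF i] by (subst nn_integral_density) (auto simp: mult.commute measurable_cong_sets[OF sets_vol refl])
  ultimately show ?thesis using nn_integral_chart_measure[OF i f] by simp
qed

end

section \<open>Piecewise smooth curves and the geodesic distance\<close>

lemma partition_mono:
  fixes p :: "nat \<Rightarrow> real"
  assumes "\<And>k. k < n \<Longrightarrow> p k < p (Suc k)" "k \<le> l" "l \<le> n"
  shows "p k \<le> p l"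
  using assms(2,3)
proof (induction l rule: dec_induct)
  case (step m)
  then show ?case using assms(1)[of m] by simp
qed simp

lemma partition_cell:
  fixes p :: "nat \<Rightarrow> real"
  assumes "p 0 < t" "t < p n" "t \<notin> p ` {..n}"
  shows "\<exists>k<n. p k < t \<and> t < p (Suc k)"
proof -
  define l where "l = (LEAST l. t < p l)"
  have l: "t < p l" "l \<le> n"
    using LeastI[of "\<lambda>l. t < p l" n] Least_le[of "\<lambda>l. t < p l" n] assms(2) by (auto simp: l_def)
  with assms(1) obtain k where k: "l = Suc k" by (cases l) auto
  then have "\<not> t < p k" using not_less_Least[of k "\<lambda>l. t < p l"] by (simp add: l_def)
  moreover have "p k \<noteq> t" using assms(3) l k by auto
  ultimately show ?thesis using l k by (intro exI[of _ k]) auto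
qed

lemma inner_congruent:
  fixes J G :: "real^'n::finite^'n"
  shows "v \<bullet> ((transpose J ** G ** J) *v v) = (J *v v) \<bullet> (G *v (J *v v))"
proof -
  have "v \<bullet> (transpose J *v w) = (J *v v) \<bullet> w" for w
    by (metis dot_lmul_matrix inner_commute transpose_matrix_vector)
  then show ?thesis by (simp only: matrix_vector_mul_assoc[symmetric])
qed

context closed_riemannian
begin

section \<open>Velocity, speed and length away from break points\<close>

abbreviation "vel i \<gamma> t \<equiv> vector_derivative (\<phi> i \<circ> \<gamma>) (at t)"

text \<open>The weakening of piecewise smoothness that suffices for lengths. It speaks of two-sided
  derivatives, as \<open>speed\<close> does, whereas \<open>C1_arc\<close> gives derivatives within
  closed subintervals.\<close>

definition "regular \<gamma> F \<longleftrightarrow> finite F \<and> pathin T \<gamma> \<and>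
  (\<forall>i\<in>I. \<forall>t\<in>{0<..<1}-F. \<gamma> t \<in> cdom i \<longrightarrow>
     ((\<phi> i \<circ> \<gamma>) has_vector_derivative vel i \<gamma> t) (at t) \<and> isCont (vel i \<gamma>) t)"

lemma open_path_preimage:
  assumes "pathin T \<gamma>" "openin T W"
  shows "open {t\<in>{0<..<1}. \<gamma> t \<in> W}"
proof -
  have "openin (top_of_set {0..1}) {t \<in> topspace (top_of_set {0..1}). \<gamma> t \<in> W}"
    using assms unfolding pathin_def by (intro openin_continuous_map_preimage) auto
  then obtain Q where "open Q" "{t \<in> {0..1}. \<gamma> t \<in> W} = {0..1} \<inter> Q" by (auto simp: openin_open)
  then have "{t\<in>{0<..<1}. \<gamma> t \<in> W} = {0<..<1} \<inter> Q" by fastforce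
  then show ?thesis using open_Int[OF open_greaterThanLessThan \<open>open Q\<close>] by metis
qed

lemma open_regular_preimage:
  assumes "pathin T \<gamma>" "openin T W" "finite F"
  shows "open {t\<in>{0<..<1}-F. \<gamma> t \<in> W}"
proof -
  have "{t\<in>{0<..<1}-F. \<gamma> t \<in> W} = {t\<in>{0<..<1}. \<gamma> t \<in> W} - F" by auto
  then show ?thesis
    using open_Diff[OF open_path_preimage[OF assms(1,2)] finite_imp_closed[OF assms(3)]] by metis
qed

lemma piecewise_C1_curve_regular:
  assumes "piecewise_C1_curve M \<gamma>"
  obtains F where "regular \<gamma> F"
proof -
  obtain p n where p: "p 0 = 0" "p n = 1" "\<And>k. k < n \<Longrightarrow> p k < p (Suc k)"
    "\<And>k. k < n \<Longrightarrow> C1_arc M \<gamma> (p k) (p (Suc k))" and path: "pathin T \<gamma>"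
    using assms unfolding piecewise_C1_curve_def by blast
  define F where "F = p ` {..n}"
  have "((\<phi> i \<circ> \<gamma>) has_vector_derivative vel i \<gamma> t) (at t) \<and> isCont (vel i \<gamma>) t"
    if i: "i \<in> I" and t: "t \<in> {0<..<1} - F" "\<gamma> t \<in> cdom i" for i t
  proof -
    obtain k where k: "k < n" "p k < t" "t < p (Suc k)"
      using partition_cell[of p t n] t p(1,2) by (auto simp: F_def)
    obtain D where D: "\<And>s. s \<in> {p k..p (Suc k)} \<Longrightarrow> \<gamma> s \<in> cdom i \<Longrightarrow>
        ((\<phi> i \<circ> \<gamma>) has_vector_derivative D s) (at s within {p k..p (Suc k)})"
      and Dc: "continuous_on {s\<in>{p k..p (Suc k)}. \<gamma> s \<in> cdom i} D"
      using p(4)[OF k(1)] i unfolding C1_arc_def by blast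
    \<comment> \<open>An open set inside one partition cell and one chart: here the derivatives
      within the closed cell are two-sided ones, and \<open>D\<close> is the velocity near
      \<open>t\<close> and not only at \<open>t\<close>.\<close>
    define Q where "Q = {s\<in>{0<..<1}. \<gamma> s \<in> cdom i} \<inter> {p k<..<p (Suc k)}"
    have Q: "open Q" "t \<in> Q"
      unfolding Q_def using open_path_preimage[OF path openin_dom[OF i]] t k by auto
    have der: "((\<phi> i \<circ> \<gamma>) has_vector_derivative D s) (at s)" if "s \<in> Q" for s
      using D[of s] that at_within_Icc_at[of "p k" s "p (Suc k)"] by (auto simp: Q_def)
    then have vel: "vel i \<gamma> s = D s" if "s \<in> Q" for s
      using that vector_derivative_at by blast
    have "continuous_on Q D"
      by (rule continuous_on_subset[OF Dc]) (auto simp: Q_def)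
    then have "continuous_on Q (vel i \<gamma>)" using vel by (simp cong: continuous_on_cong)
    then show ?thesis using Q der[of t] vel[of t] continuous_on_eq_continuous_at[OF Q(1)] by auto
  qed
  then have "regular \<gamma> F" unfolding regular_def using path by (auto simp: F_def)
  with that show ?thesis .
qed

lemma chart_at: "x \<in> topspace T \<Longrightarrow> chart_at M x \<in> I \<and> x \<in> cdom (chart_at M x)"
proof -
  assume "x \<in> topspace T"
  then have "\<exists>i. i \<in> I \<and> x \<in> cdom i" using topspace_eq by auto
  then show ?thesis unfolding chart_at_def by (rule someI_ex)
qed

lemma path_in_topspace: "pathin T \<gamma> \<Longrightarrow> t \<in> {0..1} \<Longrightarrow> \<gamma> t \<in> topspace T"
  by (drule path_image_subset_topspace) (auto simp: Pi_iff)

text \<open>By the chain rule the velocities in two charts differ by the Jacobian of the transition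
  map, and the transformation law of the metric cancels it.\<close>

lemma speed_chart:
  assumes reg: "regular \<gamma> F" and i: "i \<in> I" and t: "t \<in> {0<..<1} - F" "\<gamma> t \<in> cdom i"
  shows "speed M \<gamma> t = sqrt (vel i \<gamma> t \<bullet> (metric M i (\<phi> i (\<gamma> t)) *v vel i \<gamma> t))"
proof -
  define j where "j = chart_at M (\<gamma> t)"
  have path: "pathin T \<gamma>" using reg by (simp add: regular_def)
  have j: "j \<in> I" "\<gamma> t \<in> cdom j"
    using chart_at[OF path_in_topspace[OF path, of t]] t by (auto simp: j_def)
  define u where "u = \<phi> i (\<gamma> t)"
  let ?J = "jac i j u" and ?v = "vel i \<gamma> t"
  have u: "u \<in> \<phi> i ` (cdom i \<inter> cdom j)" using t j by (auto simp: u_def)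
  note tr = transition_has_derivative[OF i j(1) u]
  have "((\<phi> i \<circ> \<gamma>) has_vector_derivative ?v) (at t)" using reg i t by (auto simp: regular_def)
  then have "((\<phi> i \<circ> \<gamma>) has_derivative (\<lambda>h. h *\<^sub>R ?v)) (at t)" by (simp add: has_vector_derivative_def)
  moreover have "(transition M i j has_derivative ?J) (at ((\<phi> i \<circ> \<gamma>) t))" using tr by (simp add: u_def)
  ultimately have "((transition M i j \<circ> (\<phi> i \<circ> \<gamma>)) has_derivative (?J \<circ> (\<lambda>h. h *\<^sub>R ?v))) (at t)"
    by (rule diff_chain_at)
  moreover have lin: "linear ?J" using tr has_derivative_linear by blast
  ultimately have "((transition M i j \<circ> (\<phi> i \<circ> \<gamma>)) has_vector_derivative ?J ?v) (at t)"
    by (simp add: has_vector_derivative_def o_def linear_scale)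
  then have "((\<phi> j \<circ> \<gamma>) has_vector_derivative ?J ?v) (at t)"
  proof (rule has_vector_derivative_transform_within_open)
    show "open {s\<in>{0<..<1}. \<gamma> s \<in> cdom i}" using open_path_preimage[OF path openin_dom[OF i]] .
  qed (use t i in \<open>auto simp: transition_coord\<close>)
  then have vj: "vel j \<gamma> t = matrix ?J *v ?v"
    using vector_derivative_at by (simp add: matrix_works linear_matrix_vector_mul_eq lin)
  have "transition M i j u = \<phi> j (\<gamma> t)" using i t by (simp add: u_def transition_coord)
  then have "metric M i u = transpose (matrix ?J) ** metric M j (\<phi> j (\<gamma> t)) ** matrix ?J"
    using metric_transition[OF i j(1) u] by simp
  then have "?v \<bullet> (metric M i u *v ?v) = vel j \<gamma> t \<bullet> (metric M j (\<phi> j (\<gamma> t)) *v vel j \<gamma> t)"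
    by (simp only: inner_congruent vj)
  then show ?thesis by (simp add: speed_def Let_def j_def u_def)
qed

text \<open>\<open>speed\<close> may use another chart at every time, so continuity becomes visible
  only after \<open>speed_chart\<close> has rewritten it in one fixed chart near
  \<open>t\<close>.\<close>

lemma speed_continuous:
  assumes reg: "regular \<gamma> F"
  shows "continuous_on ({0<..<1} - F) (speed M \<gamma>)"
proof (rule continuous_at_imp_continuous_on, rule ballI)
  fix t assume t: "t \<in> {0<..<1} - F"
  have path: "pathin T \<gamma>" and F: "finite F" using reg by (auto simp: regular_def)
  obtain i where i: "i \<in> I" "\<gamma> t \<in> cdom i"
    using chart_at[OF path_in_topspace[OF path, of t]] t by auto
  define Q where "Q = {s\<in>{0<..<1}-F. \<gamma> s \<in> cdom i}"
  have Q: "open Q" "t \<in> Q"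
    using open_regular_preimage[OF path openin_dom[OF i(1)] F] i t by (auto simp: Q_def)
  have "continuous_on Q (vel i \<gamma>)"
    using reg i(1) by (intro continuous_at_imp_continuous_on) (auto simp: regular_def Q_def)
  moreover have "continuous_on Q (\<lambda>s. metric M i ((\<phi> i \<circ> \<gamma>) s))"
  proof (rule continuous_on_compose2[OF metric_continuous[OF i(1)]])
    show "continuous_on Q (\<phi> i \<circ> \<gamma>)"
      using reg i(1) has_vector_derivative_continuous
      by (intro continuous_at_imp_continuous_on) (fastforce simp: regular_def Q_def)
  qed (auto simp: Q_def)
  ultimately have "continuous_on Q (\<lambda>s. sqrt (vel i \<gamma> s \<bullet> (metric M i (\<phi> i (\<gamma> s)) *v vel i \<gamma> s)))"
    unfolding inner_mat_mult o_def by (intro continuous_intros continuous_on_component)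
  then have "continuous_on Q (speed M \<gamma>)"
    by (rule continuous_on_eq) (use speed_chart[OF reg i(1)] in \<open>auto simp: Q_def\<close>)
  then show "isCont (speed M \<gamma>) t" using Q continuous_on_eq_continuous_at by blast
qed

text \<open>The speed has no meaning at the break points, which lie in \<open>F\<close>.\<close>

definition "rspeed \<gamma> F t = ennreal (indicator ({0<..<1} - F) t *\<^sub>R speed M \<gamma> t)"

lemma rspeed_measurable: "regular \<gamma> F \<Longrightarrow> rspeed \<gamma> F \<in> borel_measurable borel"
proof -
  assume reg: "regular \<gamma> F"
  then have "{0<..<1} - F \<in> sets borel" by (auto simp: regular_def finite_imp_closed)
  then have "(\<lambda>t. indicator ({0<..<1} - F) t *\<^sub>R speed M \<gamma> t) \<in> borel_measurable borel"
    using speed_continuous[OF reg] by (rule borel_measurable_continuous_on_indicator)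
  then show ?thesis unfolding rspeed_def by simp
qed

lemma AE_not_finite: "finite F \<Longrightarrow> AE t in lborel. (t::real) \<notin> F"
  by (intro AE_not_in) (auto simp: null_sets_def finite_imp_closed emeasure_lborel_countable countable_finite)

lemma curve_length_regular: "regular \<gamma> F \<Longrightarrow> curve_length M \<gamma> = (\<integral>\<^sup>+t. rspeed \<gamma> F t \<partial>lborel)"
proof -
  assume "regular \<gamma> F"
  then have "AE t in lborel. t \<notin> F \<union> {0, 1}" by (intro AE_not_finite) (simp add: regular_def)
  then show ?thesis unfolding curve_length_def
    by (intro nn_integral_cong_AE, eventually_elim) (auto simp: rspeed_def indicator_def)
qed

text \<open>The chain rule multiplies the velocity by \<open>a\<close>. Agreement of the curves is
  demanded only near \<open>t\<close>, so that each half of a concatenation is covered.\<close>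

lemma speed_affine:
  assumes reg: "regular \<gamma> F" and J: "open J" "t \<in> J" "\<And>s. s \<in> J \<Longrightarrow> \<sigma> s = \<gamma> (a * s + b)"
    and t: "a * t + b \<in> {0<..<1} - F"
  shows "speed M \<sigma> t = \<bar>a\<bar> * speed M \<gamma> (a * t + b)"
proof -
  define i where "i = chart_at M (\<gamma> (a * t + b))"
  let ?s = "a * t + b"
  have path: "pathin T \<gamma>" using reg by (simp add: regular_def)
  have i: "i \<in> I" "\<gamma> ?s \<in> cdom i"
    using chart_at[OF path_in_topspace[OF path, of ?s]] t by (auto simp: i_def)
  have "((\<phi> i \<circ> \<gamma>) has_vector_derivative vel i \<gamma> ?s) (at ?s)" using reg i t by (auto simp: regular_def)
  moreover have "((\<lambda>s. a * s + b) has_vector_derivative a) (at t)"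
    by (auto intro!: derivative_eq_intros)
  ultimately have "((\<phi> i \<circ> \<gamma> \<circ> (\<lambda>s. a * s + b)) has_vector_derivative a *\<^sub>R vel i \<gamma> ?s) (at t)"
    by (intro vector_diff_chain_at) auto
  then have "((\<phi> i \<circ> \<sigma>) has_vector_derivative a *\<^sub>R vel i \<gamma> ?s) (at t)"
    by (rule has_vector_derivative_transform_within_open[OF _ J(1,2)]) (simp add: J(3))
  then have v: "vel i \<sigma> t = a *\<^sub>R vel i \<gamma> ?s" by (rule vector_derivative_at)
  have "chart_at M (\<sigma> t) = i" "\<sigma> t = \<gamma> ?s" using J by (auto simp: i_def)
  moreover have "sqrt (a *\<^sub>R w \<bullet> (G *v (a *\<^sub>R w))) = \<bar>a\<bar> * sqrt (w \<bullet> (G *v w))" for w :: "real^'k" and G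
  proof -
    have "a *\<^sub>R w \<bullet> (G *v (a *\<^sub>R w)) = a\<^sup>2 * (w \<bullet> (G *v w))"
      by (simp add: matrix_vector_mult_scaleR power2_eq_square)
    then show ?thesis by (simp add: real_sqrt_mult)
  qed
  ultimately show ?thesis
    unfolding speed_def Let_def i_def[symmetric] by (simp only: v)
qed

section \<open>Reversal and concatenation of curves\<close>

lemma C1_arc_affine:
  assumes arc: "C1_arc M \<gamma> c d"
    and eq: "\<And>s. s \<in> {c'..d'} \<Longrightarrow> \<sigma> s = \<gamma> (a * s + b) \<and> a * s + b \<in> {c..d}"
  shows "C1_arc M \<sigma> c' d'"
  unfolding C1_arc_def
proof
  fix i assume i: "i \<in> I"
  obtain D where D: "\<And>s. s \<in> {c..d} \<Longrightarrow> \<gamma> s \<in> cdom i \<Longrightarrow> ((\<phi> i \<circ> \<gamma>) has_vector_derivative D s) (at s within {c..d})"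
      and Dc: "continuous_on {s\<in>{c..d}. \<gamma> s \<in> cdom i} D"
    using arc i unfolding C1_arc_def by blast
  show "\<exists>D. (\<forall>t\<in>{c'..d'}. \<sigma> t \<in> cdom i \<longrightarrow>
           ((\<phi> i \<circ> \<sigma>) has_vector_derivative D t) (at t within {c'..d'})) \<and>
        continuous_on {t\<in>{c'..d'}. \<sigma> t \<in> cdom i} D"
  proof (intro exI conjI ballI impI)
    fix t assume t: "t \<in> {c'..d'}" "\<sigma> t \<in> cdom i"
    have "((\<lambda>s. a * s + b) has_vector_derivative a) (at t within {c'..d'})"
      by (auto intro!: derivative_eq_intros)
    moreover have "((\<phi> i \<circ> \<gamma>) has_vector_derivative D (a * t + b)) (at (a * t + b) within (\<lambda>s. a * s + b) ` {c'..d'})"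
    proof (rule has_vector_derivative_within_subset[OF D])
      show "(\<lambda>s. a * s + b) ` {c'..d'} \<subseteq> {c..d}" using eq by blast
      show "a * t + b \<in> {c..d}" "\<gamma> (a * t + b) \<in> cdom i" using eq[OF t(1)] t(2) by auto
    qed
    ultimately have "((\<phi> i \<circ> \<gamma> \<circ> (\<lambda>s. a * s + b)) has_vector_derivative a *\<^sub>R D (a * t + b)) (at t within {c'..d'})"
      by (rule vector_diff_chain_within)
    then show "((\<phi> i \<circ> \<sigma>) has_vector_derivative a *\<^sub>R D (a * t + b)) (at t within {c'..d'})"
      by (rule has_vector_derivative_transform[OF t(1), rotated]) (use eq in auto)
  next
    show "continuous_on {t\<in>{c'..d'}. \<sigma> t \<in> cdom i} (\<lambda>t. a *\<^sub>R D (a * t + b))"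
      using eq by (intro continuous_intros continuous_on_compose2[OF Dc]) auto
  qed
qed

lemma piecewise_C1_curve_reverse:
  assumes C: "piecewise_C1_curve M \<gamma>"
  shows "piecewise_C1_curve M (\<lambda>t. \<gamma> (1 - t))" "curve_length M (\<lambda>t. \<gamma> (1 - t)) = curve_length M \<gamma>"
proof -
  let ?\<sigma> = "\<lambda>t. \<gamma> (1 - t)"
  obtain p n where p: "p 0 = 0" "p n = 1" "\<And>k. k < n \<Longrightarrow> p k < p (Suc k)"
    "\<And>k. k < n \<Longrightarrow> C1_arc M \<gamma> (p k) (p (Suc k))" and path: "pathin T \<gamma>"
    using C unfolding piecewise_C1_curve_def by blast
  have "continuous_map (top_of_set {0..1}) (top_of_set {0..1}) (\<lambda>t::real. 1 - t)"
    by (auto simp: continuous_map_in_subtopology intro!: continuous_intros)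
  then have path': "pathin T ?\<sigma>"
    using continuous_map_compose[OF _ path[unfolded pathin_def]] unfolding pathin_def o_def by blast
  show "piecewise_C1_curve M ?\<sigma>"
    unfolding piecewise_C1_curve_def
  proof (intro conjI path' exI[of _ n] exI[of _ "\<lambda>k. 1 - p (n - k)"] allI impI)
    fix k assume k: "k < n"
    \<comment> \<open>Arc \<open>k\<close> of the reversed curve runs backwards through arc
      \<open>n - Suc k\<close> of the original.\<close>
    then have S: "n - k = Suc (n - Suc k)" by simp
    then show "1 - p (n - k) < 1 - p (n - Suc k)" using p(3)[of "n - Suc k"] k by simp
    show "C1_arc M ?\<sigma> (1 - p (n - k)) (1 - p (n - Suc k))"
      by (rule C1_arc_affine[where a = "-1" and b = 1, OF p(4)[of "n - Suc k"]]) (use k S in auto)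
  qed (use p in auto)
  then obtain F' where F': "regular ?\<sigma> F'" by (rule piecewise_C1_curve_regular)
  obtain F where F: "regular \<gamma> F" using C by (rule piecewise_C1_curve_regular)
  have "AE t in lborel. t \<notin> F' \<union> (\<lambda>s. 1 - s) ` F"
    using F F' by (intro AE_not_finite) (simp add: regular_def)
  then have "AE t in lborel. rspeed ?\<sigma> F' t = rspeed \<gamma> F (1 + (-1) * t)"
  proof eventually_elim
    case (elim t)
    have F1: "1 - t \<notin> F" using elim by (force simp: image_iff)
    have "speed M ?\<sigma> t = speed M \<gamma> (1 - t)" if "t \<in> {0<..<1}"
      using speed_affine[OF F, of UNIV t ?\<sigma> "-1" 1] F1 that by simp
    then show ?case using elim F1 by (auto simp: rspeed_def indicator_def)
  qed
  then have "curve_length M ?\<sigma> = (\<integral>\<^sup>+t. rspeed \<gamma> F (1 + (-1) * t) \<partial>lborel)"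
    unfolding curve_length_regular[OF F'] by (rule nn_integral_cong_AE)
  also have "\<dots> = curve_length M \<gamma>"
    using nn_integral_real_affine[OF rspeed_measurable[OF F], of "-1" 1] curve_length_regular[OF F] by simp
  finally show "curve_length M ?\<sigma> = curve_length M \<gamma>" .
qed

text \<open>Each half runs at twice the speed, and the substitution on its half interval compensates
  this, so the lengths add up.\<close>

lemma piecewise_C1_curve_join:
  assumes C1: "piecewise_C1_curve M \<gamma>1" and C2: "piecewise_C1_curve M \<gamma>2" and meet: "\<gamma>1 1 = \<gamma>2 0"
  defines "\<sigma> \<equiv> \<lambda>t. if t \<le> 1/2 then \<gamma>1 (2 * t) else \<gamma>2 (2 * t - 1)"
  shows "piecewise_C1_curve M \<sigma>" "curve_length M \<sigma> = curve_length M \<gamma>1 + curve_length M \<gamma>2"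
proof -
  obtain p1 n1 where p1: "p1 0 = 0" "p1 n1 = 1" "\<And>k. k < n1 \<Longrightarrow> p1 k < p1 (Suc k)"
    "\<And>k. k < n1 \<Longrightarrow> C1_arc M \<gamma>1 (p1 k) (p1 (Suc k))" and path1: "pathin T \<gamma>1"
    using C1 unfolding piecewise_C1_curve_def by blast
  obtain p2 n2 where p2: "p2 0 = 0" "p2 n2 = 1" "\<And>k. k < n2 \<Longrightarrow> p2 k < p2 (Suc k)"
    "\<And>k. k < n2 \<Longrightarrow> C1_arc M \<gamma>2 (p2 k) (p2 (Suc k))" and path2: "pathin T \<gamma>2"
    using C2 unfolding piecewise_C1_curve_def by blast
  have \<sigma>1: "\<sigma> t = \<gamma>1 (2 * t)" if "t \<le> 1/2" for t using that by (simp add: \<sigma>_def)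
  have \<sigma>2: "\<sigma> t = \<gamma>2 (2 * t - 1)" if "1/2 \<le> t" for t
  proof (cases "t = 1/2")
    case True
    show ?thesis unfolding True \<sigma>_def using meet by simp
  qed (use that in \<open>simp add: \<sigma>_def\<close>)
  let ?T01 = "top_of_set {0..1::real}"
  have path: "pathin T \<sigma>"
  proof -
    have "continuous_map ?T01 T (\<lambda>t. if t \<le> 1/2 then (\<gamma>1 \<circ> (\<lambda>t. 2 * t)) t else (\<gamma>2 \<circ> (\<lambda>t. 2 * t - 1)) t)"
    proof (intro continuous_map_cases_le continuous_map_compose[where X' = ?T01])
      show "continuous_map (subtopology ?T01 {x \<in> topspace ?T01. x \<le> 1/2}) ?T01 (\<lambda>t. 2 * t)"
        by (auto simp: continuous_map_in_subtopology subtopology_subtopology intro!: continuous_intros)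
      show "continuous_map (subtopology ?T01 {x \<in> topspace ?T01. 1/2 \<le> x}) ?T01 (\<lambda>t. 2 * t - 1)"
        by (auto simp: continuous_map_in_subtopology subtopology_subtopology intro!: continuous_intros)
      show "(\<gamma>1 \<circ> (\<lambda>t. 2 * t)) x = (\<gamma>2 \<circ> (\<lambda>t. 2 * t - 1)) x" if "x = 1/2" for x
        using \<sigma>1[of x] \<sigma>2[of x] that by (simp only: o_def order_refl)
    qed (use path1 path2 in \<open>auto simp: pathin_def\<close>)
    then show ?thesis unfolding pathin_def \<sigma>_def o_def .
  qed
  \<comment> \<open>The two partitions, scaled to half length and put end to end; at
    \<open>k = n1\<close> both formulas give \<open>1/2\<close>.\<close>
  define p where "p k = (if k \<le> n1 then p1 k / 2 else 1/2 + p2 (k - n1) / 2)" for k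
  have pA: "p k = p1 k / 2" if "k \<le> n1" for k using that by (simp add: p_def)
  have pB: "p k = 1/2 + p2 (k - n1) / 2" if "k \<ge> n1" for k
    using that p1 p2 by (cases "k = n1") (auto simp: p_def)
  have le1: "0 \<le> p1 k" "p1 k \<le> 1" if "k \<le> n1" for k
    using partition_mono[of n1 p1 0 k, OF p1(3)] partition_mono[of n1 p1 k n1, OF p1(3)] that p1(1,2) by auto
  have le2: "0 \<le> p2 k" "p2 k \<le> 1" if "k \<le> n2" for k
    using partition_mono[of n2 p2 0 k, OF p2(3)] partition_mono[of n2 p2 k n2, OF p2(3)] that p2(1,2) by auto
  show C: "piecewise_C1_curve M \<sigma>"
    unfolding piecewise_C1_curve_def
  proof (intro conjI path exI[of _ "n1 + n2"] exI[of _ p] allI impI)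
    show "p 0 = 0" "p (n1 + n2) = 1" using pA[of 0] pB[of "n1 + n2"] p1 p2 by auto
    fix k assume k: "k < n1 + n2"
    show "p k < p (Suc k)" "C1_arc M \<sigma> (p k) (p (Suc k))"
    proof (atomize (full), cases "k < n1")
      case True
      have "C1_arc M \<sigma> (p1 k / 2) (p1 (Suc k) / 2)"
      proof (rule C1_arc_affine[where a = 2 and b = 0, OF p1(4)[OF True]])
        fix s assume "s \<in> {p1 k / 2..p1 (Suc k) / 2}"
        then show "\<sigma> s = \<gamma>1 (2 * s + 0) \<and> 2 * s + 0 \<in> {p1 k..p1 (Suc k)}"
          using \<sigma>1[of s] le1[of "Suc k"] True by auto
      qed
      then show "p k < p (Suc k) \<and> C1_arc M \<sigma> (p k) (p (Suc k))"
        using True p1(3)[OF True] by (simp add: pA)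
    next
      case False
      define l where "l = k - n1"
      have l: "l < n2" "k - n1 = l" "Suc k - n1 = Suc l" using False k by (auto simp: l_def)
      have "C1_arc M \<sigma> (1/2 + p2 l / 2) (1/2 + p2 (Suc l) / 2)"
      proof (rule C1_arc_affine[where a = 2 and b = "-1", OF p2(4)[OF l(1)]])
        fix s assume "s \<in> {1/2 + p2 l / 2..1/2 + p2 (Suc l) / 2}"
        then show "\<sigma> s = \<gamma>2 (2 * s + -1) \<and> 2 * s + -1 \<in> {p2 l..p2 (Suc l)}"
          using \<sigma>2[of s] le2[of l] l(1) by auto
      qed
      then show "p k < p (Suc k) \<and> C1_arc M \<sigma> (p k) (p (Suc k))"
        using False p2(3)[OF l(1)] by (simp add: pB l)
    qed
  qed
  obtain F where F: "regular \<sigma> F" using C by (rule piecewise_C1_curve_regular)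
  obtain F1 where F1: "regular \<gamma>1 F1" using C1 by (rule piecewise_C1_curve_regular)
  obtain F2 where F2: "regular \<gamma>2 F2" using C2 by (rule piecewise_C1_curve_regular)
  let ?s1 = "\<lambda>t. rspeed \<gamma>1 F1 (0 + 2 * t)" and ?s2 = "\<lambda>t. rspeed \<gamma>2 F2 (-1 + 2 * t)"
  have m: "?s1 \<in> borel_measurable lborel" "?s2 \<in> borel_measurable lborel"
    using measurable_compose[OF _ rspeed_measurable[OF F1], of "\<lambda>t. 0 + 2 * t" borel]
      measurable_compose[OF _ rspeed_measurable[OF F2], of "\<lambda>t. -1 + 2 * t" borel] by auto
  \<comment> \<open>The null set consists of the end points, the joining time, the break points of
    the concatenation, and those of the two curves transported to its time scale.\<close>
  have "AE t in lborel. t \<notin> F \<union> {0, 1/2, 1} \<union> (\<lambda>s. s / 2) ` F1 \<union> (\<lambda>s. (s + 1) / 2) ` F2"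
    using F F1 F2 by (intro AE_not_finite) (simp add: regular_def)
  then have "AE t in lborel. rspeed \<sigma> F t = 2 * ?s1 t + 2 * ?s2 t"
  proof eventually_elim
    case (elim t)
    have ne: "2 * t \<notin> F1" "2 * t - 1 \<notin> F2"
      using elim imageI[of "2 * t" F1 "\<lambda>s. s / 2"] imageI[of "2 * t - 1" F2 "\<lambda>s. (s + 1) / 2"] by auto
    have e1: "speed M \<sigma> t = 2 * speed M \<gamma>1 (2 * t)" if "0 < t" "t < 1/2"
      using speed_affine[OF F1, of "{..<1/2}" t \<sigma> 2 0] ne that \<sigma>1 by simp
    have e2: "speed M \<sigma> t = 2 * speed M \<gamma>2 (2 * t - 1)" if "1/2 < t" "t < 1"
      using speed_affine[OF F2, of "{1/2<..}" t \<sigma> 2 "-1"] ne that \<sigma>2 by simp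
    consider "t < 0" | "0 < t" "t < 1/2" | "1/2 < t" "t < 1" | "1 < t" using elim by fastforce
    then show ?case
      using elim ne e1 e2 by cases (auto simp: rspeed_def ennreal_mult')
  qed
  then have "curve_length M \<sigma> = (\<integral>\<^sup>+t. 2 * ?s1 t + 2 * ?s2 t \<partial>lborel)"
    unfolding curve_length_regular[OF F] by (rule nn_integral_cong_AE)
  also have "\<dots> = (\<integral>\<^sup>+t. 2 * ?s1 t \<partial>lborel) + (\<integral>\<^sup>+t. 2 * ?s2 t \<partial>lborel)"
    using m by (intro nn_integral_add) auto
  also have "(\<integral>\<^sup>+t. 2 * ?s1 t \<partial>lborel) = curve_length M \<gamma>1"
    using nn_integral_real_affine[OF rspeed_measurable[OF F1], of 2 0] curve_length_regular[OF F1] m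
    by (simp add: nn_integral_cmult)
  also have "(\<integral>\<^sup>+t. 2 * ?s2 t \<partial>lborel) = curve_length M \<gamma>2"
    using nn_integral_real_affine[OF rspeed_measurable[OF F2], of 2 "-1"] curve_length_regular[OF F2] m
    by (simp add: nn_integral_cmult)
  finally show "curve_length M \<sigma> = curve_length M \<gamma>1 + curve_length M \<gamma>2" .
qed

section \<open>The distance as an infimum of lengths\<close>

abbreviation "d \<equiv> geodesic_dist M"

lemma dist_le_length: "piecewise_C1_curve M \<gamma> \<Longrightarrow> d (\<gamma> 0) (\<gamma> 1) \<le> curve_length M \<gamma>"
  unfolding geodesic_dist_def by (intro INF_lower) auto

lemma le_dist:
  assumes "\<And>\<gamma>. piecewise_C1_curve M \<gamma> \<Longrightarrow> \<gamma> 0 = x \<Longrightarrow> \<gamma> 1 = y \<Longrightarrow> c \<le> curve_length M \<gamma>"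
  shows "c \<le> d x y"
  unfolding geodesic_dist_def using assms by (intro INF_greatest) auto

lemma dist_sym_le: "d x y \<le> d y x"
proof (rule le_dist)
  fix \<gamma> assume "piecewise_C1_curve M \<gamma>" "\<gamma> 0 = y" "\<gamma> 1 = x"
  then show "d x y \<le> curve_length M \<gamma>"
    using dist_le_length[OF piecewise_C1_curve_reverse(1)] piecewise_C1_curve_reverse(2) by fastforce
qed

lemma dist_sym: "d x y = d y x"
  by (intro antisym dist_sym_le)

lemma dist_lessE:
  assumes "d x y < c"
  obtains \<gamma> where "piecewise_C1_curve M \<gamma>" "\<gamma> 0 = x" "\<gamma> 1 = y" "curve_length M \<gamma> < c"
  using assms unfolding geodesic_dist_def INF_less_iff by blast

text \<open>Concatenates two curves that are within \<open>e / 2\<close> of the infimum.\<close>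

lemma dist_triangle: "d x z \<le> d x y + d y z"
proof (rule ennreal_le_epsilon)
  fix e :: real assume fin: "d x y + d y z < top" and e: "e > 0"
  have "d x y < d x y + ennreal (e / 2)" "d y z < d y z + ennreal (e / 2)"
    using fin e by (auto simp: ennreal_add_left_cancel_less[of _ 0, simplified])
  obtain \<gamma>1 where 1: "piecewise_C1_curve M \<gamma>1" "\<gamma>1 0 = x" "\<gamma>1 1 = y" "curve_length M \<gamma>1 < d x y + ennreal (e / 2)"
    using \<open>d x y < _\<close> by (rule dist_lessE)
  obtain \<gamma>2 where 2: "piecewise_C1_curve M \<gamma>2" "\<gamma>2 0 = y" "\<gamma>2 1 = z" "curve_length M \<gamma>2 < d y z + ennreal (e / 2)"
    using \<open>d y z < _\<close> by (rule dist_lessE)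
  have "d x z \<le> curve_length M \<gamma>1 + curve_length M \<gamma>2"
    using dist_le_length[OF piecewise_C1_curve_join(1)[OF 1(1) 2(1)]] piecewise_C1_curve_join(2)[OF 1(1) 2(1)] 1 2
    by simp
  also have "\<dots> \<le> (d x y + ennreal (e / 2)) + (d y z + ennreal (e / 2))"
    using 1 2 by (intro add_mono) auto
  also have "\<dots> = d x y + d y z + (ennreal (e / 2) + ennreal (e / 2))" by (simp add: ac_simps)
  also have "ennreal (e / 2) + ennreal (e / 2) = ennreal e"
    using e by (simp flip: ennreal_plus)
  finally show "d x z \<le> d x y + d y z + ennreal e" .
qed

text \<open>Straight segments in coordinates are the test curves for the upper bound on the
  distance.\<close>

lemma segment_curve:
  assumes i: "i \<in> I" and seg: "\<And>t. t \<in> {0..1} \<Longrightarrow> u + t *\<^sub>R w \<in> cod i"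
  defines "\<gamma> \<equiv> \<lambda>t. \<psi> i (u + t *\<^sub>R w)"
  shows "piecewise_C1_curve M \<gamma>"
    "\<And>F t. regular \<gamma> F \<Longrightarrow> t \<in> {0<..<1} - F \<Longrightarrow> speed M \<gamma> t = sqrt (w \<bullet> (metric M i (u + t *\<^sub>R w) *v w))"
proof -
  have in_dom: "\<gamma> t \<in> cdom i" "\<phi> i (\<gamma> t) = u + t *\<^sub>R w" if "t \<in> {0..1}" for t
    using seg[OF that] by (auto simp: \<gamma>_def \<phi>_\<psi> \<psi>_in)
  have path: "pathin T \<gamma>"
  proof -
    have "continuous_map (top_of_set {0..1}) (top_of_set (cod i)) (\<lambda>t. u + t *\<^sub>R w)"
      using seg by (auto simp: continuous_map_in_subtopology intro!: continuous_intros)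
    from continuous_map_compose[OF this continuous_inverse[OF i]]
    show ?thesis by (simp add: pathin_def \<gamma>_def o_def continuous_map_in_subtopology)
  qed
  show "piecewise_C1_curve M \<gamma>"
    unfolding piecewise_C1_curve_def
  proof (intro conjI path exI[of _ 1] exI[of _ real] allI impI)
    fix k :: nat assume "k < 1"
    then have k: "k = 0" by simp
    have "C1_arc M \<gamma> 0 1"
      unfolding C1_arc_def
    proof
      \<comment> \<open>The arc condition quantifies over all charts. In chart \<open>j\<close> the
        segment has as velocity the Jacobian of the transition map applied to
        \<open>w\<close>.\<close>
      fix j assume j: "j \<in> I"
      have overlap: "u + t *\<^sub>R w \<in> \<phi> i ` (cdom i \<inter> cdom j)" if "t \<in> {0..1}" "\<gamma> t \<in> cdom j" for t
        using in_dom[OF that(1)] that(2) by (metis IntI imageI)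
      show "\<exists>D. (\<forall>t\<in>{0..1}. \<gamma> t \<in> cdom j \<longrightarrow> ((\<phi> j \<circ> \<gamma>) has_vector_derivative D t) (at t within {0..1})) \<and>
        continuous_on {t\<in>{0..1}. \<gamma> t \<in> cdom j} D"
      proof (intro exI conjI ballI impI)
        fix t :: real assume t: "t \<in> {0..1}" "\<gamma> t \<in> cdom j"
        have tr: "(transition M i j has_derivative jac i j (u + t *\<^sub>R w)) (at (u + t *\<^sub>R w))"
          by (intro transition_has_derivative[OF i j] overlap t)
        have "((\<lambda>t. u + t *\<^sub>R w) has_derivative (\<lambda>h. h *\<^sub>R w)) (at t within {0..1})"
          by (auto intro!: derivative_eq_intros)
        from diff_chain_within[OF this has_derivative_at_withinI[OF tr]]
        have "((transition M i j \<circ> (\<lambda>t. u + t *\<^sub>R w)) has_vector_derivative jac i j (u + t *\<^sub>R w) w) (at t within {0..1})"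
          using has_derivative_linear[OF tr] by (simp add: has_vector_derivative_def o_def linear_scale)
        then show "((\<phi> j \<circ> \<gamma>) has_vector_derivative jac i j (u + t *\<^sub>R w) w) (at t within {0..1})"
          by (rule has_vector_derivative_transform[OF t(1), rotated]) (simp add: \<gamma>_def transition_eq)
      next
        show "continuous_on {t\<in>{0..1}. \<gamma> t \<in> cdom j} (\<lambda>t. jac i j (u + t *\<^sub>R w) w)"
        proof (rule continuous_on_compose2[OF continuous_on_jac[OF i j]])
          show "(\<lambda>t. u + t *\<^sub>R w) ` {t\<in>{0..1}. \<gamma> t \<in> cdom j} \<subseteq> \<phi> i ` (cdom i \<inter> cdom j)"
            using overlap by blast
        qed (auto intro!: continuous_intros)
      qed
    qed
    then show "C1_arc M \<gamma> (real k) (real (Suc k))" "real k < real (Suc k)" using k by auto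
  qed auto
  fix F t assume F: "regular \<gamma> F" and t: "t \<in> {0<..<1} - F"
  have "((\<lambda>t. u + t *\<^sub>R w) has_vector_derivative w) (at t)"
    by (auto intro!: derivative_eq_intros)
  then have "((\<phi> i \<circ> \<gamma>) has_vector_derivative w) (at t)"
    by (rule has_vector_derivative_transform_within_open[of _ _ _ "{0<..<1}"]) (use t in_dom in auto)
  then have "vel i \<gamma> t = w" by (rule vector_derivative_at)
  then show "speed M \<gamma> t = sqrt (w \<bullet> (metric M i (u + t *\<^sub>R w) *v w))"
    using speed_chart[OF F i t] in_dom[of t] t by simp
qed

end

section \<open>Almost isometric charts\<close>

context closed_riemannian
begin

text \<open>The curve in the linear coordinates \<open>Q\<close> is displaced by the integral of its
  velocity, hence by at most the integral of the norm, and \<kappa> times this norm is at most the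
  speed.\<close>

lemma length_lower_bound:
  fixes Q :: "real^'k^'k"
  assumes reg: "regular \<gamma> F" and b: "0 < b" "b \<le> 1" and i: "i \<in> I"
    and dom: "\<And>t. t \<in> {0..b} \<Longrightarrow> \<gamma> t \<in> cdom i" and \<kappa>: "\<kappa> > 0"
    and speed: "\<And>t. t \<in> {0<..<b} - F \<Longrightarrow> \<kappa> * norm (Q *v vel i \<gamma> t) \<le> speed M \<gamma> t"
  shows "ennreal (\<kappa> * norm (Q *v (\<phi> i (\<gamma> b) - \<phi> i (\<gamma> 0)))) \<le> curve_length M \<gamma>"
proof (cases "curve_length M \<gamma> = \<infinity>")
  case False
  define c where "c t = Q *v \<phi> i (\<gamma> t)" for t
  define S where "S = {0<..<b} - F"
  define g where "g t = indicator S t *\<^sub>R (Q *v vel i \<gamma> t)" for t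
  have F: "finite F" and path: "pathin T \<gamma>" using reg by (auto simp: regular_def)
  have S: "open S" unfolding S_def using F by (intro open_Diff finite_imp_closed) auto
  have isC: "isCont (vel i \<gamma>) t" and der: "((\<phi> i \<circ> \<gamma>) has_vector_derivative vel i \<gamma> t) (at t)" if "t \<in> S" for t
    using reg i dom[of t] that b unfolding regular_def S_def by auto
  have "continuous_on S (vel i \<gamma>)"
    using isC by (intro continuous_at_imp_continuous_on) blast
  then have "continuous_on S (\<lambda>t. Q *v vel i \<gamma> t)"
    by (rule bounded_linear.continuous_on[OF matrix_vector_mul_bounded_linear])
  then have gm: "g \<in> borel_measurable borel"
    unfolding g_def using S by (intro borel_measurable_continuous_on_indicator) auto
  have "ennreal (\<kappa> * norm (g t)) \<le> rspeed \<gamma> F t" for t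
    using speed[of t] b by (auto simp: g_def S_def rspeed_def indicator_def intro!: ennreal_leI)
  then have le: "(\<integral>\<^sup>+t. ennreal (\<kappa> * norm (g t)) \<partial>lborel) \<le> curve_length M \<gamma>"
    unfolding curve_length_regular[OF reg] by (rule nn_integral_mono)
  have eq: "(\<integral>\<^sup>+t. ennreal (\<kappa> * norm (g t)) \<partial>lborel) = ennreal \<kappa> * (\<integral>\<^sup>+t. ennreal (norm (g t)) \<partial>lborel)"
    using gm \<kappa> by (subst nn_integral_cmult[symmetric]) (auto simp: ennreal_mult' intro!: nn_integral_cong)
  \<comment> \<open>Finite length makes the velocity integrable, which the comparison with the
    fundamental theorem requires.\<close>
  have "ennreal \<kappa> * (\<integral>\<^sup>+t. ennreal (norm (g t)) \<partial>lborel) < \<infinity>"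
    using le False unfolding eq by (simp add: less_top[symmetric] top_unique neq_top_trans)
  then have "(\<integral>\<^sup>+t. ennreal (norm (g t)) \<partial>lborel) < \<infinity>"
    using \<kappa> by (auto simp: ennreal_mult_less_top ennreal_eq_0_iff)
  then have int: "integrable lborel g" using gm by (simp add: integrable_iff_bounded)
  have "((\<lambda>t. Q *v vel i \<gamma> t) has_integral (c b - c 0)) {0..b}"
  proof (rule fundamental_theorem_of_calculus_interior_strong[OF F])
    show "(c has_vector_derivative Q *v vel i \<gamma> t) (at t)" if "t \<in> {0<..<b} - F" for t
      using bounded_linear.has_vector_derivative[OF matrix_vector_mul_bounded_linear der[of t], of Q] that
      by (simp add: c_def[abs_def] S_def o_def)
    have "continuous_map (top_of_set {0..b}) (subtopology T (cdom i)) \<gamma>"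
      using continuous_map_from_subtopology_mono[OF path[unfolded pathin_def], of "{0..b}"] b dom
      by (simp add: continuous_map_in_subtopology image_subset_iff Pi_iff)
    from continuous_map_compose[OF this continuous_coord[OF i]]
    have "continuous_on {0..b} (\<phi> i \<circ> \<gamma>)" by (simp add: continuous_map_in_subtopology)
    then show "continuous_on {0..b} c"
      unfolding c_def by (intro bounded_linear.continuous_on[OF matrix_vector_mul_bounded_linear]) (simp add: o_def)
  qed (use b in auto)
  moreover have "(g has_integral integral\<^sup>L lborel g) UNIV"
    using has_integral_integral_lborel[OF int] .
  then have "(g has_integral integral\<^sup>L lborel g) {0..b}"
  proof -
    have "g = (\<lambda>t. if t \<in> {0..b} then g t else 0)"
      by (auto simp: fun_eq_iff g_def S_def indicator_def)
    then show "(g has_integral integral\<^sup>L lborel g) UNIV \<Longrightarrow> ?thesis"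
      by (metis has_integral_restrict_UNIV)
  qed
  \<comment> \<open>\<open>g\<close> and the velocity differ on the interval only at finitely many
    points, so the Lebesgue integral of \<open>g\<close> is the integral in the fundamental
    theorem.\<close>
  then have "((\<lambda>t. Q *v vel i \<gamma> t) has_integral integral\<^sup>L lborel g) {0..b}"
    by (rule has_integral_spike_finite[rotated 2, of _ _ _ "F \<union> {0, b}"]) (use F in \<open>auto simp: g_def S_def\<close>)
  ultimately have "integral\<^sup>L lborel g = c b - c 0" using has_integral_unique by blast
  then have "ennreal (norm (c b - c 0)) \<le> (\<integral>\<^sup>+t. ennreal (norm (g t)) \<partial>lborel)"
    using integral_norm_bound_ennreal[OF int] by simp
  then have "ennreal \<kappa> * ennreal (norm (c b - c 0)) \<le> curve_length M \<gamma>"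
    using le unfolding eq by (meson mult_left_mono order_trans zero_le)
  moreover have "ennreal (\<kappa> * norm (Q *v (\<phi> i (\<gamma> b) - \<phi> i (\<gamma> 0)))) = ennreal \<kappa> * ennreal (norm (c b - c 0))"
    using \<kappa> by (simp add: c_def matrix_vector_mult_diff_distrib ennreal_mult')
  ultimately show ?thesis by simp
qed simp

text \<open>\<open>\<xi>\<close> parametrizes a neighbourhood of \<open>p\<close>. The minimum with \<open>R/2\<close> accounts for curves that leave
  the chart: starting in the half ball, they have to cross an annulus of width \<open>R/2\<close>.\<close>

definition "normal_chart p \<epsilon> R \<xi> \<longleftrightarrow> R > 0 \<and> \<xi> 0 = p \<and> continuous_map (top_of_set (ball 0 R)) T \<xi> \<and>
  (\<forall>s\<le>R. openin T (\<xi> ` ball (0::real^'k) s)) \<and>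
  (\<forall>f\<in>borel_measurable B.
     (\<integral>\<^sup>+x\<in>\<xi> ` ball 0 R. f x \<partial>vol) \<le> ennreal (1 + \<epsilon>) * (\<integral>\<^sup>+u\<in>ball 0 R. f (\<xi> u) \<partial>lborel) \<and>
     ennreal (1 - \<epsilon>) * (\<integral>\<^sup>+u\<in>ball 0 R. f (\<xi> u) \<partial>lborel) \<le> (\<integral>\<^sup>+x\<in>\<xi> ` ball 0 R. f x \<partial>vol)) \<and>
  (\<forall>u\<in>ball 0 R. \<forall>v\<in>ball 0 R. d (\<xi> u) (\<xi> v) \<le> ennreal ((1 + \<epsilon>) * norm (u - v))) \<and>
  (\<forall>u\<in>ball 0 (R/2). \<forall>v\<in>ball 0 R. ennreal ((1 - \<epsilon>) * min (norm (u - v)) (R/2)) \<le> d (\<xi> u) (\<xi> v)) \<and>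
  (\<forall>u\<in>ball 0 (R/2). \<forall>y. y \<notin> \<xi> ` ball 0 R \<longrightarrow> ennreal ((1 - \<epsilon>) * (R/2)) \<le> d (\<xi> u) y)"

text \<open>An affine change of coordinates makes the metric the identity at \<open>p\<close>. By
  continuity the quadratic form and the volume density stay within \<epsilon> of the Euclidean ones
  on a small ball, and comparing lengths of curves transfers this to distances.\<close>

lemma normal_chart_exists:
  assumes p: "p \<in> topspace T" and \<epsilon>: "0 < \<epsilon>" "\<epsilon> < 1"
  shows "\<exists>R \<xi>. normal_chart p \<epsilon> R \<xi>"
proof -
  define i where "i = chart_at M p"
  have i: "i \<in> I" "p \<in> cdom i" using chart_at[OF p] by (auto simp: i_def)
  define x0 where "x0 = \<phi> i p"
  have x0: "x0 \<in> cod i" using i by (simp add: x0_def)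
  obtain P :: "real^'k^'k" where P: "invertible P" "transpose P ** metric M i x0 ** P = mat 1"
    using posdef_orthonormal_columns[OF metric_sym[OF i(1) x0]] metric_pos[OF i(1) x0] by blast
  obtain Q :: "real^'k^'k" where Q: "P ** Q = mat 1" "Q ** P = mat 1" using P(1) by (auto simp: invertible_def)
  have PQ: "P *v (Q *v z) = z" "Q *v (P *v z) = z" for z
    by (simp_all only: matrix_vector_mul_assoc Q matrix_vector_mul_lid)
  define h where "h u = x0 + P *v u" for u
  define k where "k x = Q *v (x - x0)" for x
  have hk: "h (k x) = x" "k (h u) = u" for x u by (simp_all add: h_def k_def PQ)
  have hcont: "continuous_on A h" for A
    unfolding h_def by (intro continuous_intros bounded_linear.continuous_on[OF matrix_vector_mul_bounded_linear])
  have kcont: "continuous_on A k" for A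
    unfolding k_def by (intro continuous_intros bounded_linear.continuous_on[OF matrix_vector_mul_bounded_linear])
  have kdiff: "k x - k y = Q *v (x - y)" for x y
    by (simp add: k_def matrix_vector_mult_diff_distrib[symmetric])
  \<comment> \<open>The metric matrix in the coordinates \<open>u\<close>.\<close>
  define G where "G u = transpose P ** metric M i (h u) ** P" for u
  define V where "V = h -` cod i"
  have V: "open V" "0 \<in> V"
    using open_vimage[OF open_cod[OF i(1)] hcont[of UNIV]] x0 by (auto simp: V_def h_def)
  have metc: "continuous_on V (\<lambda>u. metric M i (h u))"
    by (rule continuous_on_compose2[OF metric_continuous[OF i(1)] hcont]) (auto simp: V_def)
  then have entry: "continuous_on V (\<lambda>u. metric M i (h u) $ a $ b)" for a b
    by (intro continuous_on_component)
  have Gc: "continuous_on V (\<lambda>u. G u $ a $ b)" for a b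
    unfolding G_def matrix_matrix_mult_def by (simp, intro continuous_intros entry)
  \<comment> \<open>\<open>e1\<close> bounds the deviation of the quadratic form of
    \<open>G u\<close> from the Euclidean one, and \<open>e2\<close> is the volume density in the
    coordinates \<open>u\<close>. At the centre they are 0 and 1.\<close>
  define e1 where "e1 u = (\<Sum>a\<in>UNIV. \<Sum>b\<in>UNIV. \<bar>(G u - mat 1) $ a $ b\<bar>)" for u
  define e2 where "e2 u = \<bar>det P\<bar> * sqrt (det (metric M i (h u)))" for u
  have G0: "G 0 = mat 1" using P(2) by (simp add: G_def h_def)
  have "e1 0 = 0" using G0 by (simp add: e1_def)
  have "e2 0 = 1" using det_orthonormal_columns(2)[OF P(2)] by (simp add: e2_def h_def)
  have "continuous_on V e1" unfolding e1_def by (simp, intro continuous_intros Gc)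
  then have "open (V \<inter> e1 -` {..<\<epsilon>})" by (intro continuous_open_preimage V) auto
  moreover have "continuous_on V e2" unfolding e2_def det_def by (intro continuous_intros entry)
  then have "open (V \<inter> e2 -` {1-\<epsilon><..<1+\<epsilon>})" by (intro continuous_open_preimage V) auto
  ultimately have "open ((V \<inter> e1 -` {..<\<epsilon>}) \<inter> (V \<inter> e2 -` {1-\<epsilon><..<1+\<epsilon>}))" by (rule open_Int)
  moreover have "0 \<in> (V \<inter> e1 -` {..<\<epsilon>}) \<inter> (V \<inter> e2 -` {1-\<epsilon><..<1+\<epsilon>})"
    using V \<open>e1 0 = 0\<close> \<open>e2 0 = 1\<close> \<epsilon> by auto
  ultimately obtain R where R: "R > 0" "ball 0 R \<subseteq> (V \<inter> e1 -` {..<\<epsilon>}) \<inter> (V \<inter> e2 -` {1-\<epsilon><..<1+\<epsilon>})"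
    by (meson openE)
  have cod: "h u \<in> cod i" if "u \<in> ball 0 R" for u using R(2) that by (auto simp: V_def)
  have e2: "1 - \<epsilon> \<le> e2 u" "e2 u \<le> 1 + \<epsilon>" if "u \<in> ball 0 R" for u using R(2) that by force+
  have form: "(P *v w) \<bullet> (metric M i (h u) *v (P *v w)) = w \<bullet> (G u *v w)" for u w
    unfolding G_def by (rule inner_congruent[symmetric])
  have quad: "\<bar>w \<bullet> (G u *v w) - (norm w)\<^sup>2\<bar> \<le> \<epsilon> * (norm w)\<^sup>2" if "u \<in> ball 0 R" for u w
  proof -
    have "w \<bullet> (G u *v w) - (norm w)\<^sup>2 = w \<bullet> ((G u - mat 1) *v w)"
      by (simp add: matrix_vector_mult_diff_rdistrib inner_diff_right power2_norm_eq_inner)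
    also have "\<bar>\<dots>\<bar> \<le> e1 u * (norm w)\<^sup>2" unfolding e1_def by (rule quadratic_form_bound)
    also have "\<dots> \<le> \<epsilon> * (norm w)\<^sup>2" using R(2) that by (intro mult_right_mono) force+
    finally show ?thesis .
  qed
  \<comment> \<open>The square root keeps the same \<epsilon>, because \<open>1 + \<epsilon>\<close>
    is at most its square and \<open>1 - \<epsilon>\<close> at least its square.\<close>
  have upper: "sqrt (w \<bullet> (G u *v w)) \<le> (1 + \<epsilon>) * norm w" if "u \<in> ball 0 R" for u w
  proof (rule real_le_lsqrt)
    have "w \<bullet> (G u *v w) \<le> (1 + \<epsilon>) * (norm w)\<^sup>2" using quad[OF that, of w] by (simp add: algebra_simps)
    also have "\<dots> \<le> (1 + \<epsilon>) * (1 + \<epsilon>) * (norm w)\<^sup>2"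
      using \<epsilon> by (intro mult_right_mono) auto
    finally show "w \<bullet> (G u *v w) \<le> ((1 + \<epsilon>) * norm w)\<^sup>2"
      by (simp add: power2_eq_square mult_ac)
  qed (use \<epsilon> in auto)
  have lower: "(1 - \<epsilon>) * norm w \<le> sqrt (w \<bullet> (G u *v w))" if "u \<in> ball 0 R" for u w
  proof (rule real_le_rsqrt)
    have "((1 - \<epsilon>) * norm w)\<^sup>2 = (1 - \<epsilon>) * (1 - \<epsilon>) * (norm w)\<^sup>2" by (simp add: power2_eq_square mult_ac)
    also have "\<dots> \<le> (1 - \<epsilon>) * 1 * (norm w)\<^sup>2" using \<epsilon> by (intro mult_right_mono mult_left_mono) auto
    also have "\<dots> \<le> w \<bullet> (G u *v w)" using quad[OF that, of w] by (simp add: algebra_simps)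
    finally show "((1 - \<epsilon>) * norm w)\<^sup>2 \<le> w \<bullet> (G u *v w)" .
  qed
  define \<xi> where "\<xi> u = \<psi> i (h u)" for u
  have \<xi>: "\<xi> u \<in> cdom i" "\<phi> i (\<xi> u) = h u" "k (\<phi> i (\<xi> u)) = u" if "u \<in> ball 0 R" for u
    using cod[OF that] by (auto simp: \<xi>_def \<phi>_\<psi> \<psi>_in hk)
  have img: "\<xi> ` A = \<psi> i ` (h ` A)" for A by (simp add: \<xi>_def image_image)
  have openin\<xi>: "openin T (\<xi> ` ball 0 s)" if s: "s \<le> R" for s
  proof -
    have "h ` ball 0 s = k -` ball 0 s" 
    proof (intro set_eqI iffI)
      fix x assume "x \<in> k -` ball 0 s"
      then show "x \<in> h ` ball 0 s" by (intro image_eqI[of _ _ "k x"]) (simp_all add: hk)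
    qed (use hk in auto)
    then have "open (h ` ball 0 s)" using open_vimage[OF _ kcont[of UNIV]] by simp
    then show ?thesis
      unfolding img using cod s by (intro openin_inverse_image i) auto
  qed
  have closedin\<xi>: "closedin T (\<xi> ` cball 0 s)" if s: "s < R" for s
  proof -
    have "compact (h ` cball 0 s)" by (intro compact_continuous_image hcont) simp
    then show ?thesis
      unfolding img using cod s by (intro closedin_inverse_image i) auto
  qed
  let ?W = "\<xi> ` ball 0 R"
  have W: "x \<in> ?W \<longleftrightarrow> x \<in> cdom i \<and> k (\<phi> i x) \<in> ball 0 R" for x
    using \<xi> i(1) by (auto simp: image_iff \<xi>_def hk intro!: bexI[of _ "k (\<phi> i x)"])
  have WB: "?W \<in> sets B" using openin\<xi>[of R] openin_sets_B by simp
  have vol: "(\<integral>\<^sup>+x\<in>?W. f x \<partial>vol) = (\<integral>\<^sup>+u\<in>ball 0 R. f (\<xi> u) * ennreal (e2 u) \<partial>lborel)"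
    and fm: "(\<lambda>u. f (\<xi> u) * indicator (ball 0 R) u) \<in> borel_measurable borel"
    if f: "f \<in> borel_measurable B" for f :: "'a \<Rightarrow> ennreal"
  proof -
    let ?f = "\<lambda>x. f x * indicator ?W x"
    have f': "?f \<in> borel_measurable B" using f WB by (intro borel_measurable_times_ennreal) auto
    have hm: "h \<in> borel_measurable borel" using hcont borel_measurable_continuous_onI by blast
    have comp: "(\<lambda>x. ?f (\<psi> i x) * indicator (cod i) x) \<in> borel_measurable borel"
    proof -
      have "(\<lambda>x. ?f (\<psi> i x)) \<in> borel_measurable (restrict_space borel (cod i))"
        using measurable_compose[OF measurable_inverse[OF i(1)] f'] .
      then show ?thesis
        using open_cod[OF i(1)] by (subst (asm) borel_measurable_restrict_space_iff_ennreal) auto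
    qed
    \<comment> \<open>The two cut-offs, needed for measurability on the whole space, amount in the
      coordinates \<open>u\<close> to the indicator of the ball.\<close>
    have ind: "indicator ?W (\<psi> i (h u)) * indicator (cod i) (h u) = (indicator (ball 0 R) u :: ennreal)" for u
    proof (cases "h u \<in> cod i")
      case True
      have "\<psi> i (h u) \<in> ?W \<longleftrightarrow> u \<in> ball 0 R"
        using W[of "\<psi> i (h u)"] \<phi>_\<psi>[OF True] \<psi>_in[OF True] by (simp only: hk simp_thms)
      then show ?thesis using True by (simp only: indicator_def of_bool_eq mult_1_right)
    next
      case False
      then have "u \<notin> ball 0 R" using cod by blast
      with False show ?thesis by (simp only: indicator_def of_bool_eq mult_zero_right)
    qed
    have "(\<lambda>u. ?f (\<psi> i (h u)) * indicator (cod i) (h u)) \<in> borel_measurable borel"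
      using measurable_compose[OF hm comp] .
    then show "(\<lambda>u. f (\<xi> u) * indicator (ball 0 R) u) \<in> borel_measurable borel"
      by (simp only: mult.assoc ind \<xi>_def)
    have m2: "(\<lambda>x. (?f (\<psi> i x) * indicator (cod i) x) * (dens i x * indicator (cod i) x)) \<in> borel_measurable borel"
      by (intro borel_measurable_times_ennreal comp dens_measurable i)
    have "(\<integral>\<^sup>+x\<in>?W. f x \<partial>vol) = (\<integral>\<^sup>+x\<in>cdom i. ?f x \<partial>vol)"
      using W by (intro nn_integral_cong) (auto simp: indicator_def)
    also have "\<dots> = (\<integral>\<^sup>+x\<in>cod i. ?f (\<psi> i x) * dens i x \<partial>lborel)"
      by (rule nn_integral_vol_chart[OF i(1) f'])
    also have "\<dots> = (\<integral>\<^sup>+x. (?f (\<psi> i x) * indicator (cod i) x) * (dens i x * indicator (cod i) x) \<partial>lborel)"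
      by (intro nn_integral_cong) (auto simp: indicator_def)
    also have "\<dots> = (\<integral>\<^sup>+u. ((?f (\<psi> i (h u)) * indicator (cod i) (h u)) * (dens i (h u) * indicator (cod i) (h u))) * ennreal \<bar>det P\<bar> \<partial>lborel)"
      using nn_integral_affine[OF P(1) m2, of x0] by (simp only: h_def)
    also have "\<dots> = (\<integral>\<^sup>+u\<in>ball 0 R. f (\<xi> u) * ennreal (e2 u) \<partial>lborel)"
    proof (intro nn_integral_cong)
      fix u :: "real^'k"
      have "dens i (h u) * ennreal \<bar>det P\<bar> = ennreal (e2 u)"
        unfolding dens_def e2_def by (subst ennreal_mult') (simp_all add: mult.commute)
      then have "f (\<psi> i (h u)) * indicator (ball 0 R) u * (dens i (h u) * indicator (cod i) (h u)) * ennreal \<bar>det P\<bar>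
          = f (\<xi> u) * ennreal (e2 u) * indicator (ball 0 R) u"
        using cod[of u] by (auto simp: indicator_def \<xi>_def mult.assoc)
      then show "?f (\<psi> i (h u)) * indicator (cod i) (h u) * (dens i (h u) * indicator (cod i) (h u)) * ennreal \<bar>det P\<bar>
          = f (\<xi> u) * ennreal (e2 u) * indicator (ball 0 R) u"
        by (simp only: mult.assoc[of "f (\<psi> i (h u))" "indicator ?W (\<psi> i (h u))"] ind)
    qed
    finally show "(\<integral>\<^sup>+x\<in>?W. f x \<partial>vol) = (\<integral>\<^sup>+u\<in>ball 0 R. f (\<xi> u) * ennreal (e2 u) \<partial>lborel)" .
  qed
  have volbounds: "(\<integral>\<^sup>+x\<in>?W. f x \<partial>vol) \<le> ennreal (1 + \<epsilon>) * (\<integral>\<^sup>+u\<in>ball 0 R. f (\<xi> u) \<partial>lborel) \<and>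
     ennreal (1 - \<epsilon>) * (\<integral>\<^sup>+u\<in>ball 0 R. f (\<xi> u) \<partial>lborel) \<le> (\<integral>\<^sup>+x\<in>?W. f x \<partial>vol)"
    if f: "f \<in> borel_measurable B" for f :: "'a \<Rightarrow> ennreal"
  proof -
    have "ennreal c * (\<integral>\<^sup>+u\<in>ball 0 R. f (\<xi> u) \<partial>lborel) = (\<integral>\<^sup>+u\<in>ball 0 R. f (\<xi> u) * ennreal c \<partial>lborel)" for c
      using fm[OF f] by (subst nn_integral_cmult[symmetric]) (auto simp: mult_ac)
    then show ?thesis
      unfolding vol[OF f] using e2
      by (auto intro!: nn_integral_mono mult_left_mono ennreal_leI simp: indicator_def)
  qed
  have dist_upper: "d (\<xi> u) (\<xi> v) \<le> ennreal ((1 + \<epsilon>) * norm (u - v))"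
    if uv: "u \<in> ball 0 R" "v \<in> ball 0 R" for u v
  proof -
    \<comment> \<open>Convexity of the ball keeps the segment where the bounds on the metric
      hold.\<close>
    have seg: "u + t *\<^sub>R (v - u) \<in> ball 0 R" if "t \<in> {0..1}" for t
    proof -
      have "(1 - t) *\<^sub>R u + t *\<^sub>R v \<in> ball 0 R"
        using convexD_alt[OF convex_ball uv, of t] that by auto
      then show ?thesis by (simp add: algebra_simps)
    qed
    have hseg: "h (u + t *\<^sub>R (v - u)) = h u + t *\<^sub>R (P *v (v - u))" for t
      by (simp add: h_def matrix_vector_right_distrib matrix_vector_mult_scaleR)
    define \<gamma> where "\<gamma> t = \<psi> i (h u + t *\<^sub>R (P *v (v - u)))" for t
    have hc: "h u + t *\<^sub>R (P *v (v - u)) \<in> cod i" if "t \<in> {0..1}" for t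
      using cod[OF seg[OF that]] by (simp only: hseg)
    have sc: "piecewise_C1_curve M \<gamma>"
      unfolding \<gamma>_def[abs_def] by (rule segment_curve(1)[OF i(1)]) (rule hc)
    have sc_speed: "speed M \<gamma> t = sqrt ((P *v (v - u)) \<bullet> (metric M i (h u + t *\<^sub>R (P *v (v - u))) *v (P *v (v - u))))"
      if "regular \<gamma> F" "t \<in> {0<..<1} - F" for F t
      using that hc unfolding \<gamma>_def[abs_def] by (intro segment_curve(2)[OF i(1)])
    obtain F where F: "regular \<gamma> F" using sc by (rule piecewise_C1_curve_regular)
    have "speed M \<gamma> t \<le> (1 + \<epsilon>) * norm (u - v)" if "t \<in> {0<..<1} - F" for t
      using sc_speed[OF F that] upper[OF seg[of t], of "v - u"] that
      by (simp add: hseg[symmetric] form norm_minus_commute)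
    then have "rspeed \<gamma> F t \<le> ennreal ((1 + \<epsilon>) * norm (u - v)) * indicator {0<..<1} t" for t
      by (auto simp: rspeed_def indicator_def intro!: ennreal_leI)
    then have "curve_length M \<gamma> \<le> (\<integral>\<^sup>+t. ennreal ((1 + \<epsilon>) * norm (u - v)) * indicator {0<..<1::real} t \<partial>lborel)"
      unfolding curve_length_regular[OF F] by (rule nn_integral_mono)
    also have "\<dots> = ennreal ((1 + \<epsilon>) * norm (u - v))" by (simp add: nn_integral_cmult_indicator)
    finally have "d (\<gamma> 0) (\<gamma> 1) \<le> ennreal ((1 + \<epsilon>) * norm (u - v))"
      using dist_le_length[OF sc] by simp
    moreover have "\<gamma> 0 = \<xi> u" "\<gamma> 1 = \<xi> v" using hseg[of 0] hseg[of 1] by (simp_all add: \<gamma>_def \<xi>_def)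
    ultimately show ?thesis by simp
  qed
  \<comment> \<open>The lower bound for curves inside the chart, up to an arbitrary time
    \<open>b\<close> so that it also applies just before a first exit.\<close>
  have stay: "ennreal ((1 - \<epsilon>) * norm (k (\<phi> i (\<gamma> b)) - k (\<phi> i (\<gamma> 0)))) \<le> curve_length M \<gamma>"
    if reg: "regular \<gamma> F" and b: "0 < b" "b \<le> 1" and inW: "\<And>t. t \<in> {0..b} \<Longrightarrow> \<gamma> t \<in> ?W" for \<gamma> F b
    unfolding kdiff
  proof (rule length_lower_bound[OF reg b i(1)])
    show "\<gamma> t \<in> cdom i" if "t \<in> {0..b}" for t using inW[OF that] W by blast
    show "0 < 1 - \<epsilon>" using \<epsilon> by simp
    fix t assume t: "t \<in> {0<..<b} - F"
    then have "\<gamma> t \<in> cdom i" "k (\<phi> i (\<gamma> t)) \<in> ball 0 R" using inW[of t] W by auto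
    then show "(1 - \<epsilon>) * norm (Q *v vel i \<gamma> t) \<le> speed M \<gamma> t"
      using lower[of "k (\<phi> i (\<gamma> t))" "Q *v vel i \<gamma> t"] speed_chart[OF reg i(1), of t] t b
      by (simp add: form[symmetric] PQ hk)
  qed
  \<comment> \<open>A shorter curve would stay, up to its first exit time, in a closed ball of
    radius below \<open>R\<close>. The image of that ball is closed in the manifold, so the exit
    point would still lie inside the chart.\<close>
  have exit: "ennreal ((1 - \<epsilon>) * (R/2)) \<le> curve_length M \<gamma>"
    if u: "u \<in> ball 0 (R/2)" and C: "piecewise_C1_curve M \<gamma>" "\<gamma> 0 = \<xi> u"
      and out: "\<exists>t\<in>{0..1}. \<gamma> t \<notin> ?W" for \<gamma> u
  proof (rule ccontr)
    assume "\<not> ennreal ((1 - \<epsilon>) * (R/2)) \<le> curve_length M \<gamma>"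
    then have L: "curve_length M \<gamma> < ennreal ((1 - \<epsilon>) * (R/2))" by simp
    obtain F where F: "regular \<gamma> F" using C(1) by (rule piecewise_C1_curve_regular)
    then have path: "pathin T \<gamma>" by (simp add: regular_def)
    have uR: "u \<in> ball 0 R" using u R(1) by auto
    define L' where "L' = enn2real (curve_length M \<gamma>)"
    have "curve_length M \<gamma> < top" using L by (rule order_less_trans) simp
    then have L': "curve_length M \<gamma> = ennreal L'" "0 \<le> L'"
      by (auto simp: L'_def)
    \<comment> \<open>The largest coordinate displacement that the length allows while the curve is
      in the chart; together with \<open>norm u\<close> it stays below \<open>R\<close>.\<close>
    define q where "q = L' / (1 - \<epsilon>)"
    have q: "0 \<le> q" "q < R/2"
      using L L' \<epsilon> R(1) by (auto simp: q_def ennreal_less_iff field_simps)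
    define Z where "Z = {t\<in>{0..1}. \<gamma> t \<notin> ?W}"
    have Zc: "closed Z"
    proof -
      have "closedin (top_of_set {0..1}) {t \<in> topspace (top_of_set {0..1}). \<gamma> t \<in> topspace T - ?W}"
        using path openin\<xi>[of R] unfolding pathin_def by (intro closedin_continuous_map_preimage) auto
      moreover have "{t \<in> topspace (top_of_set {0..1}). \<gamma> t \<in> topspace T - ?W} = Z"
        using path_in_topspace[OF path] by (auto simp: Z_def)
      ultimately show ?thesis by (simp add: closedin_closed_eq)
    qed
    have Z: "Z \<noteq> {}" "bdd_below Z" using out by (auto simp: Z_def intro!: bdd_belowI[of _ 0])
    \<comment> \<open>The first exit time. It belongs to \<open>Z\<close> because the chart image is
      open and hence \<open>Z\<close> is closed.\<close>
    define T1 where "T1 = Inf Z"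
    have T1: "T1 \<in> Z" unfolding T1_def using closed_contains_Inf[OF Z Zc] .
    have before: "\<gamma> t \<in> ?W" if "t \<in> {0..<T1}" for t
    proof -
      have "t \<notin> Z" using cInf_lower[of t Z] Z(2) that by (auto simp: T1_def)
      then show ?thesis using that T1 by (auto simp: Z_def)
    qed
    have "\<gamma> t \<in> \<xi> ` cball 0 (norm u + q)" if t: "t \<in> {0..<T1}" for t
    proof -
      have "norm (k (\<phi> i (\<gamma> t)) - u) \<le> q"
      proof (cases "t = 0")
        case True
        then show ?thesis using q C(2) \<xi>(3)[OF uR] by simp
      next
        case False
        have "ennreal ((1 - \<epsilon>) * norm (k (\<phi> i (\<gamma> t)) - k (\<phi> i (\<gamma> 0)))) \<le> ennreal L'"
          unfolding L'(1)[symmetric]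
          by (rule stay[OF F]) (use False t before T1 in \<open>auto simp: Z_def\<close>)
        then have "(1 - \<epsilon>) * norm (k (\<phi> i (\<gamma> t)) - u) \<le> L'"
          using L'(2) C(2) \<xi>(3)[OF uR] by (simp add: ennreal_le_iff)
        then show ?thesis using \<epsilon> by (simp add: q_def field_simps)
      qed
      then have "norm (k (\<phi> i (\<gamma> t))) \<le> norm u + q" using norm_triangle_sub[of "k (\<phi> i (\<gamma> t))" u] by simp
      moreover have "\<gamma> t = \<xi> (k (\<phi> i (\<gamma> t)))" using before[OF t] W i(1) by (simp add: \<xi>_def hk)
      ultimately show ?thesis by (metis imageI mem_cball_0)
    qed
    \<comment> \<open>Closedness extends the confinement from times before \<open>T1\<close> to
      \<open>T1\<close> itself.\<close>
    moreover have "closed {t\<in>{0..1}. \<gamma> t \<in> \<xi> ` cball 0 (norm u + q)}"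
    proof -
      have "norm u + q < R" using u q by auto
      then have "closedin (top_of_set {0..1}) {t \<in> topspace (top_of_set {0..1}). \<gamma> t \<in> \<xi> ` cball 0 (norm u + q)}"
        using path closedin\<xi> unfolding pathin_def by (intro closedin_continuous_map_preimage) auto
      then show ?thesis by (simp add: closedin_closed_eq)
    qed
    moreover have "T1 \<le> 1" using T1 by (simp add: Z_def)
    ultimately have "closure {0..<T1} \<subseteq> {t\<in>{0..1}. \<gamma> t \<in> \<xi> ` cball 0 (norm u + q)}"
      by (intro closure_minimal) auto
    moreover have "T1 \<noteq> 0" using T1 C(2) uR by (auto simp: Z_def)
    then have "T1 \<in> closure {0..<T1}" using T1 by (auto simp: Z_def closure_atLeastLessThan)
    ultimately have "\<gamma> T1 \<in> \<xi> ` cball 0 (norm u + q)" by auto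
    moreover have "cball 0 (norm u + q) \<subseteq> ball (0::real^'k) R" using u q by auto
    ultimately have "\<gamma> T1 \<in> ?W" by blast
    then show False using T1 by (simp add: Z_def)
  qed
  have dist_lower: "ennreal ((1 - \<epsilon>) * min (norm (u - v)) (R/2)) \<le> d (\<xi> u) (\<xi> v)"
    if uv: "u \<in> ball 0 (R/2)" "v \<in> ball 0 R" for u v
  proof (rule le_dist)
    fix \<gamma> assume C: "piecewise_C1_curve M \<gamma>" "\<gamma> 0 = \<xi> u" "\<gamma> 1 = \<xi> v"
    obtain F where F: "regular \<gamma> F" using C(1) by (rule piecewise_C1_curve_regular)
    have uR: "u \<in> ball 0 R" using uv R(1) by auto
    show "ennreal ((1 - \<epsilon>) * min (norm (u - v)) (R/2)) \<le> curve_length M \<gamma>"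
    proof (cases "\<forall>t\<in>{0..1}. \<gamma> t \<in> ?W")
      case True
      have "ennreal ((1 - \<epsilon>) * min (norm (u - v)) (R/2)) \<le> ennreal ((1 - \<epsilon>) * norm (u - v))"
        using \<epsilon> by (intro ennreal_leI mult_left_mono) auto
      also have "\<dots> \<le> curve_length M \<gamma>"
        using stay[OF F, of 1] True C \<xi>(3)[OF uR] \<xi>(3)[OF uv(2)] by (simp add: norm_minus_commute)
      finally show ?thesis .
    next
      case False
      have "ennreal ((1 - \<epsilon>) * min (norm (u - v)) (R/2)) \<le> ennreal ((1 - \<epsilon>) * (R/2))"
        using \<epsilon> by (intro ennreal_leI mult_left_mono) auto
      also have "\<dots> \<le> curve_length M \<gamma>" using exit[OF uv(1) C(1,2)] False by blast
      finally show ?thesis .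
    qed
  qed
  have dist_far: "ennreal ((1 - \<epsilon>) * (R/2)) \<le> d (\<xi> u) y"
    if u: "u \<in> ball 0 (R/2)" and y: "y \<notin> ?W" for u y
  proof (rule le_dist)
    fix \<gamma> assume C: "piecewise_C1_curve M \<gamma>" "\<gamma> 0 = \<xi> u" "\<gamma> 1 = y"
    show "ennreal ((1 - \<epsilon>) * (R/2)) \<le> curve_length M \<gamma>"
      by (rule exit[OF u C(1,2)]) (use C(3) y in \<open>auto intro!: bexI[of _ 1]\<close>)
  qed
  have "\<xi> 0 = p" using i by (simp add: \<xi>_def h_def x0_def)
  moreover have "continuous_map (top_of_set (ball 0 R)) T \<xi>"
  proof -
    have "continuous_map (top_of_set (ball 0 R)) (top_of_set (cod i)) h"
      using hcont cod by (auto simp: continuous_map_in_subtopology)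
    from continuous_map_compose[OF this continuous_inverse[OF i(1)]]
    show ?thesis unfolding \<xi>_def[abs_def] o_def by (simp add: continuous_map_in_subtopology)
  qed
  ultimately have "normal_chart p \<epsilon> R \<xi>"
    unfolding normal_chart_def using R(1) openin\<xi> volbounds dist_upper dist_lower dist_far by blast
  then show ?thesis by blast
qed

end

section \<open>Concentration of the kernel\<close>

locale kernel_manifold = closed_riemannian M + kernel K
  for M :: "('a, 'i, 'k::finite) riemannian" and K :: "real \<Rightarrow> real"
begin

lemma normal_chartD:
  assumes "normal_chart p \<epsilon> R \<xi>"
  shows "R > 0" "\<xi> 0 = p" "continuous_map (top_of_set (ball 0 R)) T \<xi>"
    "\<And>s. s \<le> R \<Longrightarrow> openin T (\<xi> ` ball 0 s)"
    "\<And>f. f \<in> borel_measurable B \<Longrightarrow>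
      (\<integral>\<^sup>+x\<in>\<xi> ` ball 0 R. f x \<partial>vol) \<le> ennreal (1 + \<epsilon>) * (\<integral>\<^sup>+u\<in>ball 0 R. f (\<xi> u) \<partial>lborel)"
    "\<And>f. f \<in> borel_measurable B \<Longrightarrow>
      ennreal (1 - \<epsilon>) * (\<integral>\<^sup>+u\<in>ball 0 R. f (\<xi> u) \<partial>lborel) \<le> (\<integral>\<^sup>+x\<in>\<xi> ` ball 0 R. f x \<partial>vol)"
    "\<And>u v. u \<in> ball 0 R \<Longrightarrow> v \<in> ball 0 R \<Longrightarrow> d (\<xi> u) (\<xi> v) \<le> ennreal ((1 + \<epsilon>) * norm (u - v))"
    "\<And>u v. u \<in> ball 0 (R/2) \<Longrightarrow> v \<in> ball 0 R \<Longrightarrow> ennreal ((1 - \<epsilon>) * min (norm (u - v)) (R/2)) \<le> d (\<xi> u) (\<xi> v)"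
    "\<And>u y. u \<in> ball 0 (R/2) \<Longrightarrow> y \<notin> \<xi> ` ball 0 R \<Longrightarrow> ennreal ((1 - \<epsilon>) * (R/2)) \<le> d (\<xi> u) y"
  using assms unfolding normal_chart_def by blast+

section \<open>Finite volume and measurability of the distance\<close>

lemma finite_subcover:
  assumes "\<And>p. p \<in> topspace T \<Longrightarrow> p \<in> W p \<and> openin T (W p)"
  obtains F where "finite F" "F \<subseteq> topspace T" "topspace T \<subseteq> (\<Union>p\<in>F. W p)"
proof -
  have "\<forall>U\<in>W ` topspace T. openin T U" "topspace T \<subseteq> \<Union>(W ` topspace T)" using assms by auto
  then obtain \<F> where \<F>: "finite \<F>" "\<F> \<subseteq> W ` topspace T" "topspace T \<subseteq> \<Union>\<F>"
    using compact[unfolded compact_space_alt, rule_format, of "W ` topspace T"] by auto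
  from finite_subset_image[OF \<F>(1,2)] obtain F where "F \<subseteq> topspace T" "finite F" "\<F> = W ` F" by auto
  with that[of F] \<F>(3) show ?thesis by simp
qed

text \<open>The volume comparison with the constant function 1 gives every point a neighbourhood of
  finite volume; compactness does the rest.\<close>

lemma emeasure_vol_finite: "emeasure vol (topspace T) < \<infinity>"
proof -
  have "\<exists>W. p \<in> W \<and> openin T W \<and> emeasure vol W < \<infinity>" if p: "p \<in> topspace T" for p
  proof -
    obtain R \<xi> where N: "normal_chart p (1/2) R \<xi>" using normal_chart_exists[OF p, of "1/2"] by auto
    note D = normal_chartD[OF N]
    let ?W = "\<xi> ` ball 0 R"
    have W: "openin T ?W" using D(4)[of R] by simp
    have "p \<in> ?W" using D(1,2) by (metis centre_in_ball imageI)
    have "emeasure vol ?W = (\<integral>\<^sup>+x\<in>?W. 1 \<partial>vol)" using openin_sets_B[OF W] by simp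
    also have "\<dots> \<le> ennreal (1 + 1/2) * (\<integral>\<^sup>+u\<in>ball (0::real^'k) R. 1 \<partial>lborel)" by (rule D(5)) simp
    also have "\<dots> = ennreal (1 + 1/2) * emeasure lborel (ball (0::real^'k) R)" by simp
    also have "\<dots> < \<infinity>" using emeasure_bounded_finite[of "ball (0::real^'k) R"] by (simp add: ennreal_mult_less_top)
    finally show ?thesis using W \<open>p \<in> ?W\<close> by blast
  qed
  then obtain W where W: "\<And>p. p \<in> topspace T \<Longrightarrow> p \<in> W p \<and> openin T (W p) \<and> emeasure vol (W p) < \<infinity>" by metis
  then obtain F where F: "finite F" "F \<subseteq> topspace T" "topspace T \<subseteq> (\<Union>p\<in>F. W p)"
    using finite_subcover[of W] by metis
  have Wm: "W p \<in> sets vol" if "p \<in> F" for p using that F(2) W openin_sets_B by auto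
  have "emeasure vol (topspace T) \<le> emeasure vol (\<Union>p\<in>F. W p)"
    using F(1,3) Wm by (intro emeasure_mono sets.finite_UN)
  also have "\<dots> \<le> (\<Sum>p\<in>F. emeasure vol (W p))" using F(1) Wm by (intro emeasure_subadditive_finite) auto
  also have "\<dots> < \<infinity>" using F W by (auto simp: subset_iff)
  finally show ?thesis .
qed

lemma finite_measure_vol: "finite_measure vol"
  using emeasure_vol_finite by (intro finite_measureI) auto

definition "V = measure vol (topspace T)"

lemma emeasure_V: "emeasure vol (topspace T) = ennreal V"
  using finite_measure.emeasure_eq_measure[OF finite_measure_vol] by (simp add: V_def)

lemma dist_nbhd:
  assumes x: "x \<in> topspace T" and e: "e > 0"
  shows "\<exists>U. openin T U \<and> x \<in> U \<and> (\<forall>x'\<in>U. d x x' \<le> ennreal e)"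
proof -
  obtain R \<xi> where N: "normal_chart x (1/2) R \<xi>" using normal_chart_exists[OF x, of "1/2"] by auto
  note D = normal_chartD[OF N]
  \<comment> \<open>With chart accuracy \<open>1/2\<close> distances are at most \<open>3/2\<close>
    times coordinate distances, so radius \<open>e / 2\<close> is small enough.\<close>
  define s where "s = min R (e / 2)"
  have s: "0 < s" "s \<le> R" "s \<le> e / 2" using D(1) e by (auto simp: s_def)
  have "d x x' \<le> ennreal e" if x': "x' \<in> \<xi> ` ball 0 s" for x'
  proof -
    obtain v where v: "v \<in> ball 0 s" "x' = \<xi> v" using x' by blast
    have "d x x' \<le> ennreal ((1 + 1/2) * norm (0 - v))" using D(7)[of 0 v] D(1,2) s v by auto
    also have "\<dots> \<le> ennreal e" using v s e by (intro ennreal_leI) auto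
    finally show ?thesis .
  qed
  moreover have "x \<in> \<xi> ` ball 0 s" using D(2) s by (metis centre_in_ball imageI)
  ultimately show ?thesis using D(4)[OF s(2)] by blast
qed

text \<open>Upper semicontinuity of the distance: by the triangle inequality, moving both points by
  at most \<open>e\<close> adds at most \<open>2 * e\<close>, and \<open>e\<close> is half of a gap
  left below \<open>c\<close>.\<close>

lemma open_dist_less:
  assumes xy: "x \<in> topspace T" "y \<in> topspace T" and less: "d x y < c"
  shows "\<exists>U W. openin T U \<and> openin T W \<and> x \<in> U \<and> y \<in> W \<and> (\<forall>x'\<in>U. \<forall>y'\<in>W. d x' y' < c)"
proof -
  obtain z where z: "d x y < z" "z < c" using less dense by blast
  obtain a where a: "d x y = ennreal a" "0 \<le> a" using z(1) by (cases "d x y" rule: ennreal_cases) auto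
  obtain b where b: "z = ennreal b" "0 \<le> b" using z(2) by (cases z rule: ennreal_cases) auto
  have ab: "a < b" using z(1) a b by (simp add: ennreal_less_iff)
  define e where "e = (b - a) / 2"
  have e: "e > 0" using ab by (simp add: e_def)
  obtain U where U: "openin T U" "x \<in> U" "\<And>x'. x' \<in> U \<Longrightarrow> d x x' \<le> ennreal e"
    using dist_nbhd[OF xy(1) e] by blast
  obtain W where W: "openin T W" "y \<in> W" "\<And>y'. y' \<in> W \<Longrightarrow> d y y' \<le> ennreal e"
    using dist_nbhd[OF xy(2) e] by blast
  have "d x' y' < c" if "x' \<in> U" "y' \<in> W" for x' y'
  proof -
    have "d x' y' \<le> d x' x + d x y'" by (rule dist_triangle)
    also have "\<dots> \<le> d x' x + (d x y + d y y')" by (intro add_left_mono dist_triangle)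
    also have "\<dots> \<le> ennreal e + (ennreal a + ennreal e)"
      using U(3)[OF that(1)] W(3)[OF that(2)] a by (intro add_mono) (auto simp: dist_sym[of x'])
    also have "\<dots> = ennreal b" using e a by (simp add: e_def flip: ennreal_plus)
    also have "\<dots> < c" using z b by simp
    finally show ?thesis .
  qed
  then show ?thesis using U W by blast
qed

text \<open>Sublevel sets are open in the product topology. Second countability writes them as
  countable unions of open rectangles, which puts them into the product \<sigma>-algebra.\<close>

lemma dist_measurable: "(\<lambda>z. d (fst z) (snd z)) \<in> borel_measurable (B \<Otimes>\<^sub>M B)"
proof (rule borel_measurableI_less)
  fix c
  let ?E = "{z \<in> space (B \<Otimes>\<^sub>M B). d (fst z) (snd z) < c}"
  obtain \<B> where \<B>: "countable \<B>" "\<And>U. U \<in> \<B> \<Longrightarrow> openin T U"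
    "\<And>U x. openin T U \<Longrightarrow> x \<in> U \<Longrightarrow> \<exists>V\<in>\<B>. x \<in> V \<and> V \<subseteq> U"
    using second_countable unfolding second_countable_def by metis
  define \<D> where "\<D> = {UW \<in> \<B> \<times> \<B>. fst UW \<times> snd UW \<subseteq> ?E}"
  have "countable \<D>" unfolding \<D>_def using \<B>(1) by (intro countable_Collect) auto
  moreover have "fst UW \<times> snd UW \<in> sets (B \<Otimes>\<^sub>M B)" if "UW \<in> \<D>" for UW
    using that \<B>(2) by (intro pair_measureI openin_sets_B) (auto simp: \<D>_def)
  ultimately have "(\<Union>UW\<in>\<D>. fst UW \<times> snd UW) \<in> sets (B \<Otimes>\<^sub>M B)" by (intro sets.countable_UN') auto
  moreover have "(\<Union>UW\<in>\<D>. fst UW \<times> snd UW) = ?E"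
  proof (intro equalityI subsetI)
    fix z assume z: "z \<in> ?E"
    have xy: "fst z \<in> topspace T" "snd z \<in> topspace T" "d (fst z) (snd z) < c"
      using z by (auto simp: space_pair_measure)
    obtain U W where UW: "openin T U" "openin T W" "fst z \<in> U" "snd z \<in> W" "\<And>x' y'. x' \<in> U \<Longrightarrow> y' \<in> W \<Longrightarrow> d x' y' < c"
      using open_dist_less[OF xy] by blast
    obtain U' where U': "U' \<in> \<B>" "fst z \<in> U'" "U' \<subseteq> U" using \<B>(3)[OF UW(1,3)] by blast
    obtain W' where W': "W' \<in> \<B>" "snd z \<in> W'" "W' \<subseteq> W" using \<B>(3)[OF UW(2,4)] by blast
    have "U' \<times> W' \<subseteq> ?E"
      using U' W' openin_subset[OF \<B>(2)[OF U'(1)]] openin_subset[OF \<B>(2)[OF W'(1)]]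
      by (auto simp: space_pair_measure intro!: UW(5))
    then have "(U', W') \<in> \<D>" using U' W' by (simp add: \<D>_def)
    moreover have "z \<in> U' \<times> W'" using U' W' by (simp add: mem_Times_iff)
    ultimately show "z \<in> (\<Union>UW\<in>\<D>. fst UW \<times> snd UW)" by force
  qed (auto simp: \<D>_def)
  ultimately show "?E \<in> sets (B \<Otimes>\<^sub>M B)" by simp
qed

section \<open>The kernel as a function of pairs\<close>

definition "kw r z = ennreal (kernel_weight M K r (fst z) (snd z))"

lemma kw_measurable: "r > 0 \<Longrightarrow> kw r \<in> borel_measurable (B \<Otimes>\<^sub>M B)"
proof -
  assume r: "r > 0"
  let ?P = "B \<Otimes>\<^sub>M B"
  have 1: "(\<lambda>z. enn2real (d (fst z) (snd z)) / r) \<in> borel_measurable ?P"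
    using dist_measurable by (intro borel_measurable_divide borel_measurable_enn2real) auto
  have 2: "(\<lambda>z. scaled_kernel CARD('k) K r (enn2real (d (fst z) (snd z)))) \<in> borel_measurable ?P"
    unfolding scaled_kernel_def using r
    by (intro borel_measurable_divide borel_measurable_compose_nonneg 1) auto
  have 3: "{z \<in> space ?P. d (fst z) (snd z) = \<infinity>} \<in> sets ?P"
    using dist_measurable by (intro borel_measurable_eq) auto
  have "(\<lambda>z. kernel_weight M K r (fst z) (snd z)) \<in> borel_measurable ?P"
    unfolding kernel_weight_def using 2 3 by (intro measurable_If) auto
  then show ?thesis unfolding kw_def by (intro measurable_compose[OF _ measurable_ennreal])
qed

lemma kw_sym: "kw r (x, y) = kw r (y, x)"
  by (simp add: kw_def kernel_weight_def dist_sym[of x y])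

text \<open>The kernel decreases in the distance; pairs at infinite distance obey the bound as well,
  since their weight is 0.\<close>

lemma kw_le: "r > 0 \<Longrightarrow> 0 \<le> a \<Longrightarrow> ennreal a \<le> d x y \<Longrightarrow> kw r (x, y) \<le> ennreal (scaled_kernel CARD('k) K r a)"
proof -
  assume r: "r > 0" and a: "0 \<le> a" "ennreal a \<le> d x y"
  show ?thesis
  proof (cases "d x y" rule: ennreal_cases)
    case (real b)
    then have "a \<le> b" using a by (simp add: ennreal_le_iff)
    then show ?thesis using real r a
      by (auto simp: kw_def kernel_weight_def intro!: ennreal_leI scaled_decreasing)
  qed (simp add: kw_def kernel_weight_def)
qed

lemma kw_ge: "r > 0 \<Longrightarrow> 0 \<le> a \<Longrightarrow> d x y \<le> ennreal a \<Longrightarrow> ennreal (scaled_kernel CARD('k) K r a) \<le> kw r (x, y)"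
proof -
  assume r: "r > 0" and a: "0 \<le> a" "d x y \<le> ennreal a"
  then obtain b where b: "d x y = ennreal b" "0 \<le> b"
    by (cases "d x y" rule: ennreal_cases) (auto simp: top_unique)
  then have "b \<le> a" using a by (simp add: ennreal_le_iff)
  then show ?thesis using r a b
    by (auto simp: kw_def kernel_weight_def intro!: ennreal_leI scaled_decreasing)
qed

lemma kw_measurable_snd: "r > 0 \<Longrightarrow> x \<in> topspace T \<Longrightarrow> (\<lambda>y. kw r (x, y)) \<in> borel_measurable B"
  using measurable_compose[OF measurable_Pair1' kw_measurable] by simp

section \<open>Integrals of the kernel over the second variable\<close>

definition "\<Phi> r x = (\<integral>\<^sup>+y. kw r (x, y) \<partial>vol)"

lemma nn_integral_shift_norm:
  fixes u :: "real^'k"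
  assumes "g \<in> borel_measurable borel"
  shows "(\<integral>\<^sup>+v. g (norm (u - v)) \<partial>lborel) = (\<integral>\<^sup>+v. g (norm (v::real^'k)) \<partial>lborel)"
proof -
  have i: "invertible (mat 1 :: real^'k^'k)" by (auto simp: invertible_def)
  have "(\<lambda>v::real^'k. g (norm (u - v))) \<in> borel_measurable borel"
    by (rule measurable_compose[OF _ assms]) measurable
  from nn_integral_affine[OF i this, of u] show ?thesis by simp
qed

text \<open>The absolute value keeps the argument of \<open>K\<close> nonnegative, which gives
  measurability on the whole line.\<close>

lemma sk_measurable: "r > 0 \<Longrightarrow> c > 0 \<Longrightarrow> (\<lambda>t. ennreal (scaled_kernel CARD('k) K r (c * \<bar>t\<bar>))) \<in> borel_measurable borel"
  unfolding scaled_kernel_def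
  by (intro measurable_compose[OF _ measurable_ennreal] borel_measurable_divide borel_measurable_compose_nonneg) auto

text \<open>The chart contributes the Euclidean integral with distances shrunk by
  \<open>1 - \<epsilon>\<close>. The remainder collects all pairs known only to be at least
  \<open>(1 - \<epsilon>) * (R/2)\<close> apart, inside the chart and outside. Points in the whole
  half ball are treated, so that a bound uniform near \<open>p\<close> results.\<close>

lemma \<Phi>_upper:
  assumes N: "normal_chart p \<epsilon> R \<xi>" and \<epsilon>: "0 < \<epsilon>" "\<epsilon> < 1" and u: "u \<in> ball 0 (R/2)" and r: "r > 0"
  shows "\<Phi> r (\<xi> u) \<le> ennreal ((1 + \<epsilon>) / (1 - \<epsilon>) ^ CARD('k)) * (kernel_constant TYPE('k) K)
    + ennreal (scaled_kernel CARD('k) K r ((1 - \<epsilon>) * (R/2)) * ((1 + \<epsilon>) * measure lborel (ball (0::real^'k) R) + V))"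
proof -
  note D = normal_chartD[OF N]
  let ?W = "\<xi> ` ball 0 R" and ?\<delta> = "(1 - \<epsilon>) * (R/2)"
  have W: "?W \<in> sets B" using D(4)[of R] openin_sets_B by simp
  have uR: "u \<in> ball 0 R" using u D(1) by auto
  have uT: "\<xi> u \<in> topspace T"
    using openin_subset[OF D(4)[of R]] uR by blast
  have \<delta>: "0 < ?\<delta>" using \<epsilon> D(1) by simp
  have s0: "0 \<le> scaled_kernel CARD('k) K r ?\<delta>" using \<delta> r by (intro scaled_nonneg) auto
  let ?f = "\<lambda>y. kw r (\<xi> u, y)"
  have f: "?f \<in> borel_measurable B" by (rule kw_measurable_snd[OF r uT])
  \<comment> \<open>The two cases of the minimum in the distance bound are merged into a sum, which
    can be integrated term by term.\<close>
  have near: "?f (\<xi> v) \<le> ennreal (scaled_kernel CARD('k) K r ((1 - \<epsilon>) * norm (u - v))) + ennreal (scaled_kernel CARD('k) K r ?\<delta>)" if v: "v \<in> ball 0 R" for v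
  proof (cases "norm (u - v) \<le> R/2")
    case True
    then have "?f (\<xi> v) \<le> ennreal (scaled_kernel CARD('k) K r ((1 - \<epsilon>) * norm (u - v)))"
      using D(8)[OF u v] \<epsilon> r by (intro kw_le) auto
    then show ?thesis by (rule order_trans) simp
  next
    case False
    then have "?f (\<xi> v) \<le> ennreal (scaled_kernel CARD('k) K r ?\<delta>)"
      using D(8)[OF u v] \<delta> r by (intro kw_le) (auto simp: min_def)
    then show ?thesis by (rule order_trans) simp
  qed
  have far: "?f y \<le> ennreal (scaled_kernel CARD('k) K r ?\<delta>)" if "y \<notin> ?W" for y
    using D(9)[OF u that] \<delta> r by (intro kw_le) auto
  have m: "(\<lambda>v. ennreal (scaled_kernel CARD('k) K r ((1 - \<epsilon>) * norm (u - v)))) \<in> borel_measurable borel"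
    using measurable_compose[OF _ sk_measurable[OF r, of "1 - \<epsilon>"], of "\<lambda>v. norm (u - v)" borel] \<epsilon> by simp
  have int: "(\<integral>\<^sup>+v. ennreal (scaled_kernel CARD('k) K r ((1 - \<epsilon>) * norm (u - v))) \<partial>lborel) = ennreal (1 / (1 - \<epsilon>) ^ CARD('k)) * (kernel_constant TYPE('k) K)"
    using nn_integral_shift_norm[OF sk_measurable[OF r, of "1 - \<epsilon>"], of u] nn_integral_scaled[OF r, of "1 - \<epsilon>", where 'k = 'k] \<epsilon>
    by simp
  have ballm: "emeasure lborel (ball (0::real^'k) R) = ennreal (measure lborel (ball (0::real^'k) R))"
    using emeasure_bounded_finite[of "ball (0::real^'k) R"] by (intro emeasure_eq_ennreal_measure) auto
  have "\<Phi> r (\<xi> u) = (\<integral>\<^sup>+y. ?f y * indicator ?W y + ?f y * indicator (topspace T - ?W) y \<partial>vol)"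
    unfolding \<Phi>_def by (intro nn_integral_cong) (auto simp: indicator_def)
  also have "\<dots> = (\<integral>\<^sup>+y\<in>?W. ?f y \<partial>vol) + (\<integral>\<^sup>+y\<in>topspace T - ?W. ?f y \<partial>vol)"
    using f W sets.compl_sets[OF W] by (intro nn_integral_add) (auto simp: measurable_cong_sets[OF sets_vol refl])
  also have "(\<integral>\<^sup>+y\<in>topspace T - ?W. ?f y \<partial>vol) \<le> (\<integral>\<^sup>+y. ennreal (scaled_kernel CARD('k) K r ?\<delta>) \<partial>vol)"
    using far by (intro nn_integral_mono) (auto simp: indicator_def)
  also have "\<dots> = ennreal (scaled_kernel CARD('k) K r ?\<delta> * V)"
    using emeasure_V s0 by (simp add: ennreal_mult')
  also have "(\<integral>\<^sup>+y\<in>?W. ?f y \<partial>vol) \<le> ennreal (1 + \<epsilon>) * (\<integral>\<^sup>+v\<in>ball 0 R. ?f (\<xi> v) \<partial>lborel)"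
    by (rule D(5)[OF f])
  also have "(\<integral>\<^sup>+v\<in>ball 0 R. ?f (\<xi> v) \<partial>lborel)
      \<le> (\<integral>\<^sup>+v. ennreal (scaled_kernel CARD('k) K r ((1 - \<epsilon>) * norm (u - v))) + ennreal (scaled_kernel CARD('k) K r ?\<delta>) * indicator (ball 0 R) v \<partial>lborel)"
    using near by (intro nn_integral_mono) (auto simp: indicator_def)
  also have "\<dots> = (\<integral>\<^sup>+v. ennreal (scaled_kernel CARD('k) K r ((1 - \<epsilon>) * norm (u - v))) \<partial>lborel)
      + (\<integral>\<^sup>+v. ennreal (scaled_kernel CARD('k) K r ?\<delta>) * indicator (ball (0::real^'k) R) v \<partial>lborel)"
    using m by (intro nn_integral_add borel_measurable_times_ennreal borel_measurable_indicator) auto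
  also have "(\<integral>\<^sup>+v. ennreal (scaled_kernel CARD('k) K r ?\<delta>) * indicator (ball (0::real^'k) R) v \<partial>lborel) = ennreal (scaled_kernel CARD('k) K r ?\<delta> * measure lborel (ball (0::real^'k) R))"
    using ballm s0 by (simp add: nn_integral_cmult_indicator ennreal_mult')
  also note int
  also have "ennreal (1 + \<epsilon>) * (ennreal (1 / (1 - \<epsilon>) ^ CARD('k)) * (kernel_constant TYPE('k) K) + ennreal (scaled_kernel CARD('k) K r ?\<delta> * measure lborel (ball (0::real^'k) R)))
      + ennreal (scaled_kernel CARD('k) K r ?\<delta> * V)
    = ennreal ((1 + \<epsilon>) / (1 - \<epsilon>) ^ CARD('k)) * (kernel_constant TYPE('k) K)
      + ennreal (scaled_kernel CARD('k) K r ?\<delta> * ((1 + \<epsilon>) * measure lborel (ball (0::real^'k) R) + V))"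
  proof -
    have "ennreal (1 + \<epsilon>) * (ennreal (1 / (1 - \<epsilon>) ^ CARD('k)) * (kernel_constant TYPE('k) K)) = ennreal ((1 + \<epsilon>) / (1 - \<epsilon>) ^ CARD('k)) * (kernel_constant TYPE('k) K)"
    proof -
      define q where "q = 1 / (1 - \<epsilon>) ^ CARD('k)"
      have "(1 + \<epsilon>) / (1 - \<epsilon>) ^ CARD('k) = (1 + \<epsilon>) * q" "0 \<le> q" using \<epsilon> by (simp_all add: q_def)
      then show ?thesis using \<epsilon> unfolding q_def[symmetric] by (simp only: ennreal_mult mult.assoc)
    qed
    moreover have "ennreal (1 + \<epsilon>) * ennreal (scaled_kernel CARD('k) K r ?\<delta> * measure lborel (ball (0::real^'k) R)) + ennreal (scaled_kernel CARD('k) K r ?\<delta> * V)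
      = ennreal (scaled_kernel CARD('k) K r ?\<delta> * ((1 + \<epsilon>) * measure lborel (ball (0::real^'k) R) + V))"
    proof -
      have "0 \<le> V" by (simp add: V_def)
      then show ?thesis
        using \<epsilon> s0 by (subst ennreal_mult'[symmetric], simp, subst ennreal_plus[symmetric]) (auto simp: algebra_simps)
    qed
    ultimately show ?thesis by (simp add: distrib_left add.assoc)
  qed
  finally show ?thesis by (simp add: add_right_mono add_left_mono mult_left_mono)
qed

text \<open>Everything outside the chart is discarded; the integral over the ball alone already has
  the right limit by \<open>nn_integral_scaled_ball_tendsto\<close>.\<close>

lemma \<Phi>_lower:
  assumes N: "normal_chart p \<epsilon> R \<xi>" and \<epsilon>: "0 < \<epsilon>" and p: "p \<in> topspace T" and r: "r > 0"
  shows "ennreal (1 - \<epsilon>) * (\<integral>\<^sup>+v\<in>ball 0 R. ennreal (scaled_kernel CARD('k) K r ((1 + \<epsilon>) * norm (v :: real^'k))) \<partial>lborel) \<le> \<Phi> r p"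
proof -
  note D = normal_chartD[OF N]
  let ?f = "\<lambda>y. kw r (p, y)"
  have "ennreal (scaled_kernel CARD('k) K r ((1 + \<epsilon>) * norm v)) \<le> ?f (\<xi> v)" if v: "v \<in> ball 0 R" for v
    using D(7)[of 0 v] D(1,2) v \<epsilon> r by (intro kw_ge) auto
  then have "ennreal (1 - \<epsilon>) * (\<integral>\<^sup>+v\<in>ball 0 R. ennreal (scaled_kernel CARD('k) K r ((1 + \<epsilon>) * norm (v :: real^'k))) \<partial>lborel)
      \<le> ennreal (1 - \<epsilon>) * (\<integral>\<^sup>+v\<in>ball 0 R. ?f (\<xi> v) \<partial>lborel)"
    by (intro mult_left_mono nn_integral_mono) (auto split: split_indicator)
  also have "\<dots> \<le> (\<integral>\<^sup>+y\<in>\<xi> ` ball 0 R. ?f y \<partial>vol)" by (rule D(6)[OF kw_measurable_snd[OF r p]])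
  also have "\<dots> \<le> \<Phi> r p" unfolding \<Phi>_def by (intro nn_integral_mono) (auto simp: indicator_def)
  finally show ?thesis .
qed

text \<open>A chart of accuracy \<open>1/2\<close> bounds \<Phi> near its centre for all
  \<open>r\<close> at once, since the scaled kernel at a fixed positive distance is bounded in
  \<open>r\<close>. Compactness makes the bound global.\<close>

lemma \<Phi>_bounded: "\<exists>c\<ge>0. \<forall>x\<in>topspace T. \<forall>r>0. \<Phi> r x \<le> ennreal c"
proof -
  have "\<exists>W c. p \<in> W \<and> openin T W \<and> 0 \<le> c \<and> (\<forall>x\<in>W. \<forall>r>0. \<Phi> r x \<le> ennreal c)" if p: "p \<in> topspace T" for p
  proof -
    obtain R \<xi> where N: "normal_chart p (1/2) R \<xi>" using normal_chart_exists[OF p, of "1/2"] by auto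
    note D = normal_chartD[OF N]
    have pos: "(1 - 1/2) * (R/2) > 0" using D(1) by simp
    obtain b where b: "b \<ge> 0" "\<And>r. r > 0 \<Longrightarrow> scaled_kernel CARD('k) K r ((1 - 1/2) * (R/2)) \<le> b"
      using scaled_bounded[OF pos, of "CARD('k)"] by blast
    define m where "m = (1 + 1/2) * measure lborel (ball (0::real^'k) R) + V"
    have m: "m \<ge> 0" by (simp add: m_def V_def)
    define a where "a = enn2real (ennreal ((1 + 1/2) / (1 - 1/2) ^ CARD('k)) * (kernel_constant TYPE('k) K))"
    have a: "ennreal ((1 + 1/2) / (1 - 1/2) ^ CARD('k)) * (kernel_constant TYPE('k) K) = ennreal a" "0 \<le> a"
      using kernel_constant_finite[where 'k = 'k] by (auto simp: a_def ennreal_mult_less_top)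
    have "\<Phi> r x \<le> ennreal (a + b * m)" if x: "x \<in> \<xi> ` ball 0 (R/2)" and r: "r > 0" for x r
    proof -
      obtain u where u: "u \<in> ball 0 (R/2)" "x = \<xi> u" using x by blast
      have "\<Phi> r x \<le> ennreal a + ennreal (scaled_kernel CARD('k) K r ((1 - 1/2) * (R/2)) * m)"
        using \<Phi>_upper[OF N _ _ u(1) r] unfolding u(2) a(1)[symmetric] m_def by simp
      also have "\<dots> \<le> ennreal a + ennreal (b * m)"
        using b(2)[OF r] m by (intro add_left_mono ennreal_leI mult_right_mono)
      also have "\<dots> = ennreal (a + b * m)" using a b m by (simp add: ennreal_plus)
      finally show ?thesis .
    qed
    moreover have "p \<in> \<xi> ` ball 0 (R/2)" using D(1,2) by (intro image_eqI[of _ _ 0]) auto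
    moreover have "openin T (\<xi> ` ball 0 (R/2))" using D(1) by (intro D(4)) simp
    moreover have "0 \<le> a + b * m" using a b m by simp
    ultimately show ?thesis by blast
  qed
  then obtain W c where W: "\<And>p. p \<in> topspace T \<Longrightarrow> p \<in> W p \<and> openin T (W p)"
    and c: "\<And>p. p \<in> topspace T \<Longrightarrow> 0 \<le> c p" "\<And>p x r. p \<in> topspace T \<Longrightarrow> x \<in> W p \<Longrightarrow> r > 0 \<Longrightarrow> \<Phi> r x \<le> ennreal (c p)"
    by metis
  obtain F where F: "finite F" "F \<subseteq> topspace T" "topspace T \<subseteq> (\<Union>p\<in>F. W p)"
    using finite_subcover[of W] W by metis
  show ?thesis
  \<comment> \<open>The sum of the nonnegative local bounds serves as an upper bound for each of
    them.\<close>
  proof (intro exI[of _ "\<Sum>p\<in>F. c p"] conjI ballI allI impI)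
    show "0 \<le> (\<Sum>p\<in>F. c p)" using c F by (intro sum_nonneg) auto
    fix x r assume x: "x \<in> topspace T" and r: "(r::real) > 0"
    obtain p where p: "p \<in> F" "x \<in> W p" using x F(3) by blast
    have "\<Phi> r x \<le> ennreal (c p)" using c(2)[OF _ p(2) r] p F by blast
    also have "\<dots> \<le> ennreal (\<Sum>p\<in>F. c p)" using p F c by (intro ennreal_leI member_le_sum) auto
    finally show "\<Phi> r x \<le> ennreal (\<Sum>p\<in>F. c p)" .
  qed
qed

text \<open>For \<open>b\<close> on either side of the constant, \<epsilon> is fixed first so that
  the distortion factors do not reach \<open>b\<close>; then \<open>r\<close> tends to 0, which
  removes the far part above and restores the full integral below.\<close>

lemma \<Phi>_tendsto:
  assumes p: "p \<in> topspace T" and r: "\<And>n. r n > 0" "r \<longlonglongrightarrow> 0"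
  shows "(\<lambda>n. \<Phi> (r n) p) \<longlonglongrightarrow> (kernel_constant TYPE('k) K)"
proof -
  define c where "c = enn2real (kernel_constant TYPE('k) K)"
  have c: "(kernel_constant TYPE('k) K) = ennreal c" "c \<ge> 0" using kernel_constant_finite[where 'k = 'k] by (auto simp: c_def)
  have small: "\<forall>\<^sub>F \<epsilon> in at_right 0. 0 < \<epsilon> \<and> \<epsilon> < (1::real)"
    by (rule eventually_at_rightI[of 0 1]) auto
  have rr: "filterlim r (at_right 0) sequentially"
    using r by (intro tendsto_imp_filterlim_at_right) auto
  show ?thesis
  proof (rule order_tendstoI)
    fix b assume b: "(kernel_constant TYPE('k) K) < b"
    have "((\<lambda>\<epsilon>::real. (1 + \<epsilon>) / (1 - \<epsilon>) ^ CARD('k) * c) \<longlongrightarrow> (1 + 0) / (1 - 0) ^ CARD('k) * c) (at_right 0)"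
      by (intro tendsto_intros) auto
    then have "((\<lambda>\<epsilon>::real. ennreal ((1 + \<epsilon>) / (1 - \<epsilon>) ^ CARD('k) * c)) \<longlongrightarrow> (kernel_constant TYPE('k) K)) (at_right 0)"
      unfolding c(1) by (intro tendsto_ennrealI) simp
    then have "\<forall>\<^sub>F \<epsilon> in at_right 0. ennreal ((1 + \<epsilon>) / (1 - \<epsilon>) ^ CARD('k) * c) < b"
      using b by (rule order_tendstoD(2))
    with small have "\<forall>\<^sub>F \<epsilon> in at_right 0. (0 < \<epsilon> \<and> \<epsilon> < 1) \<and> ennreal ((1 + \<epsilon>) / (1 - \<epsilon>) ^ CARD('k) * c) < b"
      by (rule eventually_conj)
    then obtain \<epsilon> :: real where \<epsilon>: "0 < \<epsilon>" "\<epsilon> < 1" "ennreal ((1 + \<epsilon>) / (1 - \<epsilon>) ^ CARD('k) * c) < b"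
      using eventually_happens'[OF trivial_limit_at_right_real] by blast
    obtain R \<xi> where N: "normal_chart p \<epsilon> R \<xi>" using normal_chart_exists[OF p \<epsilon>(1,2)] by auto
    note D = normal_chartD[OF N]
    define m where "m = (1 + \<epsilon>) * measure lborel (ball (0::real^'k) R) + V"
    have le: "\<Phi> (r n) p \<le> ennreal ((1 + \<epsilon>) / (1 - \<epsilon>) ^ CARD('k) * c) + ennreal (scaled_kernel CARD('k) K (r n) ((1 - \<epsilon>) * (R/2)) * m)" for n
    proof -
      have "ennreal ((1 + \<epsilon>) / (1 - \<epsilon>) ^ CARD('k) * c) = ennreal ((1 + \<epsilon>) / (1 - \<epsilon>) ^ CARD('k)) * ennreal c"
        using \<epsilon> c(2) by (intro ennreal_mult) auto
      moreover have "0 \<in> ball (0::real^'k) (R/2)" using D(1) by simp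
      ultimately show ?thesis
        using \<Phi>_upper[OF N \<epsilon>(1,2) _ r(1), of 0 n] unfolding c(1) m_def D(2) by metis
    qed
    have "((\<lambda>r. scaled_kernel CARD('k) K r ((1 - \<epsilon>) * (R/2))) \<longlongrightarrow> 0) (at_right 0)"
      using D(1) \<epsilon> by (intro scaled_tendsto_0) simp
    then have "(\<lambda>n. scaled_kernel CARD('k) K (r n) ((1 - \<epsilon>) * (R/2))) \<longlonglongrightarrow> 0" using rr by (rule filterlim_compose)
    then have "(\<lambda>n. scaled_kernel CARD('k) K (r n) ((1 - \<epsilon>) * (R/2)) * m) \<longlonglongrightarrow> 0 * m" by (intro tendsto_intros)
    then have "(\<lambda>n. ennreal (scaled_kernel CARD('k) K (r n) ((1 - \<epsilon>) * (R/2)) * m)) \<longlonglongrightarrow> ennreal 0"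
      by (intro tendsto_ennrealI) simp
    then have "(\<lambda>n. ennreal ((1 + \<epsilon>) / (1 - \<epsilon>) ^ CARD('k) * c) + ennreal (scaled_kernel CARD('k) K (r n) ((1 - \<epsilon>) * (R/2)) * m))
      \<longlonglongrightarrow> ennreal ((1 + \<epsilon>) / (1 - \<epsilon>) ^ CARD('k) * c) + ennreal 0"
      by (intro tendsto_add tendsto_const)
    then have "\<forall>\<^sub>F n in sequentially. ennreal ((1 + \<epsilon>) / (1 - \<epsilon>) ^ CARD('k) * c) + ennreal (scaled_kernel CARD('k) K (r n) ((1 - \<epsilon>) * (R/2)) * m) < b"
      using \<epsilon>(3) by (intro order_tendstoD(2)) auto
    then show "\<forall>\<^sub>F n in sequentially. \<Phi> (r n) p < b"
      by eventually_elim (rule le_less_trans[OF le])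
  next
    fix b assume b: "b < (kernel_constant TYPE('k) K)"
    have "((\<lambda>\<epsilon>::real. (1 - \<epsilon>) / (1 + \<epsilon>) ^ CARD('k) * c) \<longlongrightarrow> (1 - 0) / (1 + 0) ^ CARD('k) * c) (at_right 0)"
      by (intro tendsto_intros) auto
    then have "((\<lambda>\<epsilon>::real. ennreal ((1 - \<epsilon>) / (1 + \<epsilon>) ^ CARD('k) * c)) \<longlongrightarrow> (kernel_constant TYPE('k) K)) (at_right 0)"
      unfolding c(1) by (intro tendsto_ennrealI) simp
    then have "\<forall>\<^sub>F \<epsilon> in at_right 0. b < ennreal ((1 - \<epsilon>) / (1 + \<epsilon>) ^ CARD('k) * c)"
      using b by (rule order_tendstoD(1))
    with small have "\<forall>\<^sub>F \<epsilon> in at_right 0. (0 < \<epsilon> \<and> \<epsilon> < 1) \<and> b < ennreal ((1 - \<epsilon>) / (1 + \<epsilon>) ^ CARD('k) * c)"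
      by (rule eventually_conj)
    then obtain \<epsilon> :: real where \<epsilon>: "0 < \<epsilon>" "\<epsilon> < 1" "b < ennreal ((1 - \<epsilon>) / (1 + \<epsilon>) ^ CARD('k) * c)"
      using eventually_happens'[OF trivial_limit_at_right_real] by blast
    obtain R \<xi> where N: "normal_chart p \<epsilon> R \<xi>" using normal_chart_exists[OF p \<epsilon>(1,2)] by auto
    note D = normal_chartD[OF N]
    let ?L = "\<lambda>n. ennreal (1 - \<epsilon>) * (\<integral>\<^sup>+v\<in>ball 0 R. ennreal (scaled_kernel CARD('k) K (r n) ((1 + \<epsilon>) * norm (v :: real^'k))) \<partial>lborel)"
    have "?L \<longlonglongrightarrow> ennreal (1 - \<epsilon>) * (ennreal (1 / (1 + \<epsilon>) ^ CARD('k)) * (kernel_constant TYPE('k) K))"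
      using \<epsilon> r D(1) by (intro ennreal_tendsto_cmult nn_integral_scaled_ball_tendsto) auto
    moreover have "ennreal (1 - \<epsilon>) * (ennreal (1 / (1 + \<epsilon>) ^ CARD('k)) * (kernel_constant TYPE('k) K)) = ennreal ((1 - \<epsilon>) / (1 + \<epsilon>) ^ CARD('k) * c)"
      using \<epsilon> c by (simp add: ennreal_mult'[symmetric])
    ultimately have "\<forall>\<^sub>F n in sequentially. b < ?L n" using \<epsilon>(3) by (intro order_tendstoD(1)) auto
    then show "\<forall>\<^sub>F n in sequentially. b < \<Phi> (r n) p"
      by eventually_elim (rule less_le_trans[OF _ \<Phi>_lower[OF N \<epsilon>(1) p r(1)]])
  qed
qed

text \<open>The converse of \<open>dist_nbhd\<close>: a neighbourhood in the manifold topology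
  contains a ball of the distance.\<close>

lemma dist_complement_pos:
  assumes A: "openin T A" and x: "x \<in> A"
  shows "\<exists>\<delta>>0. \<forall>y. y \<notin> A \<longrightarrow> ennreal \<delta> \<le> d x y"
proof -
  have xT: "x \<in> topspace T" using A x openin_subset by blast
  obtain R \<xi> where N: "normal_chart x (1/2) R \<xi>" using normal_chart_exists[OF xT, of "1/2"] by auto
  note D = normal_chartD[OF N]
  have "openin (top_of_set (ball 0 R)) {u \<in> topspace (top_of_set (ball 0 R)). \<xi> u \<in> A}"
    by (rule openin_continuous_map_preimage[OF D(3) A])
  then have "open {u \<in> ball 0 R. \<xi> u \<in> A}" by (simp add: openin_open_eq)
  moreover have "0 \<in> {u \<in> ball 0 R. \<xi> u \<in> A}" using D(1,2) x by simp
  ultimately obtain s where s: "s > 0" "ball 0 s \<subseteq> {u \<in> ball 0 R. \<xi> u \<in> A}" by (meson openE)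
  \<comment> \<open>The factor \<open>1/2\<close> is the accuracy of the chart; \<open>s\<close>
    handles points outside \<open>A\<close> within the chart, and \<open>R/2\<close> those outside
    the chart.\<close>
  define \<delta> where "\<delta> = 1/2 * min s (R/2)"
  have \<delta>: "\<delta> > 0" using s(1) D(1) by (simp add: \<delta>_def)
  have 0: "(0::real^'k) \<in> ball 0 (R/2)" using D(1) by simp
  have "ennreal \<delta> \<le> d x y" if y: "y \<notin> A" for y
  proof (cases "y \<in> \<xi> ` ball 0 R")
    case True
    then obtain v where v: "v \<in> ball 0 R" "y = \<xi> v" by blast
    have "v \<notin> ball 0 s" using s(2) y v(2) by blast
    then have "\<delta> \<le> (1 - 1/2) * min (norm (0 - v)) (R/2)" by (auto simp: \<delta>_def min_def)
    then show ?thesis using D(8)[OF 0 v(1)] D(2) v(2) by (metis ennreal_leI order_trans)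
  next
    case False
    have "\<delta> \<le> (1 - 1/2) * (R/2)" by (simp add: \<delta>_def)
    then show ?thesis using D(9)[OF 0 False] D(2) by (metis ennreal_leI order_trans)
  qed
  then show ?thesis using \<delta> by blast
qed

section \<open>The kernel measure of rectangles\<close>

definition "mass r A C = (\<integral>\<^sup>+x\<in>A. (\<integral>\<^sup>+y\<in>C. kw r (x, y) \<partial>vol) \<partial>vol)"

lemma sigma_finite_vol: "sigma_finite_measure vol"
  using finite_measure_vol by (simp add: finite_measure_def)

lemma sets_vol_pair: "sets (vol \<Otimes>\<^sub>M vol) = sets (B \<Otimes>\<^sub>M B)"
  by (intro sets_pair_measure_cong sets_vol)

lemma kw_measurable_vol: "r > 0 \<Longrightarrow> kw r \<in> borel_measurable (vol \<Otimes>\<^sub>M vol)"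
  using kw_measurable by (simp only: measurable_cong_sets[OF sets_vol_pair refl])

lemma kw_ind_measurable:
  assumes "r > 0" "A \<in> sets B" "C \<in> sets B"
  shows "(\<lambda>z. kw r z * indicator (A \<times> C) z) \<in> borel_measurable (vol \<Otimes>\<^sub>M vol)"
  using assms
  by (intro borel_measurable_times_ennreal borel_measurable_indicator kw_measurable_vol pair_measureI) simp_all

lemma inner_measurable:
  assumes "r > 0" "C \<in> sets B"
  shows "(\<lambda>x. \<integral>\<^sup>+y\<in>C. kw r (x, y) \<partial>vol) \<in> borel_measurable vol"
proof -
  have T: "topspace T \<in> sets B" using sets.top[of B] by simp
  let ?g = "\<lambda>x. \<integral>\<^sup>+y. kw r (x, y) * indicator (topspace T \<times> C) (x, y) \<partial>vol"
  have g: "?g \<in> borel_measurable vol"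
    using sigma_finite_measure.borel_measurable_nn_integral_fst[OF sigma_finite_vol kw_ind_measurable[OF assms(1) T assms(2)]] .
  have eq: "(\<integral>\<^sup>+y\<in>C. kw r (x, y) \<partial>vol) = ?g x" if "x \<in> space vol" for x
    using that by (simp add: indicator_times)
  show ?thesis using g measurable_cong[of vol _ ?g borel, OF eq] by (rule iffD2[rotated])
qed

lemma mass_iterated: "mass r A C = (\<integral>\<^sup>+x. \<integral>\<^sup>+y. kw r (x, y) * indicator (A \<times> C) (x, y) \<partial>vol \<partial>vol)"
  unfolding mass_def
proof (intro nn_integral_cong)
  fix x
  show "(\<integral>\<^sup>+y\<in>C. kw r (x, y) \<partial>vol) * indicator A x = (\<integral>\<^sup>+y. kw r (x, y) * indicator (A \<times> C) (x, y) \<partial>vol)"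
    by (cases "x \<in> A") (simp_all add: indicator_times)
qed

lemma mass_eq:
  assumes "r > 0" "A \<in> sets B" "C \<in> sets B"
  shows "mass r A C = (\<integral>\<^sup>+z. kw r z * indicator (A \<times> C) z \<partial>(vol \<Otimes>\<^sub>M vol))"
proof -
  have "mass r A C = (\<integral>\<^sup>+x. \<integral>\<^sup>+y. kw r (x, y) * indicator (A \<times> C) (x, y) \<partial>vol \<partial>vol)"
    by (rule mass_iterated)
  also have "\<dots> = (\<integral>\<^sup>+z. kw r z * indicator (A \<times> C) z \<partial>(vol \<Otimes>\<^sub>M vol))"
    by (rule sigma_finite_measure.nn_integral_fst[OF sigma_finite_vol kw_ind_measurable[OF assms]])
  finally show ?thesis .
qed

text \<open>Fubini together with \<open>kw_sym\<close>. This will carry the vanishing of the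
  crossing mass from a set to its complement.\<close>

lemma mass_sym:
  assumes "r > 0" "A \<in> sets B" "C \<in> sets B"
  shows "mass r A C = mass r C A"
proof -
  interpret pair_sigma_finite vol vol by (intro pair_sigma_finite.intro sigma_finite_vol)
  have "mass r A C = (\<integral>\<^sup>+x. \<integral>\<^sup>+y. kw r (x, y) * indicator (A \<times> C) (x, y) \<partial>vol \<partial>vol)"
    by (rule mass_iterated)
  also have "\<dots> = (\<integral>\<^sup>+y. \<integral>\<^sup>+x. kw r (x, y) * indicator (A \<times> C) (x, y) \<partial>vol \<partial>vol)"
    using Fubini[OF kw_ind_measurable[OF assms]] by simp
  also have "\<dots> = mass r C A"
    unfolding mass_def
  proof (intro nn_integral_cong)
    fix y
    show "(\<integral>\<^sup>+x. kw r (x, y) * indicator (A \<times> C) (x, y) \<partial>vol) = (\<integral>\<^sup>+x\<in>A. kw r (y, x) \<partial>vol) * indicator C y"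
      by (cases "y \<in> C") (simp_all add: indicator_times kw_sym[of r _ y])
  qed
  finally show ?thesis .
qed

lemma emeasure_kernel_measure:
  assumes "r > 0" "A \<in> sets B"
  shows "emeasure (kernel_measure M K r) (A \<times> A) = mass r A A"
proof -
  have eq: "(\<lambda>(x, y). ennreal (kernel_weight M K r x y)) = kw r"
    by (rule ext) (simp only: kw_def case_prod_beta)
  show ?thesis
    unfolding kernel_measure_def eq mass_eq[OF assms assms(2)]
    using assms by (intro emeasure_density kw_measurable_vol pair_measureI) simp_all
qed

lemma mass_space:
  assumes "r > 0"
  shows "mass r A (topspace T) = (\<integral>\<^sup>+x\<in>A. \<Phi> r x \<partial>vol)"
proof -
  have "(\<integral>\<^sup>+y\<in>topspace T. kw r (x, y) \<partial>vol) = \<Phi> r x" for x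
    unfolding \<Phi>_def by (rule nn_integral_cong) simp
  then show ?thesis by (simp add: mass_def)
qed

lemma mass_space_split:
  assumes "r > 0" "A \<in> sets B" "C \<in> sets B"
  shows "mass r A (topspace T) = mass r A C + mass r A (topspace T - C)"
proof -
  have C': "topspace T - C \<in> sets B" using sets.compl_sets[OF assms(3)] by simp
  have "(\<integral>\<^sup>+y\<in>topspace T. kw r (x, y) \<partial>vol) = (\<integral>\<^sup>+y\<in>C. kw r (x, y) \<partial>vol) + (\<integral>\<^sup>+y\<in>topspace T - C. kw r (x, y) \<partial>vol)"
    if x: "x \<in> topspace T" for x
  proof -
    have m: "(\<lambda>y. kw r (x, y)) \<in> borel_measurable vol"
      using kw_measurable_snd[OF assms(1) x] by (simp add: measurable_cong_sets[OF sets_vol refl])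
    have "(\<integral>\<^sup>+y\<in>topspace T. kw r (x, y) \<partial>vol) = (\<integral>\<^sup>+y. kw r (x, y) * indicator C y + kw r (x, y) * indicator (topspace T - C) y \<partial>vol)"
      by (intro nn_integral_cong) (auto simp: indicator_def)
    also have "\<dots> = (\<integral>\<^sup>+y\<in>C. kw r (x, y) \<partial>vol) + (\<integral>\<^sup>+y\<in>topspace T - C. kw r (x, y) \<partial>vol)"
      using m assms C' by (intro nn_integral_add borel_measurable_times_ennreal) auto
    finally show ?thesis .
  qed
  then have "mass r A (topspace T) = (\<integral>\<^sup>+x. (\<integral>\<^sup>+y\<in>C. kw r (x, y) \<partial>vol) * indicator A x
      + (\<integral>\<^sup>+y\<in>topspace T - C. kw r (x, y) \<partial>vol) * indicator A x \<partial>vol)"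
    unfolding mass_def by (intro nn_integral_cong) (simp add: distrib_right)
  also have "\<dots> = mass r A C + mass r A (topspace T - C)"
    unfolding mass_def using assms C'
    by (intro nn_integral_add borel_measurable_times_ennreal inner_measurable) auto
  finally show ?thesis .
qed

lemma mass_union_le:
  assumes "r > 0" "A \<in> sets B" "A' \<in> sets B" "C \<in> sets B" "D \<subseteq> A \<union> A'"
  shows "mass r D C \<le> mass r A C + mass r A' C"
proof -
  let ?g = "\<lambda>x. \<integral>\<^sup>+y\<in>C. kw r (x, y) \<partial>vol"
  have "mass r D C \<le> (\<integral>\<^sup>+x. ?g x * indicator A x + ?g x * indicator A' x \<partial>vol)"
    unfolding mass_def using assms(5) by (intro nn_integral_mono) (auto simp: indicator_def)
  also have "\<dots> = mass r A C + mass r A' C"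
    unfolding mass_def using assms
    by (intro nn_integral_add borel_measurable_times_ennreal inner_measurable) auto
  finally show ?thesis .
qed

section \<open>Bounds and limits of the mass\<close>

lemma mass_mono: "C \<subseteq> C' \<Longrightarrow> mass r A C \<le> mass r A C'"
  unfolding mass_def
  by (intro nn_integral_mono mult_right_mono) (auto simp: indicator_def)

lemma inner_le: "(\<integral>\<^sup>+y\<in>C. kw r (x, y) \<partial>vol) \<le> \<Phi> r x"
  unfolding \<Phi>_def by (intro nn_integral_mono) (auto simp: indicator_def)

text \<open>Converts small volume into small mass, uniformly in \<open>r\<close> once the bound from
  \<open>\<Phi>_bounded\<close> is inserted.\<close>

lemma mass_le:
  assumes c: "\<And>x. x \<in> topspace T \<Longrightarrow> \<Phi> r x \<le> c" and A: "A \<in> sets B"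
  shows "mass r A C \<le> c * emeasure vol A"
proof -
  have "mass r A C \<le> (\<integral>\<^sup>+x. c * indicator A x \<partial>vol)"
    unfolding mass_def
    by (intro nn_integral_mono mult_right_mono order_trans[OF inner_le c]) auto
  also have "\<dots> = c * emeasure vol A" using A by (simp add: nn_integral_cmult_indicator)
  finally show ?thesis .
qed

text \<open>Pointwise convergence of \<Phi> and dominated convergence; the constant majorant is
  integrable because the volume is finite.\<close>

lemma mass_space_tendsto:
  assumes r: "\<And>n. r n > 0" "r \<longlonglongrightarrow> 0" and A: "A \<in> sets B"
  shows "(\<lambda>n. mass (r n) A (topspace T)) \<longlonglongrightarrow> (kernel_constant TYPE('k) K) * emeasure vol A"
proof -
  obtain c where c: "c \<ge> 0" "\<And>x r. x \<in> topspace T \<Longrightarrow> r > 0 \<Longrightarrow> \<Phi> r x \<le> ennreal c"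
    using \<Phi>_bounded by blast
  have Tm: "topspace T \<in> sets B" using sets.top[of B] by simp
  have \<Phi>m: "\<Phi> (r n) \<in> borel_measurable vol" for n
  proof -
    have "(\<lambda>x. \<integral>\<^sup>+y\<in>topspace T. kw (r n) (x, y) \<partial>vol) \<in> borel_measurable vol"
      by (rule inner_measurable[OF r(1) Tm])
    moreover have "(\<lambda>x. \<integral>\<^sup>+y\<in>topspace T. kw (r n) (x, y) \<partial>vol) = \<Phi> (r n)"
      unfolding \<Phi>_def by (intro ext nn_integral_cong) auto
    ultimately show ?thesis by simp
  qed
  have "(\<lambda>n. \<integral>\<^sup>+x. \<Phi> (r n) x * indicator A x \<partial>vol) \<longlonglongrightarrow> (\<integral>\<^sup>+x. (kernel_constant TYPE('k) K) * indicator A x \<partial>vol)"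
  proof (rule nn_integral_dominated_convergence[where w = "\<lambda>_. ennreal c"])
    show "(\<lambda>x. \<Phi> (r n) x * indicator A x) \<in> borel_measurable vol" for n
      using \<Phi>m A by (intro borel_measurable_times_ennreal) auto
    show "(\<lambda>x. (kernel_constant TYPE('k) K) * indicator A x) \<in> borel_measurable vol" using A by auto
    show "AE x in vol. \<Phi> (r n) x * indicator A x \<le> ennreal c" for n
      using c(2)[OF _ r(1)] by (intro AE_I2) (auto simp: indicator_def)
    show "(\<integral>\<^sup>+x. ennreal c \<partial>vol) < \<infinity>" using emeasure_V by (simp add: ennreal_mult_less_top)
    show "AE x in vol. (\<lambda>n. \<Phi> (r n) x * indicator A x) \<longlonglongrightarrow> (kernel_constant TYPE('k) K) * indicator A x"
      using \<Phi>_tendsto[OF _ r] by (intro AE_I2) (auto simp: indicator_def)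
  qed simp
  then show ?thesis
    using A by (simp add: mass_space[OF r(1)] nn_integral_cmult_indicator)
qed

text \<open>A point of \<open>A\<close> has some distance \<delta> > 0 from the complement, so its
  inner integral is at most the scaled kernel at \<delta> times the volume and tends to 0. The bound
  on \<Phi> is the majorant.\<close>

lemma mass_complement_tendsto_open:
  assumes r: "\<And>n. r n > 0" "r \<longlonglongrightarrow> 0" and A: "openin T A"
  shows "(\<lambda>n. mass (r n) A (topspace T - A)) \<longlonglongrightarrow> 0"
proof -
  obtain c where c: "c \<ge> 0" "\<And>x r. x \<in> topspace T \<Longrightarrow> r > 0 \<Longrightarrow> \<Phi> r x \<le> ennreal c"
    using \<Phi>_bounded by blast
  have AB: "A \<in> sets B" using A by (rule openin_sets_B)
  have A': "topspace T - A \<in> sets B" using sets.compl_sets[OF AB] by simp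
  have rr: "filterlim r (at_right 0) sequentially"
    using r by (intro tendsto_imp_filterlim_at_right) auto
  let ?g = "\<lambda>n x. \<integral>\<^sup>+y\<in>topspace T - A. kw (r n) (x, y) \<partial>vol"
  have "(\<lambda>n. \<integral>\<^sup>+x. ?g n x * indicator A x \<partial>vol) \<longlonglongrightarrow> (\<integral>\<^sup>+x. 0 \<partial>vol)"
  proof (rule nn_integral_dominated_convergence[where w = "\<lambda>_. ennreal c"])
    show "(\<lambda>x. ?g n x * indicator A x) \<in> borel_measurable vol" for n
      using AB A' r(1) by (intro borel_measurable_times_ennreal inner_measurable) auto
    show "AE x in vol. ?g n x * indicator A x \<le> ennreal c" for n
      using order_trans[OF inner_le c(2)[OF _ r(1)]] by (intro AE_I2) (auto split: split_indicator)
    show "(\<integral>\<^sup>+x. ennreal c \<partial>vol) < \<infinity>" using emeasure_V by (simp add: ennreal_mult_less_top)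
    show "AE x in vol. (\<lambda>n. ?g n x * indicator A x) \<longlonglongrightarrow> 0"
    proof (intro AE_I2)
      fix x
      show "(\<lambda>n. ?g n x * indicator A x) \<longlonglongrightarrow> 0"
      proof (cases "x \<in> A")
        case True
        obtain \<delta> where \<delta>: "\<delta> > 0" "\<And>y. y \<notin> A \<Longrightarrow> ennreal \<delta> \<le> d x y"
          using dist_complement_pos[OF A True] by blast
        have le: "?g n x * indicator A x \<le> ennreal (scaled_kernel CARD('k) K (r n) \<delta> * V)" for n
        proof -
          have "kw (r n) (x, y) \<le> ennreal (scaled_kernel CARD('k) K (r n) \<delta>)" if "y \<notin> A" for y
            using kw_le[OF r(1) _ \<delta>(2)[OF that]] \<delta>(1) by simp
          then have "?g n x \<le> (\<integral>\<^sup>+y. ennreal (scaled_kernel CARD('k) K (r n) \<delta>) \<partial>vol)"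
            by (intro nn_integral_mono) (auto split: split_indicator)
          then have "?g n x * indicator A x \<le> (\<integral>\<^sup>+y. ennreal (scaled_kernel CARD('k) K (r n) \<delta>) \<partial>vol)"
            using True by (simp only: indicator_simps mult_1_right)
          also have "\<dots> = ennreal (scaled_kernel CARD('k) K (r n) \<delta> * V)"
            using emeasure_V scaled_nonneg[OF r(1), of \<delta>] \<delta>(1) by (simp add: ennreal_mult')
          finally show ?thesis .
        qed
        have "(\<lambda>n. scaled_kernel CARD('k) K (r n) \<delta>) \<longlonglongrightarrow> 0" using scaled_tendsto_0[OF \<delta>(1)] rr by (rule filterlim_compose)
        then have "(\<lambda>n. scaled_kernel CARD('k) K (r n) \<delta> * V) \<longlonglongrightarrow> 0 * V" by (intro tendsto_intros)
        then have lim: "(\<lambda>n. ennreal (scaled_kernel CARD('k) K (r n) \<delta> * V)) \<longlonglongrightarrow> 0" using tendsto_ennrealI by fastforce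
        show ?thesis
          by (rule tendsto_sandwich[OF _ _ tendsto_const lim]) (auto simp: le)
      qed simp
    qed
  qed auto
  then show ?thesis by (simp add: mass_def)
qed

text \<open>Induction over the generation of the Borel sets from the open ones; countable unions are
  the substantial case.\<close>

lemma mass_complement_tendsto:
  assumes r: "\<And>n. r n > 0" "r \<longlonglongrightarrow> 0" and A: "A \<in> sets B"
  shows "(\<lambda>n. mass (r n) A (topspace T - A)) \<longlonglongrightarrow> 0"
proof -
  obtain c where c: "c \<ge> 0" "\<And>x r. x \<in> topspace T \<Longrightarrow> r > 0 \<Longrightarrow> \<Phi> r x \<le> ennreal c"
    using \<Phi>_bounded by blast
  interpret finite_measure vol by (rule finite_measure_vol)
  have "A \<in> sigma_sets (topspace T) {U. openin T U}" using A by (simp add: sets_B)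
  then show ?thesis
  proof induction
    case (Basic A)
    then show ?case using mass_complement_tendsto_open[OF r] by simp
  next
    case Empty
    then show ?case by (simp add: mass_def)
  next
    case (Compl A)
    have AB: "A \<in> sets B" using Compl(1) by (simp add: sets_B)
    have A': "topspace T - A \<in> sets B" using sets.compl_sets[OF AB] by simp
    \<comment> \<open>Passing to the complement exchanges the two factors, and
      \<open>mass_sym\<close> exchanges them back.\<close>
    have "topspace T - (topspace T - A) = A" using sets.sets_into_space[OF AB] by auto
    then have "mass (r n) (topspace T - A) (topspace T - (topspace T - A)) = mass (r n) A (topspace T - A)" for n
      using mass_sym[OF r(1) AB A', of n] by simp
    then show ?case using Compl(2) by simp
  next
    case (Union A)
    have AB: "A i \<in> sets B" for i using Union(1)[of i] by (simp add: sets_B)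
    define U where "U = (\<Union>i. A i)"
    have UB: "U \<in> sets B" unfolding U_def using AB by auto
    have U': "topspace T - U \<in> sets B" using sets.compl_sets[OF UB] by simp
    \<comment> \<open>The part of the union missed by the first sets; its volume tends to 0 because
      the total volume is finite.\<close>
    define D where "D k = U - (\<Union>i\<le>k. A i)" for k
    have DB: "D k \<in> sets B" for k unfolding D_def using UB AB by auto
    have "decseq D" unfolding D_def decseq_def by force
    then have "(\<lambda>k. emeasure vol (D k)) \<longlonglongrightarrow> emeasure vol (\<Inter>k. D k)"
      using DB by (intro Lim_emeasure_decseq) auto
    moreover have "(\<Inter>k. D k) = {}" by (auto simp: D_def U_def)
    ultimately have "(\<lambda>k. ennreal c * emeasure vol (D k)) \<longlonglongrightarrow> ennreal c * 0"
      by (intro ennreal_tendsto_cmult) auto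
    then have Dlim: "(\<lambda>k. ennreal c * emeasure vol (D k)) \<longlonglongrightarrow> 0" by simp
    \<comment> \<open>The complement of \<open>U\<close> lies in the complement of each
      \<open>A i\<close>, so each term can be enlarged to one covered by the induction
      hypothesis.\<close>
    have fin_union: "mass (r n) (\<Union>i\<le>k. A i) (topspace T - U) \<le> (\<Sum>i\<le>k. mass (r n) (A i) (topspace T - A i))" for n k
    proof (induction k)
      case 0
      show ?case by (simp, intro mass_mono) (auto simp: U_def)
    next
      case (Suc k)
      have "mass (r n) (\<Union>i\<le>Suc k. A i) (topspace T - U)
        \<le> mass (r n) (\<Union>i\<le>k. A i) (topspace T - U) + mass (r n) (A (Suc k)) (topspace T - U)"
        using AB U' r(1) by (intro mass_union_le) (auto simp: atMost_Suc)
      also have "\<dots> \<le> (\<Sum>i\<le>k. mass (r n) (A i) (topspace T - A i)) + mass (r n) (A (Suc k)) (topspace T - A (Suc k))"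
        by (intro add_mono Suc mass_mono) (auto simp: U_def)
      finally show ?case by simp
    qed
    have bound: "mass (r n) U (topspace T - U)
        \<le> (\<Sum>i\<le>k. mass (r n) (A i) (topspace T - A i)) + ennreal c * emeasure vol (D k)" for n k
    proof -
      have "mass (r n) U (topspace T - U) \<le> mass (r n) (\<Union>i\<le>k. A i) (topspace T - U) + mass (r n) (D k) (topspace T - U)"
        using AB DB U' r(1) by (intro mass_union_le) (auto simp: D_def)
      also have "\<dots> \<le> (\<Sum>i\<le>k. mass (r n) (A i) (topspace T - A i)) + ennreal c * emeasure vol (D k)"
        using c(2) r(1) DB by (intro add_mono fin_union mass_le) auto
      finally show ?thesis .
    qed
    have "(\<lambda>n. mass (r n) U (topspace T - U)) \<longlonglongrightarrow> 0"
    proof (rule order_tendstoI)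
      \<comment> \<open>First \<open>k\<close> is chosen to make the tail term smaller than
        \<open>e\<close> for every \<open>n\<close>; only then does \<open>n\<close> grow in the
        remaining finite sum.\<close>
      fix e :: ennreal assume e: "0 < e"
      have "\<forall>\<^sub>F k in sequentially. ennreal c * emeasure vol (D k) < e" using Dlim e by (rule order_tendstoD(2))
      then obtain k where k: "ennreal c * emeasure vol (D k) < e" by (auto simp: eventually_sequentially)
      have "(\<lambda>n. (\<Sum>i\<le>k. mass (r n) (A i) (topspace T - A i)) + ennreal c * emeasure vol (D k))
          \<longlonglongrightarrow> (\<Sum>i\<le>k. 0) + ennreal c * emeasure vol (D k)"
        by (intro tendsto_add tendsto_sum tendsto_const Union(2))
      then have "\<forall>\<^sub>F n in sequentially. (\<Sum>i\<le>k. mass (r n) (A i) (topspace T - A i)) + ennreal c * emeasure vol (D k) < e"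
        using k by (intro order_tendstoD(2)) auto
      then show "\<forall>\<^sub>F n in sequentially. mass (r n) U (topspace T - U) < e"
        by eventually_elim (rule le_less_trans[OF bound])
    qed simp
    then show ?case by (simp add: U_def)
  qed
qed

text \<open>The square is what remains of the strip over \<open>A\<close> after removing the
  crossing mass. The limit is taken along sequences, which the dominated convergence arguments
  require.\<close>

lemma emeasure_kernel_measure_tendsto:
  assumes A: "A \<in> sets B"
  shows "((\<lambda>r. emeasure (kernel_measure M K r) (A \<times> A)) \<longlongrightarrow> (kernel_constant TYPE('k) K) * emeasure vol A) (at_right 0)"
  unfolding tendsto_at_iff_sequentially
proof (intro allI impI)
  fix r :: "nat \<Rightarrow> real" assume "\<forall>i. r i \<in> {0<..} - {0}" "r \<longlonglongrightarrow> 0"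
  then have r: "\<And>n. r n > 0" "r \<longlonglongrightarrow> 0" by auto
  interpret finite_measure vol by (rule finite_measure_vol)
  obtain c where c: "c \<ge> 0" "\<And>x r. x \<in> topspace T \<Longrightarrow> r > 0 \<Longrightarrow> \<Phi> r x \<le> ennreal c"
    using \<Phi>_bounded by blast
  \<comment> \<open>Finiteness is needed to cancel the crossing mass in the subtraction on
    \<open>ennreal\<close>.\<close>
  have fin: "mass (r n) A C < \<infinity>" for n C
  proof -
    have "mass (r n) A C \<le> ennreal c * emeasure vol A" using c(2) r(1) A by (intro mass_le) auto
    also have "\<dots> < \<infinity>" by (simp add: ennreal_mult_less_top emeasure_eq_measure)
    finally show ?thesis .
  qed
  have "(\<lambda>n. mass (r n) A (topspace T) - mass (r n) A (topspace T - A)) \<longlonglongrightarrow> (kernel_constant TYPE('k) K) * emeasure vol A - 0"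
  proof (rule tendsto_diff_ennreal[OF mass_space_tendsto[OF r A] mass_complement_tendsto[OF r A]])
    show "(kernel_constant TYPE('k) K) * emeasure vol A \<noteq> top"
      using kernel_constant_finite[where 'k = 'k] by (simp add: ennreal_mult_eq_top_iff less_top)
  qed simp
  moreover have "mass (r n) A (topspace T) - mass (r n) A (topspace T - A) = emeasure (kernel_measure M K (r n)) (A \<times> A)" for n
    using fin[of n "topspace T - A"] mass_space_split[OF r(1) A A, of n] emeasure_kernel_measure[OF r(1) A, of n]
    by (simp add: ennreal_add_diff_cancel_right)
  ultimately show "((\<lambda>r. emeasure (kernel_measure M K r) (A \<times> A)) \<circ> r) \<longlonglongrightarrow> (kernel_constant TYPE('k) K) * emeasure vol A"
    by (simp add: o_def)
qed

end

theorem theorem1p2: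
  fixes M :: "('a, 'i, 'k::finite) riemannian"
    and K :: "real \<Rightarrow> real"
    and A :: "'a set"
  assumes "closed_riemannian_manifold M"
    and "\<And>t. t \<ge> 0 \<Longrightarrow> K t \<ge> 0"
    and "K 0 > 0"
    and "antimono_on {0..} K"
    and "\<And>n::nat. n \<ge> 1 \<Longrightarrow> set_integrable lborel {0..} (\<lambda>t. K t * t ^ n)"
    and "A \<in> sets (borel_manifold M)"
  shows "((\<lambda>r. emeasure (kernel_measure M K r) (A \<times> A)) \<longlongrightarrow>
           kernel_constant TYPE('k) K * emeasure (riemannian_volume M) A) (at_right 0)"
proof -
  interpret kernel_manifold M K
    by unfold_locales (use assms in auto)
  show ?thesis by (rule emeasure_kernel_measure_tendsto[OF assms(6)])
qed

end
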